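(* Let $\Delta$ be a finite irreducible reduced root system with positive system $\Delta_+$ and Weyl group $W$, let $\Delta^*\subset\Delta_+$ be a root set, and let $\mathbf y\in V$. Let $\mathbf k=(k_\alpha)_{\alpha\in\Delta_+}$ with $k_\alpha\in\mathbb Z_{\ge2}$ for $\alpha\in\Delta^*$ and $k_\alpha=0$ for $\alpha\in\Delta_+\setminus\Delta^*$, and write $\mathbf k_{\Delta^*}=(k_\alpha)_{\alpha\in\Delta^*}$. Then, provided all the series on the left-hand side converge absolutely, $$\sum_{w\in W}\Bigl(\prod_{\alpha\in\Delta_+\cap w\Delta_-}(-1)^{k_\alpha}\Bigr)\zeta_r(w^{-1}\mathbf k,w^{-1}\mathbf y;\Delta)=(-1)^{|\Delta_+|}\mathcal P_{\Delta^*}(\mathbf k_{\Delta^*},\mathbf y;\Delta)\prod_{\alpha\in\Delta^*}\frac{(2\pi i)^{k_\alpha}}{k_\alpha!}.$$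
   Context: Let $V$ be an $r$-dimensional real vector space with inner product $\langle\cdot,\cdot\rangle$, $\Delta\subset V$ a finite irreducible reduced root system, $\Delta_+$ a fixed set of positive roots, $\Delta_-=-\Delta_+$, $\{\alpha_1,\ldots,\alpha_r\}$ the fundamental system, $\alpha^\vee=2\alpha/\langle\alpha,\alpha\rangle$, $Q^\vee=\bigoplus_i\mathbb Z\alpha_i^\vee$, $\lambda_j$ the fundamental weights ($\langle\alpha_i^\vee,\lambda_j\rangle=\delta_{ij}$), $P_{++}=\bigoplus_i\mathbb N\lambda_i$ ($\mathbb N=\{1,2,\ldots\}$), $W$ the Weyl group acting on $V$. A root set is a subset $\Delta^*\subset\Delta_+$ such that for each $j$ some $\alpha\in\Delta^*$ has $\langle\alpha,\lambda_j\rangle\neq0$. For $\mathbf s=(s_\alpha)_{\alpha\in\Delta_+}$ and $\mathbf y\in V$, $\zeta_r(\mathbf s,\mathbf y;\Delta)=\sum_{\lambda\in P_{++}}e^{2\pi i\langle\mathbf y,\lambda\rangle}\prod_{\alpha\in\Delta_+}\langle\alpha^\vee,\lambda\rangle^{-s_\alpha}$. For $w\in W$, $(w\mathbf s)_\alpha=s_{w^{-1}\alpha}$, with the convention $s_{-\beta}=s_\beta$ when $w^{-1}\alpha\in\Delta_-$. Let $\mathscr V$ be the set of subsets $\mathbf V\subset\Delta_+$ that are bases of $V$; for $\mathbf V\in\mathscr V$ let $\{\mu^{\mathbf V}_\beta\}_{\beta\in\mathbf V}$ be the basis dual to $\{\beta^\vee\}_{\beta\in\mathbf V}$, and $L(\mathbf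 V^\vee)=\bigoplus_{\beta\in\mathbf V}\mathbb Z\beta^\vee$. Fix $\phi\in V$ with $\langle\phi,\mu^{\mathbf V}_\beta\rangle\neq0$ for all $\mathbf V,\beta$ ($\phi=\alpha_1^\vee$ in type $A_1$). Put $\{\mathbf y\}_{\mathbf V,\beta}=\{\langle\mathbf y,\mu^{\mathbf V}_\beta\rangle\}$ if $\langle\phi,\mu^{\mathbf V}_\beta\rangle>0$ and $1-\{-\langle\mathbf y,\mu^{\mathbf V}_\beta\rangle\}$ otherwise ($\{x\}$ = fractional part). Write $A=\Delta_+\setminus\Delta^*=\{\nu_1,\ldots,\nu_N\}$ (fixed ordering), $A_0=\emptyset$, $A_j=\{\nu_1,\ldots,\nu_j\}$, $\mathscr V_A=\{\mathbf V\in\mathscr V:\nu_{j+1}\notin\mathrm{L.h.}[\mathbf V\cap A_j]\ (0\le j\le N-1)\}$ (L.h. = linear span). For $\mathbf t_{\Delta^*}=(t_\alpha)_{\alpha\in\Delta^*}$, $$F_{\Delta^*}(\mathbf t_{\Delta^*},\mathbf y;\Delta)=\sum_{\mathbf V\in\mathscr V_A}(-1)^{|A\setminus\mathbf V|}\Bigl(\prod_{\gamma\in\Delta_+\setminus(\mathbf V\cup A)}\frac{t_\gamma}{t_\gamma-\sum_{\beta\in\mathbf V\setminus A}t_\beta\langle\gamma^\vee,\mu^{\mathbf V}_\beta\rangle}\Bigr)\frac{1}{|Q^\vee/L(\mathbf V^\vee)|}\sum_{q\in Q^\vee/L(\mathbf V^\vee)}\prod_{\beta\in\mathbf V\setminus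 A}\frac{t_\beta\exp(t_\beta\{\mathbf y+q\}_{\mathbf V,\beta})}{e^{t_\beta}-1},$$ which is holomorphic in $\mathbf t_{\Delta^*}$ near the origin, and $\mathcal P_{\Delta^*}(\mathbf k_{\Delta^*},\mathbf y;\Delta)$ is defined by $F_{\Delta^*}(\mathbf t_{\Delta^*},\mathbf y;\Delta)=\sum_{\mathbf k_{\Delta^*}\in\mathbb N_0^{|\Delta^*|}}\mathcal P_{\Delta^*}(\mathbf k_{\Delta^*},\mathbf y;\Delta)\prod_{\alpha\in\Delta^*}t_\alpha^{k_\alpha}/k_\alpha!$. *)

theory Defs
  imports "HOL-Analysis.Analysis"
begin

definition coroot :: "'a::euclidean_space \<Rightarrow> 'a" where
  "coroot \<alpha> = (2 / (\<alpha> \<bullet> \<alpha>)) *\<^sub>R \<alpha>"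

definition reflection :: "'a::euclidean_space \<Rightarrow> 'a \<Rightarrow> 'a" where
  "reflection \<alpha> v = v - (coroot \<alpha> \<bullet> v) *\<^sub>R \<alpha>"

definition root_system :: "'a::euclidean_space set \<Rightarrow> bool" where
  "root_system R \<longleftrightarrow> finite R \<and> 0 \<notin> R \<and> span R = UNIV \<and>
     (\<forall>\<alpha>\<in>R. \<forall>\<beta>\<in>R. reflection \<alpha> \<beta> \<in> R) \<and>
     (\<forall>\<alpha>\<in>R. \<forall>\<beta>\<in>R. coroot \<alpha> \<bullet> \<beta> \<in> \<int>)"

definition reduced_rs :: "'a::euclidean_space set \<Rightarrow> bool" where
  "reduced_rs R \<longleftrightarrow> (\<forall>\<alpha>\<in>R. \<forall>c::real. c *\<^sub>R \<alpha> \<in> R \<longrightarrow> c = 1 \<or> c = -1)"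

definition irreducible_rs :: "'a::euclidean_space set \<Rightarrow> bool" where
  "irreducible_rs R \<longleftrightarrow> \<not> (\<exists>R1 R2. R1 \<noteq> {} \<and> R2 \<noteq> {} \<and> R1 \<union> R2 = R \<and> R1 \<inter> R2 = {} \<and>
       (\<forall>a\<in>R1. \<forall>b\<in>R2. a \<bullet> b = 0))"

definition fundamental_system :: "'a::euclidean_space set \<Rightarrow> 'a set \<Rightarrow> bool" where
  "fundamental_system R Sim \<longleftrightarrow> Sim \<subseteq> R \<and> independent Sim \<and> span Sim = UNIV \<and>
     (\<forall>\<beta>\<in>R. \<exists>n::'a \<Rightarrow> int. \<beta> = (\<Sum>\<alpha>\<in>Sim. of_int (n \<alpha>) *\<^sub>R \<alpha>) \<and>
        ((\<forall>\<alpha>\<in>Sim. n \<alpha> \<ge> 0) \<or> (\<forall>\<alpha>\<in>Sim. n \<alpha> \<le> 0)))"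

definition positive_roots :: "'a::euclidean_space set \<Rightarrow> 'a set \<Rightarrow> 'a set" where
  "positive_roots R Sim = {\<beta>\<in>R. \<exists>n::'a \<Rightarrow> nat. \<beta> = (\<Sum>\<alpha>\<in>Sim. of_nat (n \<alpha>) *\<^sub>R \<alpha>)}"

inductive_set weyl_group :: "'a::euclidean_space set \<Rightarrow> ('a \<Rightarrow> 'a) set" for R where
  weyl_id: "id \<in> weyl_group R"
| weyl_step: "w \<in> weyl_group R \<Longrightarrow> \<alpha> \<in> R \<Longrightarrow> reflection \<alpha> \<circ> w \<in> weyl_group R"

definition dualb :: "'a::euclidean_space set \<Rightarrow> 'a \<Rightarrow> 'a" where
  "dualb B \<beta> = (THE \<mu>. \<forall>\<beta>'\<in>B. coroot \<beta>' \<bullet> \<mu> = (if \<beta>' = \<beta> then 1 else 0))"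

definition fund_weight :: "'a::euclidean_space set \<Rightarrow> 'a \<Rightarrow> 'a" where
  "fund_weight Sim \<alpha> = dualb Sim \<alpha>"

definition Ppp :: "'a::euclidean_space set \<Rightarrow> 'a set" where
  "Ppp Sim = {v. \<exists>m::'a \<Rightarrow> nat. (\<forall>\<alpha>\<in>Sim. m \<alpha> \<ge> 1) \<and> v = (\<Sum>\<alpha>\<in>Sim. of_nat (m \<alpha>) *\<^sub>R fund_weight Sim \<alpha>)}"

definition root_set :: "'a::euclidean_space set \<Rightarrow> 'a set \<Rightarrow> 'a set \<Rightarrow> bool" where
  "root_set Dp Sim Ds \<longleftrightarrow> Ds \<subseteq> Dp \<and> (\<forall>\<alpha>j\<in>Sim. \<exists>\<alpha>\<in>Ds. \<alpha> \<bullet> fund_weight Sim \<alpha>j \<noteq> 0)"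

definition zeta_term :: "'a::euclidean_space set \<Rightarrow> ('a \<Rightarrow> nat) \<Rightarrow> 'a \<Rightarrow> 'a \<Rightarrow> complex" where
  "zeta_term Dp s y lam = exp (2 * of_real pi * \<i> * of_real (y \<bullet> lam)) *
      (\<Prod>\<alpha>\<in>Dp. inverse (of_real (coroot \<alpha> \<bullet> lam) ^ s \<alpha>))"

definition zeta_rs :: "'a::euclidean_space set \<Rightarrow> 'a set \<Rightarrow> ('a \<Rightarrow> nat) \<Rightarrow> 'a \<Rightarrow> complex" where
  "zeta_rs Dp Sim s y = infsum (zeta_term Dp s y) (Ppp Sim)"

text \<open>(w s)_\<alpha> = s_{w^{-1}\<alpha>}, with s_{-\<beta>} = s_\<beta> for w^{-1}\<alpha> negative.\<close>
definition param_act :: "'a::euclidean_space set \<Rightarrow> ('a \<Rightarrow> 'a) \<Rightarrow> ('a \<Rightarrow> 'b) \<Rightarrow> 'a \<Rightarrow> 'b" where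
  "param_act Dp w s \<alpha> = (let \<beta> = inv w \<alpha> in if \<beta> \<in> Dp then s \<beta> else s (- \<beta>))"

definition bases_in :: "'a::euclidean_space set \<Rightarrow> 'a set set" where
  "bases_in Dp = {B. B \<subseteq> Dp \<and> independent B \<and> span B = UNIV}"

text \<open>\<nu>_{j+1} = nus ! j, A_j = set (take j nus).\<close>
definition VA :: "'a::euclidean_space set \<Rightarrow> 'a list \<Rightarrow> 'a set set" where
  "VA Dp nus = {B \<in> bases_in Dp. \<forall>j<length nus. nus ! j \<notin> span (B \<inter> set (take j nus))}"

definition coroot_lattice :: "'a::euclidean_space set \<Rightarrow> 'a set" where
  "coroot_lattice Sim = {v. \<exists>n::'a \<Rightarrow> int. v = (\<Sum>\<alpha>\<in>Sim. of_int (n \<alpha>) *\<^sub>R coroot \<alpha>)}"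

text \<open>A complete system of representatives of Q^\<or>/L(B^\<or>).\<close>
definition quot_reps :: "'a::euclidean_space set \<Rightarrow> 'a set \<Rightarrow> 'a set" where
  "quot_reps Sim B = {q \<in> coroot_lattice Sim. \<forall>\<beta>\<in>B. 0 \<le> q \<bullet> dualb B \<beta> \<and> q \<bullet> dualb B \<beta> < 1}"

definition bracket :: "'a::euclidean_space \<Rightarrow> 'a set \<Rightarrow> 'a \<Rightarrow> 'a \<Rightarrow> real" where
  "bracket \<phi> B \<beta> y = (if \<phi> \<bullet> dualb B \<beta> > 0 then frac (y \<bullet> dualb B \<beta>)
                      else 1 - frac (- (y \<bullet> dualb B \<beta>)))"

definition Fden :: "'a::euclidean_space set \<Rightarrow> 'a set \<Rightarrow> 'a set \<Rightarrow> 'a \<Rightarrow> ('a \<Rightarrow> complex) \<Rightarrow> complex" where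
  "Fden Dp Ds B \<gamma> t = t \<gamma> - (\<Sum>\<beta>\<in>B - (Dp - Ds). t \<beta> * of_real (coroot \<gamma> \<bullet> dualb B \<beta>))"

definition Fgen :: "'a::euclidean_space set \<Rightarrow> 'a set \<Rightarrow> 'a set \<Rightarrow> 'a list \<Rightarrow> 'a \<Rightarrow> 'a
                     \<Rightarrow> ('a \<Rightarrow> complex) \<Rightarrow> complex" where
  "Fgen Dp Sim Ds nus \<phi> y t = (\<Sum>B\<in>VA Dp nus.
      (-1) ^ card ((Dp - Ds) - B) *
      (\<Prod>\<gamma>\<in>Dp - (B \<union> (Dp - Ds)). t \<gamma> / Fden Dp Ds B \<gamma> t) *
      (1 / of_nat (card (quot_reps Sim B))) *
      (\<Sum>q\<in>quot_reps Sim B. \<Prod>\<beta>\<in>B - (Dp - Ds).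
          t \<beta> * exp (t \<beta> * of_real (bracket \<phi> B \<beta> (y + q))) / (exp (t \<beta>) - 1)))"

definition F_regular :: "'a::euclidean_space set \<Rightarrow> 'a set \<Rightarrow> 'a list \<Rightarrow> ('a \<Rightarrow> complex) \<Rightarrow> bool" where
  "F_regular Dp Ds nus t \<longleftrightarrow> (\<forall>\<alpha>\<in>Ds. t \<alpha> \<noteq> 0) \<and>
     (\<forall>B\<in>VA Dp nus. \<forall>\<gamma>\<in>Dp - (B \<union> (Dp - Ds)). Fden Dp Ds B \<gamma> t \<noteq> 0)"

definition multi_idx :: "'a set \<Rightarrow> ('a \<Rightarrow> nat) set" where
  "multi_idx Ds = {k. \<forall>\<alpha>. \<alpha> \<notin> Ds \<longrightarrow> k \<alpha> = 0}"

text \<open>P_{\<Delta>*}(k, y): the Taylor coefficients of F at the origin, i.e.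
  F(t) = \<Sum>_k P(k) \<Prod>_{\<alpha>\<in>\<Delta>*} t_\<alpha>^{k_\<alpha>}/k_\<alpha>! on a polydisc around 0.\<close>
definition Pcoef :: "'a::euclidean_space set \<Rightarrow> 'a set \<Rightarrow> 'a set \<Rightarrow> 'a list \<Rightarrow> 'a \<Rightarrow> 'a
                      \<Rightarrow> ('a \<Rightarrow> nat) \<Rightarrow> complex" where
  "Pcoef Dp Sim Ds nus \<phi> y = (THE c. (\<forall>k. k \<notin> multi_idx Ds \<longrightarrow> c k = 0) \<and>
     (\<exists>\<epsilon>>0. \<forall>t. (\<forall>\<alpha>\<in>Ds. norm (t \<alpha>) < \<epsilon>) \<and> F_regular Dp Ds nus t \<longrightarrow>
        ((\<lambda>k. c k * (\<Prod>\<alpha>\<in>Ds. t \<alpha> ^ k \<alpha> / of_nat (fact (k \<alpha>)))) has_sum Fgen Dp Sim Ds nus \<phi> y t)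
          (multi_idx Ds)))"

end

theory Submission
  imports Defs
begin

text \<open>The Weyl group permutes the chambers simply transitively, so the left-hand side is one sum over all
  regular weights \<open>\<lambda>\<close>. Its generating series in \<open>t\<close> is the sum over \<open>\<lambda>\<close> of the products of
  \<open>t\<^sub>\<alpha> / (t\<^sub>\<alpha> - 2\<pi>i\<langle>\<alpha>\<^sup>\<or>, \<lambda>\<rangle>)\<close> over \<open>\<Delta>\<^sup>*\<close>. Such a product decomposes into partial fractions indexed by
  bases; Whitney's broken circuit theorem accounts for the condition that \<open>\<lambda>\<close> avoids the hyperplanes of
  \<open>\<Delta>\<^sub>+ - \<Delta>\<^sup>*\<close>. Each basis contributes a product of one-dimensional Bernoulli sums, which is the
  corresponding summand of \<open>F\<close>.

  The basis contributions converge only conditionally. They are summed by applying twisted difference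
  operators \<open>f(\<lambda>) - \<chi>(\<nu>) f(\<lambda> - \<nu>)\<close> with \<open>\<chi>(\<nu>) = exp (2\<pi>i\<langle>y, \<nu>\<rangle>)\<close>, which multiply a sum over the lattice
  by \<open>1 - \<chi>(\<nu>)\<close>, a nonzero factor when \<open>y\<close> is generic; this summation is linear and agrees with absolutely
  convergent sums. It shows that the homogeneous parts of \<open>F\<close> are polynomials in \<open>t\<close>, whose coefficients a finite
  Fourier transform recovers on a torus avoiding the singular hyperplanes. Arbitrary \<open>y\<close> is reached as the
  limit of \<open>y + c\<phi>\<close> for \<open>c \<rightarrow> 0+\<close>, the direction from which the brackets are continuous.\<close>

section \<open>Fourier series with summable coefficients\<close>

text \<open>Each basis contributes a rational function of \<open>t\<close> with poles on the
  hyperplanes \<open>Fden = 0\<close>; only the total is holomorphic, and these poles are never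
  cancelled by algebra. On the lattice side the functions \<open>freq_term k\<close> do not involve
  \<open>t\<close>, so in each degree the lattice function is a polynomial in \<open>t\<close>.
  Extracting coefficients at finitely many regular points gives every \<open>freq_term k\<close> a
  generalized sum. Putting these sums back at an arbitrary regular \<open>t\<close> and comparing
  with the basis expansion forces the degree \<open>n\<close> part of \<open>F\<close> to be the
  corresponding polynomial. The summation method therefore has to be linear and single-valued on
  functions for which no absolute convergence is available: exponents 0 and 1 occur among the
  multi-indices of a given degree.

  Regular points need not fill a neighbourhood of the origin. A torus with radii of different orders
  of magnitude consists of regular points, stays regular under positive scaling, and supports both
  the coefficient bounds and the uniqueness of the Taylor coefficients.\<close>

definition expi :: "real \<Rightarrow> complex" where
  "expi x = exp (2 * of_real pi * \<i> * of_real x)"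

lemma expi_add: "expi (x + y) = expi x * expi y"
  by (simp add: expi_def exp_add[symmetric] algebra_simps)

lemma expi_0 [simp]: "expi 0 = 1" by (simp add: expi_def)

lemma norm_expi [simp]: "norm (expi x) = 1"
  by (simp add: expi_def)

lemma expi_eq_0 [simp]: "expi x \<noteq> 0"
  by (simp add: expi_def)

lemma expi_minus: "expi (- x) = inverse (expi x)"
  by (simp add: expi_def exp_minus)

lemma expi_diff: "expi (x - y) = expi x / expi y"
  using expi_add[of x "-y"] by (simp add: expi_minus field_simps)

lemma expi_eq_1: "expi x = 1 \<longleftrightarrow> x \<in> \<int>"
proof -
  have "expi x = 1 \<longleftrightarrow> (\<exists>n::int. 2 * pi * x = of_int (2 * n) * pi)"
    unfolding expi_def exp_eq_1 by simp
  also have "\<dots> \<longleftrightarrow> (\<exists>n::int. x = of_int n)"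
    by (intro iff_exI) (auto simp: field_simps)
  finally show ?thesis by (auto simp: Ints_def)
qed

lemma expi_int [simp]: "expi (of_int n) = 1"
  by (simp add: expi_eq_1)

lemma expi_1 [simp]: "expi 1 = 1"
  by (simp add: expi_eq_1)

lemma cnj_expi: "cnj (expi x) = expi (- x)"
  by (simp add: expi_def exp_cnj)

lemma continuous_on_expi [continuous_intros]:
  "continuous_on S f \<Longrightarrow> continuous_on S (\<lambda>x. expi (f x))"
  unfolding expi_def by (intro continuous_intros)

lemma has_vector_derivative_expi:
  "((\<lambda>x. expi (a * x)) has_vector_derivative 2 * pi * \<i> * a * expi (a * x)) (at x within S)"
proof -
  have "((\<lambda>z. exp (2 * of_real pi * \<i> * (of_real a * z))) has_field_derivative 2 * pi * \<i> * a * expi (a * x)) (at (of_real x) within of_real ` S)"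
    unfolding expi_def by (auto intro!: derivative_eq_intros)
  from field_vector_diff_chain_within[OF has_vector_derivative_of_real[OF DERIV_ident] this]
  show ?thesis by (simp add: o_def expi_def)
qed

lemma expi_surj:
  assumes "norm z = 1" obtains x where "x \<in> {0..1}" "z = expi x"
proof (rule that[of "Arg2pi z / (2 * pi)"])
  show "Arg2pi z / (2 * pi) \<in> {0..1}"
    using Arg2pi_ge_0[of z] Arg2pi_lt_2pi[of z] by simp
  show "z = expi (Arg2pi z / (2 * pi))"
    using assms unfolding complex_norm_eq_1_exp by (simp add: expi_def mult_ac)
qed

text \<open>Trigonometric polynomials, given inductively so that orthogonality to the monomials
  passes to all of them by rule induction.\<close>

inductive trig :: "(real \<Rightarrow> complex) \<Rightarrow> bool" where
  trig_mono: "trig (\<lambda>x. expi (of_int n * x))"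
| trig_scale: "trig f \<Longrightarrow> trig (\<lambda>x. c * f x)"
| trig_add: "trig f \<Longrightarrow> trig g \<Longrightarrow> trig (\<lambda>x. f x + g x)"

lemma trig_mult:
  assumes "trig f" "trig g" shows "trig (\<lambda>x. f x * g x)"
  using assms
proof (induction f rule: trig.induct)
  case (trig_mono n)
  from this show ?case
  proof (induction g rule: trig.induct)
    case (trig_mono m)
    have "(\<lambda>x. expi (of_int n * x) * expi (of_int m * x)) = (\<lambda>x. expi (of_int (n + m) * x))"
      by (simp add: expi_add[symmetric] algebra_simps)
    then show ?case by (metis trig.trig_mono)
  next
    case (trig_scale f c)
    have "(\<lambda>x. expi (of_int n * x) * (c * f x)) = (\<lambda>x. c * (expi (of_int n * x) * f x))" by (simp add: mult_ac)
    with trig_scale show ?case by (metis trig.trig_scale)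
  next
    case (trig_add f g)
    then show ?case by (simp add: distrib_left trig.trig_add)
  qed
next
  case (trig_scale f c)
  then show ?case by (simp add: mult.assoc trig.trig_scale)
next
  case (trig_add f g)
  then show ?case by (simp add: distrib_right trig.trig_add)
qed

lemma trig_const: "trig (\<lambda>x. c)"
  using trig_scale[OF trig_mono[of 0], of c] by simp

text \<open>A real-linear form on the complex plane is a combination of z and its conjugate, and on
  the circle the conjugate of \<open>expi x\<close> is \<open>expi (- x)\<close>.\<close>

lemma trig_real_polynomial:
  assumes "real_polynomial_function p"
  shows "trig (\<lambda>x. of_real (p (expi x)))"
  using assms
proof (induction p rule: real_polynomial_function.induct)
  case (linear f)
  have f: "f z = Re z * f 1 + Im z * f \<i>" for z
  proof -
    have "z = Re z *\<^sub>R 1 + Im z *\<^sub>R \<i>"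
      by (simp add: complex_eq_iff)
    then have "f z = f (Re z *\<^sub>R 1 + Im z *\<^sub>R \<i>)" by simp
    also have "\<dots> = Re z * f 1 + Im z * f \<i>"
      using linear by (simp add: linear_simps)
    finally show ?thesis .
  qed
  have "of_real (f (expi x)) =
      ((f 1 - \<i> * f \<i>) / 2) * expi (of_int 1 * x) + ((f 1 + \<i> * f \<i>) / 2) * expi (of_int (-1) * x)" for x
  proof -
    have "expi (- x) = cnj (expi x)" by (simp add: cnj_expi)
    then show ?thesis
      by (subst f) (simp add: complex_eq_iff field_simps)
  qed
  then show ?case
    by (simp only:) (intro trig.intros)
qed (auto intro: trig_const trig_add trig_mult)

text \<open>Periodicity turns \<open>d\<close> into a continuous function on the circle, where
  Stone-Weierstrass approximates its conjugate by polynomials. Since \<open>d\<close> is orthogonal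
  to these, the integral of the squared modulus of \<open>d\<close> is arbitrarily small.\<close>

lemma fourier_unique:
  fixes d :: "real \<Rightarrow> complex"
  assumes cont: "continuous_on {0..1} d" and per: "d 0 = d 1"
    and coef: "\<And>n::int. ((\<lambda>x. d x * expi (- of_int n * x)) has_integral 0) {0..1}"
    and y: "y \<in> {0..1}"
  shows "d y = 0"
proof -
  define F where "F z = d (Arg2pi z / (2 * pi))" for z
  have F: "F (expi x) = d x" if "x \<in> {0..1}" for x
  proof (cases "x = 1")
    case True
    then show ?thesis using per Arg2pi_of_real[of 1] by (simp add: F_def)
  next
    case False
    then have "Arg2pi (expi x) = 2 * pi * x"
      using that unfolding expi_def by (subst Arg2pi_exp) auto
    then show ?thesis by (simp add: F_def)
  qed
  have img: "expi ` {0..1} = sphere 0 1"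
  proof
    show "sphere 0 1 \<subseteq> expi ` {0..1}"
    proof
      fix z :: complex assume "z \<in> sphere 0 1"
      then have "norm z = 1" by simp
      then show "z \<in> expi ` {0..1}" by (rule expi_surj) blast
    qed
  qed auto
  \<comment> \<open>\<open>Arg2pi\<close> jumps at 1, so continuity is obtained from
    \<open>expi\<close> being a quotient map from the compact interval onto the circle.\<close>
  have contF: "continuous_on (sphere 0 1) F"
    unfolding continuous_openin_preimage_eq
  proof (intro allI impI)
    fix V :: "complex set" assume "open V"
    have "openin (top_of_set {0..1}) ({0..1} \<inter> expi -` (sphere 0 1 \<inter> F -` V)) =
          openin (top_of_set (sphere 0 1)) (sphere 0 1 \<inter> F -` V)"
      by (rule Abstract_Topology_2.continuous_imp_quotient_map[OF _ img]) (auto intro!: continuous_intros)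
    moreover have "{0..1} \<inter> expi -` (sphere 0 1 \<inter> F -` V) = {0..1} \<inter> d -` V"
      using F by auto
    moreover have "openin (top_of_set {0..1}) ({0..1} \<inter> d -` V)"
      using cont \<open>open V\<close> continuous_openin_preimage_gen by blast
    ultimately show "openin (top_of_set (sphere 0 1)) (sphere 0 1 \<inter> F -` V)" by simp
  qed
  have orth: "((\<lambda>x. d x * g x) has_integral 0) {0..1}" if "trig g" for g
    using that
  proof (induction g rule: trig.induct)
    case (trig_mono n)
    show ?case using coef[of "-n"] by simp
  next
    case (trig_scale f c)
    then show ?case using has_integral_mult_right[of _ 0 "{0..1}" c] by (simp add: mult_ac)
  next
    case (trig_add f g)
    then show ?case using has_integral_add[of _ 0 "{0..1}" _ 0] by (simp add: distrib_left)
  qed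
  obtain M where M: "M > 0" "\<And>x. x \<in> {0..1} \<Longrightarrow> norm (d x) \<le> M"
    using compact_imp_bounded[OF compact_continuous_image[OF cont]] unfolding bounded_pos by auto
  define L where "L = integral {0..1} (\<lambda>x. d x * cnj (d x))"
  have contL: "continuous_on {0..1} (\<lambda>x. d x * cnj (d x))"
    by (intro continuous_intros cont)
  then have L: "((\<lambda>x. d x * cnj (d x)) has_integral L) {0..1}"
    unfolding L_def by (intro integrable_integral integrable_continuous_real)
  have "norm L \<le> M * e" if e: "e > 0" for e
  proof -
    obtain g where g: "polynomial_function g" "\<And>z. z \<in> sphere 0 1 \<Longrightarrow> norm (cnj (F z) - g z) < e"
      using Stone_Weierstrass_polynomial_function[of "sphere (0::complex) 1" "\<lambda>z. cnj (F z)" e]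
        continuous_on_cnj[OF contF] e by auto
    have "real_polynomial_function (Re \<circ> g)" "real_polynomial_function (Im \<circ> g)"
      using g(1) unfolding polynomial_function_def by (auto intro: bounded_linear_Re bounded_linear_Im)
    then have "trig (\<lambda>x. of_real ((Re \<circ> g) (expi x)) + \<i> * of_real ((Im \<circ> g) (expi x)))"
      by (intro trig_add trig_scale trig_real_polynomial)
    also have "(\<lambda>x. of_real ((Re \<circ> g) (expi x)) + \<i> * of_real ((Im \<circ> g) (expi x))) = (\<lambda>x. g (expi x))"
      by (auto simp: complex_eq_iff)
    finally have "((\<lambda>x. d x * g (expi x)) has_integral 0) {0..1}" by (rule orth)
    from has_integral_diff[OF L this]
    have "((\<lambda>x. d x * (cnj (d x) - g (expi x))) has_integral L) {0..1}"
      by (simp add: right_diff_distrib)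
    then have "((\<lambda>x. d x * (cnj (d x) - g (expi x))) has_integral L) (cbox 0 1)" by simp
    then have "norm L \<le> M * e * measure lborel (cbox 0 (1::real))"
    proof (rule has_integral_bound[rotated])
      fix x :: real assume "x \<in> cbox 0 1"
      then have x: "x \<in> {0..1}" by simp
      have "norm (cnj (d x) - g (expi x)) \<le> e" using g(2)[of "expi x"] F[OF x] by simp
      then show "norm (d x * (cnj (d x) - g (expi x))) \<le> M * e"
        unfolding norm_mult using M x by (intro mult_mono) auto
    qed (use M e in auto)
    then show ?thesis by simp
  qed
  then have "norm L \<le> 0"
  proof -
    assume *: "\<And>e. e > 0 \<Longrightarrow> norm L \<le> M * e"
    show ?thesis
    proof (rule field_le_epsilon)
      fix e :: real assume "e > 0"
      then show "norm L \<le> 0 + e" using *[of "e / M"] M(1) by simp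
    qed
  qed
  then have "L = 0" by simp
  with L have "((\<lambda>x. d x * cnj (d x)) has_integral 0) {0..1}" by simp
  from has_integral_Re[OF this] have "((\<lambda>x. Re (d x * cnj (d x))) has_integral 0) {0..1}"
    by simp
  then have "Re (d y * cnj (d y)) = 0"
    by (intro has_integral_0_cbox_imp_0[of 0 "1::real" "\<lambda>x. Re (d x * cnj (d x))" y])
       (use y continuous_on_Re[OF contL] in auto)
  then show ?thesis
    by (simp add: complex_mult_cnj complex_eq_iff sum_power2_eq_zero_iff)
qed

lemma has_integral_expi:
  "((\<lambda>x. expi (of_int n * x)) has_integral (if n = 0 then 1 else 0)) {0..1}"
proof (cases "n = 0")
  case True
  then show ?thesis using has_integral_const_real[of "1::complex" 0 1] by simp
next
  case False
  have "((\<lambda>x. expi (of_int n * x)) has_integral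
      (expi (of_int n * 1) / (2 * pi * \<i> * of_int n) - expi (of_int n * 0) / (2 * pi * \<i> * of_int n))) {0..1}"
    by (rule fundamental_theorem_of_calculus)
       (use False in \<open>auto intro!: has_vector_derivative_eq_rhs[OF has_vector_derivative_divide[OF has_vector_derivative_expi]]\<close>)
  then show ?thesis using False by simp
qed

text \<open>The series converges uniformly, hence its sum has the same Fourier coefficients as
  \<open>f\<close>, and \<open>fourier_unique\<close> applies to the difference.\<close>

lemma fourier_series:
  fixes f :: "real \<Rightarrow> complex" and c :: "int \<Rightarrow> complex"
  assumes cont: "continuous_on {0..1} f" and per: "f 0 = f 1"
    and coef: "\<And>n. ((\<lambda>x. f x * expi (- of_int n * x)) has_integral c n) {0..1}"
    and summ: "(\<lambda>n. norm (c n)) summable_on UNIV"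
    and y: "y \<in> {0..1}"
  shows "((\<lambda>n. c n * expi (of_int n * y)) has_sum f y) UNIV"
proof -
  define h where "h x = (\<Sum>\<^sub>\<infinity>n. c n * expi (of_int n * x))" for x
  have ul: "uniform_limit Y (\<lambda>X x. \<Sum>n\<in>X. c n * expi (of_int n * x)) h (finite_subsets_at_top UNIV)" for Y
    unfolding h_def by (rule Weierstrass_m_test_general[OF _ summ]) (simp add: norm_mult)
  have conth: "continuous_on {0..1} h"
    by (rule uniform_limit_theorem[OF _ ul]) (auto intro!: always_eventually continuous_intros)
  have "((\<lambda>x. h x * expi (- of_int n * x)) has_integral c n) {0..1}" for n
  proof -
    have ul': "uniform_limit {0..1} (\<lambda>X x. (\<Sum>j\<in>X. c j * expi (of_int j * x)) * expi (- of_int n * x))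
        (\<lambda>x. h x * expi (- of_int n * x)) (finite_subsets_at_top UNIV)"
    proof (rule bounded_bilinear.bounded_uniform_limit[OF bounded_bilinear_mult ul uniform_limit_const])
      show "bounded (h ` {0..1})"
        by (intro compact_imp_bounded compact_continuous_image conth) auto
      show "bounded ((\<lambda>x. expi (- of_int n * x)) ` {0..1})"
        by (auto simp: bounded_iff)
    qed
    obtain I J where IJ: "\<And>X. ((\<lambda>x. (\<Sum>j\<in>X. c j * expi (of_int j * x)) * expi (- of_int n * x)) has_integral I X) {0..1}"
      "((\<lambda>x. h x * expi (- of_int n * x)) has_integral J) {0..1}"
      "(I \<longlongrightarrow> J) (finite_subsets_at_top UNIV)"
      by (rule uniform_limit_integral[OF ul']) (auto intro!: continuous_intros)
    \<comment> \<open>As soon as the partial sum contains the index \<open>n\<close>, its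
      \<open>n\<close>-th coefficient is final, so the net of integrals is eventually
      constant.\<close>
    have IX: "I X = c n" if "finite X" "n \<in> X" for X
    proof -
      have "((\<lambda>x. \<Sum>j\<in>X. c j * expi (of_int (j - n) * x)) has_integral
          (\<Sum>j\<in>X. c j * (if j - n = 0 then 1 else 0))) {0..1}"
        by (intro has_integral_sum has_integral_mult_right has_integral_expi that)
      moreover have "(\<Sum>j\<in>X. c j * (if j - n = 0 then 1 else 0)) = c n"
        using that by (simp add: if_distrib[of "(*) _"] sum.delta' cong: if_cong)
      moreover have "(\<lambda>x. \<Sum>j\<in>X. c j * expi (of_int (j - n) * x)) =
          (\<lambda>x. (\<Sum>j\<in>X. c j * expi (of_int j * x)) * expi (- of_int n * x))"
      proof
        fix x
        have "expi (of_int (j - n) * x) = expi (of_int j * x) * expi (- of_int n * x)" for j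
          by (simp only: expi_add[symmetric] of_int_diff left_diff_distrib mult_minus_left add_uminus_conv_diff)
        then show "(\<Sum>j\<in>X. c j * expi (of_int (j - n) * x)) =
          (\<Sum>j\<in>X. c j * expi (of_int j * x)) * expi (- of_int n * x)"
          unfolding sum_distrib_right by (intro sum.cong refl) (metis mult.assoc)
      qed
      ultimately have "((\<lambda>x. (\<Sum>j\<in>X. c j * expi (of_int j * x)) * expi (- of_int n * x)) has_integral c n) {0..1}"
        by (simp only:)
      then show ?thesis by (rule has_integral_unique[OF IJ(1)])
    qed
    have "eventually (\<lambda>X. c n = I X) (finite_subsets_at_top UNIV)"
      unfolding eventually_finite_subsets_at_top
      by (rule exI[of _ "{n}"]) (auto simp: IX)
    then have "(I \<longlongrightarrow> c n) (finite_subsets_at_top UNIV)"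
      by (rule tendsto_eventually[OF eventually_mono]) auto
    then have "J = c n" using IJ(3) tendsto_unique finite_subsets_at_top_neq_bot by blast
    with IJ(2) show ?thesis by simp
  qed
  note hc = this
  have "f y - h y = 0"
  proof (rule fourier_unique[where d = "\<lambda>x. f x - h x"])
    show "continuous_on {0..1} (\<lambda>x. f x - h x)" by (intro continuous_intros cont conth)
    have "h 0 = h 1" unfolding h_def by simp
    then show "f 0 - h 0 = f 1 - h 1" using per by simp
    show "((\<lambda>x. (f x - h x) * expi (- of_int n * x)) has_integral 0) {0..1}" for n
      using has_integral_diff[OF coef[of n] hc[of n]] by (simp add: left_diff_distrib)
  qed (rule y)
  moreover have "(\<lambda>n. c n * expi (of_int n * y)) summable_on UNIV"
    by (rule abs_summable_summable) (simp add: norm_mult summ)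
  ultimately show ?thesis by (simp add: h_def has_sum_iff)
qed

section \<open>Bernoulli polynomials and their Fourier coefficients\<close>

text \<open>The series t / (e^t - 1), as the inverse of (e^t - 1) / t, whose constant term is
  1.\<close>

definition bern_fps :: "real fps" where
  "bern_fps = inverse (Abs_fps (\<lambda>n. 1 / fact (Suc n)))"

lemma bern_fps_mult: "bern_fps * Abs_fps (\<lambda>n. 1 / fact (Suc n)) = 1"
  unfolding bern_fps_def by (rule inverse_mult_eq_1) simp

lemma fps_exp_1_eq: "fps_exp 1 = 1 + fps_X * Abs_fps (\<lambda>n. 1 / fact (Suc n) :: real)"
  by (rule fps_ext) (auto simp: fps_exp_def fact_reduce)

text \<open>\<open>bpol j\<close> is the Bernoulli polynomial \<open>B\<^sub>j\<close> divided by \<open>j!\<close>.\<close>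

definition bpol :: "nat \<Rightarrow> real \<Rightarrow> real" where
  "bpol j y = fps_nth (bern_fps * fps_exp y) j"

lemma bpol_eq: "bpol j y = (\<Sum>i=0..j. fps_nth bern_fps i * (y ^ (j - i) / fact (j - i)))"
  by (simp add: bpol_def fps_mult_nth)

lemma bpol_0 [simp]: "bpol 0 y = 1"
  by (simp add: bpol_eq bern_fps_def)

lemma bpol_diff: "bpol (Suc j) 1 - bpol (Suc j) 0 = (if j = 0 then 1 else 0)"
proof -
  have "bpol (Suc j) 1 - bpol (Suc j) 0 = fps_nth (bern_fps * (fps_exp 1 - 1)) (Suc j)"
    by (simp add: bpol_def right_diff_distrib)
  also have "bern_fps * (fps_exp 1 - 1) = fps_X"
    using bern_fps_mult by (simp add: fps_exp_1_eq mult.left_commute)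
  finally show ?thesis by (simp add: fps_X_def)
qed

lemma has_field_derivative_bpol:
  "(bpol (Suc j) has_field_derivative bpol j y) (at y within S)"
proof -
  have "((\<lambda>y. \<Sum>i=0..Suc j. fps_nth bern_fps i * (y ^ (Suc j - i) / fact (Suc j - i))) has_field_derivative
     (\<Sum>i=0..Suc j. fps_nth bern_fps i * (of_nat (Suc j - i) * y ^ (Suc j - i - 1) / fact (Suc j - i)))) (at y within S)"
    by (intro DERIV_sum DERIV_cmult DERIV_cdivide) (auto intro!: derivative_eq_intros)
  also have "(\<Sum>i=0..Suc j. fps_nth bern_fps i * (of_nat (Suc j - i) * y ^ (Suc j - i - 1) / fact (Suc j - i))) = bpol j y"
  proof -
    have "of_nat (Suc j - i) * y ^ (Suc j - i - 1) / fact (Suc j - i) = y ^ (j - i) / fact (j - i)" if "i \<le> j" for i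
      using that by (simp add: Suc_diff_le del: of_nat_Suc of_nat_diff)
    then have "(\<Sum>i=0..j. fps_nth bern_fps i * (of_nat (Suc j - i) * y ^ (Suc j - i - 1) / fact (Suc j - i))) = bpol j y"
      unfolding bpol_eq by (intro sum.cong refl) simp
    then show ?thesis by simp
  qed
  finally show ?thesis by (simp only: bpol_eq[abs_def])
qed

lemma continuous_on_bpol [continuous_intros]:
  "continuous_on S f \<Longrightarrow> continuous_on S (\<lambda>x. bpol j (f x))"
  unfolding bpol_eq by (intro continuous_intros) auto

text \<open>The recursion expresses a coefficient through the earlier ones with weights 1 / (m +
  1)!, at most 2^(-m) for m = 1, 2, ...; these weights add up to less than 1.\<close>

lemma abs_bern_fps_le: "\<bar>fps_nth bern_fps n\<bar> \<le> 1"
proof (induction n rule: less_induct)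
  case (less n)
  show ?case
  proof (cases "n = 0")
    case True
    then show ?thesis by (simp add: bern_fps_def)
  next
    case False
    have s: "(\<Sum>i=0..n. fps_nth bern_fps i * (1 / fact (Suc (n - i)))) = 0"
      using arg_cong[OF bern_fps_mult, of "\<lambda>f. fps_nth f n"] False
      by (simp add: fps_mult_nth)
    have "fps_nth bern_fps n = - (\<Sum>i=0..<n. fps_nth bern_fps i * (1 / fact (Suc (n - i))))"
    proof -
      have "{0..n} = insert n {0..<n}" by auto
      with s show ?thesis by simp
    qed
    then have "\<bar>fps_nth bern_fps n\<bar> \<le> (\<Sum>i=0..<n. \<bar>fps_nth bern_fps i * (1 / fact (Suc (n - i)))\<bar>)"
      by (simp only: abs_minus_cancel sum_abs)
    also have "\<dots> \<le> (\<Sum>i=0..<n. 1 / 2 ^ (n - i))"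
    proof (rule sum_mono)
      fix i assume i: "i \<in> {0..<n}"
      have "(2::real) ^ (n - i) \<le> fact (Suc (n - i))"
      proof -
        have "(2::real) ^ m \<le> fact (Suc m)" for m
        proof (induction m)
          case (Suc m)
          have "2 * 2 ^ m \<le> real (Suc (Suc m)) * fact (Suc m)"
            by (rule mult_mono[OF _ Suc]) auto
          then show ?case by simp
        qed simp
        then show ?thesis .
      qed
      then have "1 / fact (Suc (n - i)) \<le> 1 / (2::real) ^ (n - i)" by (intro divide_left_mono) auto
      moreover have "\<bar>fps_nth bern_fps i\<bar> \<le> 1" using i less by auto
      ultimately show "\<bar>fps_nth bern_fps i * (1 / fact (Suc (n - i)))\<bar> \<le> 1 / 2 ^ (n - i)"
        using mult_mono[of "\<bar>fps_nth bern_fps i\<bar>" 1 "1 / fact (Suc (n - i))" "1 / 2 ^ (n - i)"]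
        by (simp add: abs_mult del: fact_Suc)
    qed
    also have "\<dots> = (\<Sum>i<n. (1/2) ^ Suc i)"
      by (rule sum.reindex_bij_witness[of _ "\<lambda>i. n - Suc i" "\<lambda>i. n - Suc i"])
         (auto simp: power_divide Suc_diff_Suc)
    also have "\<dots> \<le> (1::real)"
    proof -
      have "(\<Sum>i<n. (1/2) ^ Suc i) = 1 - (1/2::real) ^ n"
        by (induction n) (auto simp: field_simps)
      then show ?thesis by simp
    qed
    finally show ?thesis .
  qed
qed

text \<open>The coefficients are bounded by 1, which leaves a partial sum of the series for e; 3 is
  an upper bound for e. Uniformity in \<open>j\<close> is what later gives convergence for
  \<open>norm t < 1\<close>.\<close>

lemma abs_bpol_le:
  assumes "y \<in> {0..1}" shows "\<bar>bpol j y\<bar> \<le> 3"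
proof -
  have "\<bar>bpol j y\<bar> \<le> (\<Sum>i=0..j. \<bar>fps_nth bern_fps i * (y ^ (j - i) / fact (j - i))\<bar>)"
    unfolding bpol_eq by (rule sum_abs)
  also have "\<dots> \<le> (\<Sum>i=0..j. 1 / fact (j - i))"
  proof (rule sum_mono)
    fix i assume "i \<in> {0..j}"
    have "\<bar>fps_nth bern_fps i\<bar> * (y ^ (j - i) / fact (j - i)) \<le> 1 * (1 / fact (j - i))"
      using assms by (intro mult_mono abs_bern_fps_le divide_right_mono power_le_one) auto
    then show "\<bar>fps_nth bern_fps i * (y ^ (j - i) / fact (j - i))\<bar> \<le> 1 / fact (j - i)"
      using assms by (simp add: abs_mult)
  qed
  also have "\<dots> = (\<Sum>i<Suc j. 1 / fact i)"
    by (rule sum.reindex_bij_witness[of _ "\<lambda>i. j - i" "\<lambda>i. j - i"]) auto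
  also have "\<dots> \<le> exp 1"
  proof -
    have "(\<lambda>n. 1 / fact n) sums exp (1::real)"
      using exp_converges[of "1::real"] by (simp add: divide_inverse)
    from sum_le_suminf[OF sums_summable[OF this], of "{..<Suc j}"] sums_unique[OF this]
    show ?thesis by (simp del: sum.lessThan_Suc)
  qed
  also have "\<dots> \<le> 3" by (rule exp_le)
  finally show ?thesis .
qed

text \<open>Two Cauchy products. Against (e^t - 1) / t the \<open>bern_fps\<close> series collapses
  to 1, which identifies its sum and excludes \<open>exp t = 1\<close>; against exp (t y) it
  produces the Bernoulli polynomials.\<close>

lemma bern_gen_sums:
  fixes t :: complex
  assumes t: "t \<noteq> 0" "norm t < 1" and y: "y \<in> {0..1}"
  shows "(\<lambda>j. of_real (bpol j y) * t ^ j) sums (t * exp (t * of_real y) / (exp t - 1))"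
    and "summable (\<lambda>j. norm (of_real (bpol j y) * t ^ j))"
proof -
  let ?a = "\<lambda>j. of_real (fps_nth bern_fps j) * t ^ j :: complex"
  have geo: "summable (\<lambda>j. norm t ^ j)" using t by simp
  have sa: "summable (\<lambda>j. norm (?a j))"
    by (rule summable_comparison_test'[OF geo, of 0])
       (use abs_bern_fps_le in \<open>auto simp: norm_mult norm_power intro!: mult_left_le_one_le\<close>)
  have e1: "(\<lambda>k. t ^ k / fact (Suc k)) sums ((exp t - 1) / t)"
  proof -
    have "(\<lambda>k. t ^ Suc k / fact (Suc k)) sums (exp t - (\<Sum>k<1. t ^ k / fact k))"
      using sums_split_initial_segment[OF exp_converges[of t], of 1]
      by (simp add: scaleR_conv_of_real divide_inverse mult_ac)
    from sums_divide[OF this, of t] show ?thesis using t by simp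
  qed
  have se1: "summable (\<lambda>k. norm (t ^ k / fact (Suc k)))"
    by (rule summable_comparison_test'[OF geo, of 0])
       (auto simp: norm_divide norm_power norm_fact divide_le_eq mult_le_cancel_left1 fact_ge_1 simp del: fact_Suc)
  have "(\<lambda>k. \<Sum>i\<le>k. ?a i * (t ^ (k - i) / fact (Suc (k - i)))) sums ((\<Sum>k. ?a k) * (\<Sum>k. t ^ k / fact (Suc k)))"
    by (rule Cauchy_product_sums[OF sa se1])
  moreover have "(\<Sum>i\<le>k. ?a i * (t ^ (k - i) / fact (Suc (k - i)))) = (if k = 0 then 1 else 0)" for k
  proof -
    have "(\<Sum>i\<le>k. ?a i * (t ^ (k - i) / fact (Suc (k - i)))) =
        t ^ k * of_real (\<Sum>i=0..k. fps_nth bern_fps i * (1 / fact (Suc (k - i))))"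
      unfolding of_real_sum sum_distrib_left atLeast0AtMost
    proof (intro sum.cong refl)
      fix i assume "i \<in> {..k}"
      then have "t ^ k = t ^ i * t ^ (k - i)" by (simp flip: power_add)
      then show "?a i * (t ^ (k - i) / fact (Suc (k - i))) = t ^ k * of_real (fps_nth bern_fps i * (1 / fact (Suc (k - i))))"
        by (simp del: fact_Suc)
    qed
    also have "(\<Sum>i=0..k. fps_nth bern_fps i * (1 / fact (Suc (k - i)))) = fps_nth 1 k"
      by (simp add: bern_fps_mult[symmetric] fps_mult_nth)
    finally show ?thesis by simp
  qed
  ultimately have "(\<lambda>k. if k = 0 then 1 else 0) sums ((\<Sum>k. ?a k) * ((exp t - 1) / t))"
    using e1 by (simp add: sums_iff)
  moreover have "(\<lambda>k. if k = 0 then 1 else 0) sums (1::complex)"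
    using sums_single[of 0 "\<lambda>_. 1::complex"] by simp
  ultimately have prod1: "(\<Sum>k. ?a k) * ((exp t - 1) / t) = 1"
    using sums_unique2 by blast
  then have ne: "exp t \<noteq> 1" by auto
  have suma: "(\<Sum>k. ?a k) = t / (exp t - 1)"
    using prod1 t ne by (simp add: field_simps)
  show "summable (\<lambda>j. norm (of_real (bpol j y) * t ^ j))"
  proof (rule summable_comparison_test'[OF summable_mult[OF geo, of 3], of 0])
    fix n
    show "norm (norm (of_real (bpol n y) * t ^ n)) \<le> 3 * norm t ^ n"
      using abs_bpol_le[OF y, of n] by (simp add: norm_mult norm_power mult_right_mono)
  qed
  let ?e = "\<lambda>k. (t * of_real y) ^ k / fact k"
  have e: "?e sums exp (t * of_real y)"
    using exp_converges[of "t * of_real y"] by (simp add: scaleR_conv_of_real divide_inverse mult_ac)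
  have ne: "summable (\<lambda>k. norm (?e k))"
    using summable_norm_exp[of "t * of_real y"] by (simp add: scaleR_conv_of_real divide_inverse mult_ac)
  have "(\<lambda>k. \<Sum>i\<le>k. ?a i * ?e (k - i)) sums ((\<Sum>k. ?a k) * (\<Sum>k. ?e k))"
    by (rule Cauchy_product_sums[OF sa ne])
  moreover have "(\<Sum>i\<le>k. ?a i * ?e (k - i)) = of_real (bpol k y) * t ^ k" for k
  proof -
    have "?a i * ?e (k - i) = of_real (fps_nth bern_fps i * (y ^ (k - i) / fact (k - i))) * t ^ k" if "i \<le> k" for i
      using that by (simp add: power_mult_distrib power_add[symmetric] field_simps)
    then have "(\<Sum>i\<le>k. ?a i * ?e (k - i)) = (\<Sum>i\<le>k. of_real (fps_nth bern_fps i * (y ^ (k - i) / fact (k - i))) * t ^ k)"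
      by (intro sum.cong) auto
    then show ?thesis by (simp add: bpol_eq sum_distrib_right atLeast0AtMost)
  qed
  ultimately show "(\<lambda>j. of_real (bpol j y) * t ^ j) sums (t * exp (t * of_real y) / (exp t - 1))"
    using sums_unique[OF e] by (simp add: suma)
qed

text \<open>\<open>bc j x\<close> is the coefficient of \<open>t\<^sup>j\<close> in \<open>t / (t - 2\<pi>ix)\<close>, hence \<open>1\<close> at \<open>j = x = 0\<close>.\<close>

definition bc :: "nat \<Rightarrow> real \<Rightarrow> complex" where
  "bc j x = (if x = 0 then (if j = 0 then 1 else 0)
             else if j = 0 then 0 else - 1 / (2 * pi * \<i> * x) ^ j)"

text \<open>Integration by parts lowers the index, because \<open>bpol (Suc j)\<close> is a
  primitive of \<open>bpol j\<close>. The boundary term \<open>bpol_diff\<close> is nonzero only for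
  \<open>j = 0\<close>, where it starts the sequence of nonzero coefficients.\<close>

lemma has_integral_bpol_expi:
  "((\<lambda>x. of_real (bpol j x) * expi (- of_int n * x)) has_integral bc j (of_int n)) {0..1}"
proof (induction j)
  case 0
  show ?case using has_integral_expi[of "-n"] by (auto simp: bc_def)
next
  case (Suc j)
  show ?case
  proof (cases "n = 0")
    case True
    have "((\<lambda>x. of_real (bpol (Suc j) x) :: complex) has_integral
        of_real (bpol (Suc (Suc j)) 1) - of_real (bpol (Suc (Suc j)) 0)) {0..1}"
      by (rule fundamental_theorem_of_calculus)
         (auto intro!: has_vector_derivative_of_real has_field_derivative_bpol)
    moreover have "of_real (bpol (Suc (Suc j)) 1) - of_real (bpol (Suc (Suc j)) 0) = (0::complex)"
      using bpol_diff[of "Suc j"] by (simp flip: of_real_diff)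
    ultimately show ?thesis using True by (simp add: bc_def)
  next
    case False
    define w where "w = 2 * pi * \<i> * of_int n"
    have w: "w \<noteq> 0" using False by (simp add: w_def)
    have "((\<lambda>x. of_real (bpol j x) * expi (- of_int n * x) + of_real (bpol (Suc j) x) * (- w * expi (- of_int n * x))) has_integral
       of_real (bpol (Suc j) 1) * expi (- of_int n * 1) - of_real (bpol (Suc j) 0) * expi (- of_int n * 0)) {0..1}"
    proof (rule fundamental_theorem_of_calculus)
      fix x :: real
      have "((\<lambda>x. of_real (bpol (Suc j) x) * expi (- of_int n * x)) has_vector_derivative
          of_real (bpol (Suc j) x) * (2 * pi * \<i> * of_real (- of_int n) * expi (- of_int n * x)) + of_real (bpol j x) * expi (- of_int n * x)) (at x within {0..1})"
        using has_vector_derivative_expi[of "- of_int n"]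
        by (intro has_vector_derivative_mult has_vector_derivative_of_real has_field_derivative_bpol) auto
      then show "((\<lambda>x. of_real (bpol (Suc j) x) * expi (- of_int n * x)) has_vector_derivative
          of_real (bpol j x) * expi (- of_int n * x) + of_real (bpol (Suc j) x) * (- w * expi (- of_int n * x))) (at x within {0..1})"
        by (simp add: w_def add.commute)
    qed simp
    from has_integral_diff[OF Suc this]
    have "((\<lambda>x. w * (of_real (bpol (Suc j) x) * expi (- of_int n * x))) has_integral
       bc j (of_int n) - of_real (bpol (Suc j) 1 - bpol (Suc j) 0)) {0..1}"
      using expi_int[of "-n"] by (simp add: algebra_simps)
    from has_integral_mult_right[OF this, of "1 / w"]
    have "((\<lambda>x. of_real (bpol (Suc j) x) * expi (- of_int n * x)) has_integral
       (bc j (of_int n) - of_real (bpol (Suc j) 1 - bpol (Suc j) 0)) / w) {0..1}"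
      using w by simp
    also have "(bc j (of_int n) - of_real (bpol (Suc j) 1 - bpol (Suc j) 0)) / w = bc (Suc j) (of_int n)"
      using False unfolding bpol_diff by (auto simp: bc_def w_def field_simps)
    finally show ?thesis .
  qed
qed


lemma summable_inverse_one_plus_square: "(\<lambda>n::int. 1 / (1 + (of_int n)\<^sup>2) :: real) summable_on UNIV"
proof -
  have sq: "summable (\<lambda>n::nat. 1 / (1 + (real n)\<^sup>2))"
  proof (rule summable_comparison_test'[OF inverse_power_summable[of 2, where 'a=real], of 1])
    fix n :: nat assume "n \<ge> 1"
    then have "0 < real n ^ 2" by simp
    then show "norm (1 / (1 + (real n)\<^sup>2)) \<le> inverse (real n ^ 2)"
      by (simp add: divide_inverse abs_of_nonneg le_imp_inverse_le del: inverse_le_iff_le)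
  qed simp
  then have nat: "(\<lambda>n::nat. 1 / (1 + (real n)\<^sup>2)) summable_on UNIV"
    by (intro summable_nonneg_imp_summable_on) auto
  have 1: "(\<lambda>n::int. 1 / (1 + (of_int n)\<^sup>2) :: real) summable_on range int"
    by (subst summable_on_reindex) (auto simp: o_def nat)
  have 2: "(\<lambda>n::int. 1 / (1 + (of_int n)\<^sup>2) :: real) summable_on range (\<lambda>k. - int k)"
    by (subst summable_on_reindex) (auto simp: o_def nat inj_on_def)
  have "(\<lambda>n::int. 1 / (1 + (of_int n)\<^sup>2) :: real) summable_on (range int \<union> (range (\<lambda>k. - int k) - range int))"
    by (rule summable_on_Un_disjoint[OF 1]) (auto intro: summable_on_subset_banach[OF 2])
  also have "range int \<union> (range (\<lambda>k. - int k) - range int) = UNIV"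
  proof -
    have "n \<in> range int \<or> n \<in> range (\<lambda>k. - int k)" for n
      by (cases n rule: int_cases2) auto
    then show ?thesis by blast
  qed
  finally show ?thesis .
qed

text \<open>For \<open>j \<ge> 2\<close> the decay is at least quadratic; writing 1 + n^2 instead of
  n^2 includes \<open>n = 0\<close> and costs the factor 2. Exponent 1 is the one that decays too
  slowly.\<close>

lemma norm_bc_le:
  assumes "j \<noteq> 1" shows "norm (bc j (of_int n)) \<le> 2 * (1 / (1 + (of_int n)\<^sup>2))"
proof (cases "n = 0 \<or> j = 0")
  case True
  then show ?thesis by (auto simp: bc_def add_nonneg_nonneg)
next
  case False
  then have n1: "\<bar>real_of_int n\<bar> \<ge> 1" and j: "j \<ge> 2" using assms by auto
  have pi1: "2 * pi \<ge> 1" using pi_gt3 by simp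
  have "1 + (real_of_int n)\<^sup>2 \<le> 2 * \<bar>real_of_int n\<bar>\<^sup>2"
    using n1 by (simp add: abs_square_le_1[symmetric] one_le_power[of "\<bar>real_of_int n\<bar>" 2, simplified])
  also have "\<bar>real_of_int n\<bar>\<^sup>2 \<le> (2 * pi * \<bar>real_of_int n\<bar>)\<^sup>2"
    using pi1 n1 mult_right_mono[OF pi1, of "\<bar>real_of_int n\<bar>"] by (intro power_mono) auto
  also have "\<dots> \<le> (2 * pi * \<bar>real_of_int n\<bar>) ^ j"
    using j n1 pi1 mult_mono[of 1 "2 * pi" 1 "\<bar>real_of_int n\<bar>"] by (intro power_increasing) auto
  finally have "1 + (real_of_int n)\<^sup>2 \<le> 2 * (2 * pi * \<bar>real_of_int n\<bar>) ^ j" by simp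
  moreover have "norm (bc j (of_int n)) = 1 / (2 * pi * \<bar>real_of_int n\<bar>) ^ j"
    using False by (simp add: bc_def norm_divide norm_power norm_mult)
  moreover have "0 < (2 * pi * \<bar>real_of_int n\<bar>) ^ j" using False by simp
  moreover have "0 < 1 + (real_of_int n)\<^sup>2" by (simp add: add_pos_nonneg)
  ultimately show ?thesis by (simp add: field_simps)
qed

text \<open>For \<open>j \<noteq> 1\<close> both terms are summable. For \<open>j = 1\<close> the
  difference of two reciprocals gains a further factor of order 1 / n.\<close>

lemma bc_shift_summable:
  "(\<lambda>n. norm (bc j (of_int n) - bc j (of_int (n - int m)))) summable_on UNIV"
proof (cases "j = 1")
  case False
  have 1: "(\<lambda>n. norm (bc j (of_int n))) summable_on UNIV"
    by (rule summable_on_comparison_test[OF summable_on_cmult_right[OF summable_inverse_one_plus_square, of 2]])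
       (use norm_bc_le[OF False] in auto)
  have "(\<lambda>n. norm (bc j (of_int n))) summable_on UNIV \<longleftrightarrow> (\<lambda>n. norm (bc j (of_int (n - int m)))) summable_on UNIV"
    by (rule summable_on_reindex_bij_betw[symmetric, of "\<lambda>n. n - int m"]) (auto intro!: bij_betwI[of _ _ _ "\<lambda>n. n + int m"])
  with 1 have 2: "(\<lambda>n. norm (bc j (of_int (n - int m)))) summable_on UNIV" by blast
  show ?thesis
    by (rule summable_on_comparison_test[OF summable_on_add[OF 1 2]]) (auto intro: norm_triangle_ineq4)
next
  case True
  have pi1: "2 * pi \<ge> 2" using pi_gt3 by simp
  \<comment> \<open>The factor (1 + m)^2 also has to cover \<open>n = 0\<close> and
    \<open>n = m\<close>, where one of the two values of \<open>bc 1\<close> is 0.\<close>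
  have "norm (bc j (of_int n) - bc j (of_int (n - int m))) \<le> (1 + real m)\<^sup>2 * (1 / (1 + (of_int n)\<^sup>2))" for n
  proof -
    have pos: "0 < 1 + (real_of_int n)\<^sup>2" by (simp add: add_pos_nonneg)
    define p where "p = real_of_int n"
    define q where "q = real_of_int (n - int m)"
    have pq: "q = p - m" by (simp add: p_def q_def)
    consider "m = 0" | "n = 0" "m \<noteq> 0" | "n = m" "m \<noteq> 0" | "n \<noteq> 0" "n \<noteq> m" by blast
    then show ?thesis
    proof cases
      case 1
      then show ?thesis using pos by simp
    next
      case 2
      have "1 / (2 * pi * real m) \<le> 1" using 2 pi1 mult_mono[of 1 "2 * pi" 1 "real m"] by simp
      also have "1 \<le> (1 + real m)\<^sup>2" by (simp add: one_le_power)
      finally show ?thesis using 2 True by (simp add: bc_def norm_divide norm_mult)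
    next
      case 3
      have "1 / (2 * pi * real m) * (1 + (real m)\<^sup>2) \<le> 1 * (1 + real m)\<^sup>2"
        using 3 pi1 mult_mono[of 1 "2 * pi" 1 "real m"]
        by (intro mult_mono) (auto simp: power2_sum)
      then show ?thesis using 3 True pos by (simp add: bc_def norm_divide norm_mult field_simps)
    next
      case 4
      then have p1: "\<bar>p\<bar> \<ge> 1" and q1: "\<bar>q\<bar> \<ge> 1" unfolding p_def q_def by linarith+
      then have nz: "p \<noteq> 0" "q \<noteq> 0" by auto
      have "bc j p - bc j q = m / (2 * pi * \<i> * p * q)"
        using nz True by (simp add: bc_def field_simps) (simp add: pq algebra_simps)
      then have "norm (bc j p - bc j q) = m / (2 * pi * \<bar>p\<bar> * \<bar>q\<bar>)"
        by (simp add: norm_divide norm_mult)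
      also have "\<dots> \<le> (1 + real m)\<^sup>2 * (1 / (1 + p\<^sup>2))"
      proof -
        have "\<bar>p\<bar> \<le> \<bar>q\<bar> + m" by (simp add: pq)
        also have "\<dots> \<le> (1 + m) * \<bar>q\<bar>" using q1 mult_left_mono[of 1 "\<bar>q\<bar>" "real m"] by (simp add: algebra_simps)
        finally have "\<bar>p\<bar> * \<bar>p\<bar> \<le> \<bar>p\<bar> * ((1 + m) * \<bar>q\<bar>)" by (intro mult_left_mono) auto
        moreover have "1 \<le> \<bar>p\<bar> * \<bar>p\<bar>" using p1 mult_mono[of 1 "\<bar>p\<bar>" 1 "\<bar>p\<bar>"] by simp
        ultimately have "1 + p\<^sup>2 \<le> 2 * (\<bar>p\<bar> * ((1 + m) * \<bar>q\<bar>))" by (simp add: power2_eq_square)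
        also have "\<dots> \<le> 2 * pi * (\<bar>p\<bar> * ((1 + m) * \<bar>q\<bar>))" using pi1 by (intro mult_right_mono) auto
        finally have "1 + p\<^sup>2 \<le> (1 + real m) * (2 * pi * \<bar>p\<bar> * \<bar>q\<bar>)" by (simp add: mult_ac)
        then have "real m * (1 + p\<^sup>2) \<le> (1 + real m) * ((1 + real m) * (2 * pi * \<bar>p\<bar> * \<bar>q\<bar>))"
          by (intro mult_mono) auto
        then show ?thesis using pos nz by (simp add: p_def[symmetric] field_simps power2_eq_square)
      qed
      finally show ?thesis by (simp only: p_def q_def)
    qed
  qed
  then show ?thesis
    by (intro summable_on_comparison_test[OF summable_on_cmult_right[OF summable_inverse_one_plus_square, of "(1 + real m)\<^sup>2"]]) auto
qed

text \<open>Multiplication by \<open>1 - expi (real m * u)\<close> shifts the Fourier coefficients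
  as required. It also vanishes at both end points, so the product is periodic even for
  \<open>j = 1\<close>, where \<open>bpol\<close> has different values at 0 and 1.\<close>

lemma bc_shift_has_sum:
  assumes u: "0 \<le> u" "u \<le> 1"
  shows "((\<lambda>n. (bc j (of_int n) - bc j (of_int (n - int m))) * expi (of_int n * u)) has_sum
          (1 - expi (real m * u)) * of_real (bpol j u)) UNIV"
proof (rule fourier_series[where f = "\<lambda>x. (1 - expi (real m * x)) * of_real (bpol j x)"])
  show "continuous_on {0..1} (\<lambda>x. (1 - expi (real m * x)) * of_real (bpol j x))"
    by (intro continuous_intros)
  show "(1 - expi (real m * 0)) * of_real (bpol j 0) = (1 - expi (real m * 1)) * of_real (bpol j 1)"
    using expi_int[of "int m"] by simp
  show "((\<lambda>x. (1 - expi (real m * x)) * of_real (bpol j x) * expi (- of_int n * x)) has_integral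
          bc j (of_int n) - bc j (of_int (n - int m))) {0..1}" for n
  proof -
    have "of_real (bpol j x) * expi (- of_int n * x) - of_real (bpol j x) * expi (- of_int (n - int m) * x) =
       (1 - expi (real m * x)) * of_real (bpol j x) * expi (- of_int n * x)" for x
    proof -
      have "expi (- of_int (n - int m) * x) = expi (real m * x) * expi (- of_int n * x)"
        unfolding expi_add[symmetric] by (rule arg_cong[of _ _ expi]) (simp add: algebra_simps)
      then show ?thesis by (simp add: left_diff_distrib)
    qed
    with has_integral_diff[OF has_integral_bpol_expi[of j n] has_integral_bpol_expi[of j "n - int m"]]
    show ?thesis by simp
  qed
qed (use bc_shift_summable u in auto)

section \<open>A generalized summation method\<close>

text \<open>If f x = \<open>expi (y \<bullet> x)\<close> g x, the result is
  \<open>expi (y \<bullet> x)\<close> times the plain difference g x - g (x - v): the oscillating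
  factor is untouched and the decay of g improves.\<close>

definition twist_diff :: "'a::euclidean_space \<Rightarrow> 'a \<Rightarrow> ('a \<Rightarrow> complex) \<Rightarrow> 'a \<Rightarrow> complex" where
  "twist_diff y v f = (\<lambda>x. f x - expi (y \<bullet> v) * f (x - v))"

text \<open>A step applies the difference operator on the way from the conclusion to the premise, until the
  function becomes summable.\<close>

inductive gsum :: "'a::euclidean_space \<Rightarrow> ('a \<Rightarrow> complex) \<Rightarrow> complex \<Rightarrow> bool" for y where
  gsum_base: "(f has_sum s) UNIV \<Longrightarrow> gsum y f s"
| gsum_step: "expi (y \<bullet> v) \<noteq> 1 \<Longrightarrow> gsum y (twist_diff y v f) ((1 - expi (y \<bullet> v)) * s) \<Longrightarrow> gsum y f s"

lemma twist_diff_commute: "twist_diff y v (twist_diff y w f) = twist_diff y w (twist_diff y v f)"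
  by (auto simp: twist_diff_def algebra_simps)

lemma twist_diff_add: "twist_diff y v (\<lambda>x. f x + g x) = (\<lambda>x. twist_diff y v f x + twist_diff y v g x)"
  by (auto simp: twist_diff_def algebra_simps)

lemma twist_diff_scale: "twist_diff y v (\<lambda>x. c * f x) = (\<lambda>x. c * twist_diff y v f x)"
  by (auto simp: twist_diff_def algebra_simps)

lemma twist_diff_has_sum:
  assumes "(f has_sum s) UNIV"
  shows "(twist_diff y v f has_sum (1 - expi (y \<bullet> v)) * s) UNIV"
proof -
  have "((\<lambda>x. f (x - v)) has_sum s) UNIV"
    using has_sum_reindex_bij_betw[of "\<lambda>x. x - v" UNIV UNIV f s] assms
    by (auto simp: bij_betw_def inj_on_def surj_diff_right)
  from has_sum_add[OF assms has_sum_cmult_right[OF this, of "- expi (y \<bullet> v)"]]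
  show ?thesis by (simp add: twist_diff_def algebra_simps)
qed

lemma gsum_twist_diff:
  assumes "gsum y f s" shows "gsum y (twist_diff y v f) ((1 - expi (y \<bullet> v)) * s)"
  using assms
proof induction
  case (gsum_base f s)
  then show ?case by (intro gsum.gsum_base twist_diff_has_sum)
next
  case (gsum_step w f s)
  show ?case
    by (rule gsum.gsum_step[OF gsum_step(1)]) (use gsum_step(3) in \<open>simp add: twist_diff_commute[of y w] mult_ac\<close>)
qed

text \<open>The derivations of \<open>f\<close> and \<open>g\<close> may use different vectors.
  Every step of one is also applied to the other, which is harmless because the operators
  commute.\<close>

lemma gsum_add:
  assumes "gsum y f s" "gsum y g s'" shows "gsum y (\<lambda>x. f x + g x) (s + s')"
  using assms
proof (induction arbitrary: g s')
  case (gsum_base f s)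
  note f = this(1)
  from gsum_base(2) show ?case
  using f
  proof (induction arbitrary: f s)
    case (gsum_base g s')
    then show ?case by (intro gsum.gsum_base has_sum_add)
  next
    case (gsum_step w g s')
    show ?case
      by (rule gsum.gsum_step[OF gsum_step(1)])
         (use gsum_step(3)[OF twist_diff_has_sum[OF gsum_step(4)]] in \<open>simp add: twist_diff_add distrib_left\<close>)
  qed
next
  case (gsum_step w f s)
  show ?case
    by (rule gsum.gsum_step[OF gsum_step(1)])
       (use gsum_step(3)[OF gsum_twist_diff[OF gsum_step(4)]] in \<open>simp add: twist_diff_add distrib_left\<close>)
qed

lemma gsum_scale:
  assumes "gsum y f s" shows "gsum y (\<lambda>x. c * f x) (c * s)"
  using assms
proof induction
  case (gsum_base f s)
  then show ?case by (intro gsum.gsum_base has_sum_cmult_right)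
next
  case (gsum_step w f s)
  show ?case
    by (rule gsum.gsum_step[OF gsum_step(1)]) (use gsum_step(3) in \<open>simp add: twist_diff_scale mult_ac\<close>)
qed

lemma gsum_0: "gsum y (\<lambda>x. 0) 0"
  by (intro gsum_base has_sum_0) auto

lemma gsum_sum:
  assumes "\<And>i. i \<in> I \<Longrightarrow> gsum y (f i) (s i)"
  shows "gsum y (\<lambda>x. \<Sum>i\<in>I. f i x) (\<Sum>i\<in>I. s i)"
proof (cases "finite I")
  case True
  then show ?thesis using assms
    by (induction rule: finite_induct) (auto intro: gsum_0 gsum_add)
next
  case False
  then show ?thesis by (simp add: gsum_0)
qed

text \<open>Differences of the zero function are zero, so each step leaves only the factor
  \<open>1 - expi (y \<bullet> v)\<close>, which is nonzero and cancels. With linearity this makes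
  the generalized sum single-valued.\<close>

lemma gsum_zero_unique:
  assumes "gsum y f s" "f = (\<lambda>x. 0)" shows "s = 0"
  using assms
proof induction
  case (gsum_base f s)
  then show ?case by (simp add: has_sum_unique[OF _ has_sum_0])
next
  case (gsum_step w f s)
  then show ?case by (auto simp: twist_diff_def)
qed

lemma gsum_unique:
  assumes "gsum y f s" "gsum y f s'" shows "s = s'"
  using gsum_zero_unique[OF gsum_add[OF assms(1) gsum_scale[OF assms(2), of "-1"]]] by simp

section \<open>Dual bases and lattices\<close>

definition rbasis :: "'a::euclidean_space set \<Rightarrow> bool" where
  "rbasis B \<longleftrightarrow> independent B \<and> span B = UNIV"

lemma rbasis_finite: "rbasis B \<Longrightarrow> finite B"
  by (simp add: rbasis_def finiteI_independent)

lemma rbasis_nonzero: "rbasis B \<Longrightarrow> \<beta> \<in> B \<Longrightarrow> \<beta> \<bullet> \<beta> \<noteq> 0"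
  unfolding rbasis_def using dependent_zero by auto

lemma coroot_inner_eq: "coroot \<beta> \<bullet> v = 2 * (\<beta> \<bullet> v) / (\<beta> \<bullet> \<beta>)"
  by (simp add: coroot_def)

lemma coroot_inner_eq_0: "\<beta> \<noteq> 0 \<Longrightarrow> coroot \<beta> \<bullet> v = 0 \<longleftrightarrow> \<beta> \<bullet> v = 0"
  by (simp add: coroot_def)

lemma rbasis_orthogonal_eq_0:
  assumes "rbasis B" "\<And>\<beta>. \<beta> \<in> B \<Longrightarrow> coroot \<beta> \<bullet> v = 0" shows "v = 0"
proof -
  have "\<beta> \<bullet> v = 0" if "\<beta> \<in> B" for \<beta>
    using assms(2)[OF that] rbasis_nonzero[OF assms(1) that] by (auto simp: coroot_def)
  then have "orthogonal v x" if "x \<in> B" for x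
    using that by (simp add: orthogonal_def inner_commute[of v])
  then have "orthogonal v v"
    by (rule orthogonal_to_span[rotated]) (use assms(1) in \<open>auto simp: rbasis_def\<close>)
  then show ?thesis by (simp add: orthogonal_def)
qed

text \<open>Discharges the definite description in \<open>dualb\<close>. Existence: a linear
  functional prescribed on the basis is represented by a vector through its adjoint. Uniqueness: a
  vector orthogonal to a basis is 0.\<close>

lemma dualb_inner_left:
  assumes B: "rbasis B" "\<beta> \<in> B" "\<beta>' \<in> B"
  shows "coroot \<beta>' \<bullet> dualb B \<beta> = (if \<beta>' = \<beta> then 1 else 0)"
proof -
  \<comment> \<open>The value \<beta> \<bullet> \<beta> / 2 compensates the scaling in
    \<open>coroot\<close>.\<close>
  obtain g :: "'a \<Rightarrow> real" where g: "linear g" "\<And>x. x \<in> B \<Longrightarrow> g x = (if x = \<beta> then (\<beta> \<bullet> \<beta>) / 2 else 0)"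
    using linear_independent_extend[of B "\<lambda>x. if x = \<beta> then (\<beta> \<bullet> \<beta>) / 2 else 0"] B(1)
    unfolding rbasis_def by auto
  have g': "v \<bullet> adjoint g 1 = g v" for v
    using adjoint_works[OF g(1), of v 1] by (simp add: inner_commute)
  have "\<exists>!\<mu>. \<forall>\<beta>'\<in>B. coroot \<beta>' \<bullet> \<mu> = (if \<beta>' = \<beta> then 1 else 0)"
  proof (rule ex1I[of _ "adjoint g 1"])
    show "\<forall>\<beta>'\<in>B. coroot \<beta>' \<bullet> adjoint g 1 = (if \<beta>' = \<beta> then 1 else 0)"
      using rbasis_nonzero[OF B(1)] by (auto simp: coroot_def linear_scale[OF g(1)] g' g(2))
    then show "\<mu> = adjoint g 1" if "\<forall>\<beta>'\<in>B. coroot \<beta>' \<bullet> \<mu> = (if \<beta>' = \<beta> then 1 else 0)" for \<mu>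
      using rbasis_orthogonal_eq_0[OF B(1), of "\<mu> - adjoint g 1"] that by (auto simp: inner_diff_right)
  qed
  from theI'[OF this] show ?thesis using B(3) unfolding dualb_def by blast
qed

lemma sum_if_eq_inner:
  assumes "finite B" "\<beta> \<in> B"
  shows "(\<Sum>b\<in>B. c b * (if \<beta> = b then 1 else 0)) = (c \<beta> :: real)"
  using assms by (simp add: if_distrib[of "(*) _"] cong: if_cong)

lemma rbasis_expand:
  assumes B: "rbasis B"
  shows "v = (\<Sum>\<beta>\<in>B. (coroot \<beta> \<bullet> v) *\<^sub>R dualb B \<beta>)"
proof -
  have "v - (\<Sum>\<beta>\<in>B. (coroot \<beta> \<bullet> v) *\<^sub>R dualb B \<beta>) = 0"
    by (rule rbasis_orthogonal_eq_0[OF B])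
       (simp add: inner_diff_right inner_sum_right dualb_inner_left[OF B] sum_if_eq_inner rbasis_finite[OF B])
  then show ?thesis by simp
qed

lemma inner_expand:
  assumes B: "rbasis B"
  shows "u \<bullet> v = (\<Sum>\<beta>\<in>B. (coroot \<beta> \<bullet> v) * (u \<bullet> dualb B \<beta>))"
  by (subst rbasis_expand[OF B, of v]) (simp add: inner_sum_right)

lemma rbasis_expand_coroot:
  assumes B: "rbasis B"
  shows "v = (\<Sum>\<beta>\<in>B. (v \<bullet> dualb B \<beta>) *\<^sub>R coroot \<beta>)"
proof -
  let ?w = "v - (\<Sum>\<beta>\<in>B. (v \<bullet> dualb B \<beta>) *\<^sub>R coroot \<beta>)"
  have w: "?w \<bullet> dualb B \<beta> = 0" if "\<beta> \<in> B" for \<beta>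
    using that sum_if_eq_inner[OF rbasis_finite[OF B] that, of "\<lambda>b. v \<bullet> dualb B b"]
    by (simp add: inner_diff_left inner_sum_left dualb_inner_left[OF B] eq_commute)
  have "?w \<bullet> ?w = (\<Sum>\<beta>\<in>B. (coroot \<beta> \<bullet> ?w) * (?w \<bullet> dualb B \<beta>))" by (rule inner_expand[OF B])
  also have "\<dots> = 0" using w by simp
  finally show ?thesis by simp
qed

text \<open>The dual of the lattice spanned by the coroots of \<open>B\<close>; for a simple system
  it is the weight lattice.\<close>

definition int_dual :: "'a::euclidean_space set \<Rightarrow> 'a set" where
  "int_dual B = {v. \<forall>\<beta>\<in>B. coroot \<beta> \<bullet> v \<in> \<int>}"

lemma int_dual_diff: "v \<in> int_dual B \<Longrightarrow> w \<in> int_dual B \<Longrightarrow> v - w \<in> int_dual B"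
  by (auto simp: int_dual_def inner_diff_right)

lemma int_dual_add: "v \<in> int_dual B \<Longrightarrow> w \<in> int_dual B \<Longrightarrow> v + w \<in> int_dual B"
  by (auto simp: int_dual_def inner_add_right)

lemma coroot_lattice_add: "p \<in> coroot_lattice S \<Longrightarrow> q \<in> coroot_lattice S \<Longrightarrow> p + q \<in> coroot_lattice S"
proof -
  assume "p \<in> coroot_lattice S" "q \<in> coroot_lattice S"
  then obtain m n :: "'a \<Rightarrow> int" where "p = (\<Sum>\<alpha>\<in>S. of_int (m \<alpha>) *\<^sub>R coroot \<alpha>)" "q = (\<Sum>\<alpha>\<in>S. of_int (n \<alpha>) *\<^sub>R coroot \<alpha>)"
    by (auto simp: coroot_lattice_def)
  then have "p + q = (\<Sum>\<alpha>\<in>S. of_int (m \<alpha> + n \<alpha>) *\<^sub>R coroot \<alpha>)"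
    by (simp add: sum.distrib scaleR_add_left)
  then show ?thesis unfolding coroot_lattice_def by (intro CollectI exI)
qed

lemma coroot_lattice_scale: "p \<in> coroot_lattice S \<Longrightarrow> of_int k *\<^sub>R p \<in> coroot_lattice S"
proof -
  assume "p \<in> coroot_lattice S"
  then obtain m :: "'a \<Rightarrow> int" where "p = (\<Sum>\<alpha>\<in>S. of_int (m \<alpha>) *\<^sub>R coroot \<alpha>)"
    by (auto simp: coroot_lattice_def)
  then have "of_int k *\<^sub>R p = (\<Sum>\<alpha>\<in>S. of_int (k * m \<alpha>) *\<^sub>R coroot \<alpha>)"
    by (simp add: scaleR_sum_right)
  then show ?thesis unfolding coroot_lattice_def by (intro CollectI exI)
qed

lemma coroot_lattice_diff: "p \<in> coroot_lattice S \<Longrightarrow> q \<in> coroot_lattice S \<Longrightarrow> p - q \<in> coroot_lattice S"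
  using coroot_lattice_add[of p S "- q"] coroot_lattice_scale[of q S "-1"] by simp

lemma coroot_lattice_0: "0 \<in> coroot_lattice S"
  unfolding coroot_lattice_def by (intro CollectI exI[of _ "\<lambda>_. 0"]) simp

lemma coroot_lattice_sum: "(\<And>i. i \<in> I \<Longrightarrow> f i \<in> coroot_lattice S) \<Longrightarrow> (\<Sum>i\<in>I. f i) \<in> coroot_lattice S"
  by (induction I rule: infinite_finite_induct) (auto intro: coroot_lattice_add coroot_lattice_0)

lemma coroot_in_lattice: "finite S \<Longrightarrow> \<alpha> \<in> S \<Longrightarrow> coroot \<alpha> \<in> coroot_lattice S"
  unfolding coroot_lattice_def
  by (intro CollectI exI[of _ "\<lambda>b. if b = \<alpha> then 1 else 0"]) (simp add: if_distrib[of "\<lambda>x. of_int x *\<^sub>R _"] cong: if_cong)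

lemma coroot_lattice_inner_int:
  assumes "q \<in> coroot_lattice S" "v \<in> int_dual S" shows "q \<bullet> v \<in> \<int>"
  using assms by (auto simp: coroot_lattice_def int_dual_def inner_sum_left intro!: Ints_sum Ints_mult)

lemma coroot_lattice_bounded_finite:
  assumes S: "rbasis S" shows "finite {q \<in> coroot_lattice S. norm q \<le> K}"
proof -
  define M where "M = nat \<lceil>Max (insert 0 ((\<lambda>\<alpha>. K * norm (dualb S \<alpha>)) ` S))\<rceil>"
  note fin = rbasis_finite[OF S]
  have "{q \<in> coroot_lattice S. norm q \<le> K} \<subseteq> (\<lambda>n. \<Sum>\<alpha>\<in>S. of_int (n \<alpha>) *\<^sub>R coroot \<alpha>) ` (PiE S (\<lambda>_. {- int M..int M}))"
  proof
    fix q assume "q \<in> {q \<in> coroot_lattice S. norm q \<le> K}"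
    then obtain n :: "'a \<Rightarrow> int" where q: "norm q \<le> K" "q = (\<Sum>\<alpha>\<in>S. of_int (n \<alpha>) *\<^sub>R coroot \<alpha>)"
      by (auto simp: coroot_lattice_def)
    have n: "n \<alpha> \<in> {- int M..int M}" if "\<alpha> \<in> S" for \<alpha>
    proof -
      have "q \<bullet> dualb S \<alpha> = (\<Sum>b\<in>S. of_int (n b) * (if \<alpha> = b then 1 else 0))"
        unfolding q(2) by (simp add: inner_sum_left dualb_inner_left[OF S that] eq_commute)
      also have "\<dots> = of_int (n \<alpha>)" by (rule sum_if_eq_inner[OF fin that])
      finally have "\<bar>real_of_int (n \<alpha>)\<bar> \<le> norm q * norm (dualb S \<alpha>)"
        by (metis Cauchy_Schwarz_ineq2)
      also have "\<dots> \<le> K * norm (dualb S \<alpha>)" using q(1) by (simp add: mult_right_mono)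
      also have "\<dots> \<le> Max (insert 0 ((\<lambda>\<alpha>. K * norm (dualb S \<alpha>)) ` S))"
        using fin that by (intro Max_ge) auto
      also have "\<dots> \<le> of_nat M" unfolding M_def by (rule of_nat_ceiling)
      finally show ?thesis by auto
    qed
    have "restrict n S \<in> PiE S (\<lambda>_. {- int M..int M})" using n by auto
    moreover have "q = (\<Sum>\<alpha>\<in>S. of_int (restrict n S \<alpha>) *\<^sub>R coroot \<alpha>)" using q(2) by simp
    ultimately show "q \<in> (\<lambda>n. \<Sum>\<alpha>\<in>S. of_int (n \<alpha>) *\<^sub>R coroot \<alpha>) ` (PiE S (\<lambda>_. {- int M..int M}))"
      by blast
  qed
  then show ?thesis by (rule finite_subset) (auto intro!: finite_PiE fin)
qed

section \<open>The coroot lattice modulo the sublattice spanned by the coroots of a basis\<close>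

locale basis_lattice =
  fixes S B :: "'a::euclidean_space set"
  assumes S: "rbasis S" and B: "rbasis B" and sub: "\<And>\<beta>. \<beta> \<in> B \<Longrightarrow> coroot \<beta> \<in> coroot_lattice S"
begin

lemma quot_reps_subset: "quot_reps S B \<subseteq> coroot_lattice S"
  by (auto simp: quot_reps_def)

lemma finite_quot_reps: "finite (quot_reps S B)"
proof (rule finite_subset[OF _ coroot_lattice_bounded_finite[OF S]])
  show "quot_reps S B \<subseteq> {q \<in> coroot_lattice S. norm q \<le> (\<Sum>\<beta>\<in>B. norm (coroot \<beta>))}"
  proof (intro subsetI CollectI conjI)
    fix q assume q: "q \<in> quot_reps S B"
    then show "q \<in> coroot_lattice S" by (simp add: quot_reps_def)
    have "norm q = norm (\<Sum>\<beta>\<in>B. (q \<bullet> dualb B \<beta>) *\<^sub>R coroot \<beta>)"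
      by (subst rbasis_expand_coroot[OF B, of q]) simp
    also have "\<dots> \<le> (\<Sum>\<beta>\<in>B. norm ((q \<bullet> dualb B \<beta>) *\<^sub>R coroot \<beta>))" by (rule norm_sum)
    also have "\<dots> \<le> (\<Sum>\<beta>\<in>B. norm (coroot \<beta>))"
      using q by (intro sum_mono) (auto simp: quot_reps_def intro!: mult_left_le_one_le)
    finally show "norm q \<le> (\<Sum>\<beta>\<in>B. norm (coroot \<beta>))" .
  qed
qed

text \<open>Reduction into the half-open fundamental parallelepiped of the coroots of
  \<open>B\<close>, which is how \<open>quot_reps\<close> chooses its representatives.\<close>

definition qred :: "'a \<Rightarrow> 'a" where
  "qred q = q - (\<Sum>\<beta>\<in>B. of_int \<lfloor>q \<bullet> dualb B \<beta>\<rfloor> *\<^sub>R coroot \<beta>)"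

lemma sum_coroot_dualb:
  "\<beta> \<in> B \<Longrightarrow> (\<Sum>b\<in>B. c b *\<^sub>R coroot b) \<bullet> dualb B \<beta> = c \<beta>"
  using sum_if_eq_inner[OF rbasis_finite[OF B], of \<beta> c]
  by (simp add: inner_sum_left dualb_inner_left[OF B] eq_commute)

lemma qred_inner: "\<beta> \<in> B \<Longrightarrow> qred q \<bullet> dualb B \<beta> = frac (q \<bullet> dualb B \<beta>)"
  by (simp add: qred_def inner_diff_left sum_coroot_dualb frac_def)

lemma qred_in: "q \<in> coroot_lattice S \<Longrightarrow> qred q \<in> quot_reps S B"
  unfolding quot_reps_def
  by (auto simp: qred_inner frac_lt_1)
     (auto simp: qred_def intro!: coroot_lattice_diff coroot_lattice_sum coroot_lattice_scale sub)

lemma quot_reps_nonempty: "quot_reps S B \<noteq> {}"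
  using qred_in[OF coroot_lattice_0] by blast

lemma eq_if_inner_dualb:
  assumes "\<And>\<beta>. \<beta> \<in> B \<Longrightarrow> p \<bullet> dualb B \<beta> = q \<bullet> dualb B \<beta>" shows "p = q"
proof -
  have "p = (\<Sum>\<beta>\<in>B. (p \<bullet> dualb B \<beta>) *\<^sub>R coroot \<beta>)" by (rule rbasis_expand_coroot[OF B])
  also have "\<dots> = (\<Sum>\<beta>\<in>B. (q \<bullet> dualb B \<beta>) *\<^sub>R coroot \<beta>)" using assms by (intro sum.cong) auto
  also have "\<dots> = q" by (rule rbasis_expand_coroot[OF B, symmetric])
  finally show ?thesis .
qed

lemma expi_qred:
  assumes "v \<in> int_dual B" shows "expi (qred q \<bullet> v) = expi (q \<bullet> v)"
proof -
  have "(\<Sum>\<beta>\<in>B. of_int \<lfloor>q \<bullet> dualb B \<beta>\<rfloor> *\<^sub>R coroot \<beta>) \<bullet> v \<in> \<int>"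
    using assms by (auto simp: int_dual_def inner_sum_left)
  then show ?thesis
    by (simp add: qred_def inner_diff_left expi_diff expi_eq_1[THEN iffD2])
qed

text \<open>Translation by a coroot of \<open>S\<close> permutes the classes and multiplies the sum
  by \<open>expi (coroot \<alpha> \<bullet> v)\<close>. If \<open>v\<close> is not in the dual of
  the full lattice, some such factor differs from 1 and the sum vanishes.\<close>

lemma character_sum:
  assumes v: "v \<in> int_dual B"
  shows "(\<Sum>q\<in>quot_reps S B. expi (q \<bullet> v)) = (if v \<in> int_dual S then of_nat (card (quot_reps S B)) else 0)"
proof (cases "v \<in> int_dual S")
  case True
  then have "expi (q \<bullet> v) = 1" if "q \<in> quot_reps S B" for q
    using that coroot_lattice_inner_int[of q S v] by (simp add: expi_eq_1 quot_reps_def)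
  then show ?thesis using True by simp
next
  case False
  then obtain \<alpha> where \<alpha>: "\<alpha> \<in> S" "coroot \<alpha> \<bullet> v \<notin> \<int>" by (auto simp: int_dual_def)
  let ?p = "coroot \<alpha>"
  have p: "?p \<in> coroot_lattice S" using \<alpha>(1) rbasis_finite[OF S] by (intro coroot_in_lattice)
  let ?h = "\<lambda>q. qred (q + ?p)"
  have inj: "inj_on ?h (quot_reps S B)"
  proof (rule inj_onI)
    fix q q' assume q: "q \<in> quot_reps S B" "q' \<in> quot_reps S B" "qred (q + ?p) = qred (q' + ?p)"
    show "q = q'"
    proof (rule eq_if_inner_dualb)
      fix \<beta> assume \<beta>: "\<beta> \<in> B"
      have "frac ((q + ?p) \<bullet> dualb B \<beta>) = frac ((q' + ?p) \<bullet> dualb B \<beta>)"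
        using q(3) \<beta> by (metis qred_inner)
      then have k: "q \<bullet> dualb B \<beta> - q' \<bullet> dualb B \<beta> =
          of_int (\<lfloor>(q + ?p) \<bullet> dualb B \<beta>\<rfloor> - \<lfloor>(q' + ?p) \<bullet> dualb B \<beta>\<rfloor>)" (is "_ = of_int ?k")
        by (simp add: frac_def inner_add_left)
      have "0 \<le> q \<bullet> dualb B \<beta>" "q \<bullet> dualb B \<beta> < 1" "0 \<le> q' \<bullet> dualb B \<beta>" "q' \<bullet> dualb B \<beta> < 1"
        using q(1,2) \<beta> by (auto simp: quot_reps_def)
      then have "\<bar>q \<bullet> dualb B \<beta> - q' \<bullet> dualb B \<beta>\<bar> < 1" by linarith
      then have "?k = 0" unfolding k by linarith
      then show "q \<bullet> dualb B \<beta> = q' \<bullet> dualb B \<beta>" using k by simp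
    qed
  qed
  have "?h ` quot_reps S B \<subseteq> quot_reps S B"
    using p by (auto intro!: qred_in coroot_lattice_add dest: quot_reps_subset[THEN subsetD])
  then have "bij_betw ?h (quot_reps S B) (quot_reps S B)"
    using inj endo_inj_surj[OF finite_quot_reps] by (simp add: bij_betw_def)
  then have "(\<Sum>q\<in>quot_reps S B. expi (q \<bullet> v)) = (\<Sum>q\<in>quot_reps S B. expi (?h q \<bullet> v))"
    by (rule sum.reindex_bij_betw[symmetric])
  also have "\<dots> = expi (?p \<bullet> v) * (\<Sum>q\<in>quot_reps S B. expi (q \<bullet> v))"
    by (simp add: expi_qred[OF v] inner_add_left expi_add sum_distrib_left mult.commute)
  finally have "(1 - expi (?p \<bullet> v)) * (\<Sum>q\<in>quot_reps S B. expi (q \<bullet> v)) = 0"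
    by (simp add: algebra_simps)
  moreover have "expi (?p \<bullet> v) \<noteq> 1" using \<alpha> by (simp add: expi_eq_1)
  ultimately show ?thesis using False by simp
qed

text \<open>Pigeonhole: two of the multiples of \<open>q\<close> fall into the same one of finitely
  many classes, and their difference is integral in the coordinates of \<open>B\<close>.\<close>

lemma lattice_multiple:
  assumes "q \<in> coroot_lattice S"
  shows "\<exists>m\<ge>1. \<forall>\<beta>\<in>B. real m * (q \<bullet> dualb B \<beta>) \<in> \<int>"
proof -
  have "(\<lambda>j::nat. qred (of_int (int j) *\<^sub>R q)) ` UNIV \<subseteq> quot_reps S B"
    using assms by (auto intro!: qred_in coroot_lattice_scale simp del: of_int_of_nat_eq)
  then have "finite (range (\<lambda>j::nat. qred (of_int (int j) *\<^sub>R q)))"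
    using finite_quot_reps finite_subset by blast
  then have "\<not> inj (\<lambda>j::nat. qred (of_int (int j) *\<^sub>R q))"
    using finite_imageD infinite_UNIV_nat by blast
  then obtain i j where "qred (of_int (int i) *\<^sub>R q) = qred (of_int (int j) *\<^sub>R q)" "i \<noteq> j"
    by (auto simp: inj_on_def)
  then obtain i j where ij: "qred (of_int (int i) *\<^sub>R q) = qred (of_int (int j) *\<^sub>R q)" "i < j"
    by (metis linorder_neqE_nat)
  show ?thesis
  proof (intro exI[of _ "j - i"] conjI ballI)
    show "1 \<le> j - i" using ij by simp
    fix \<beta> assume "\<beta> \<in> B"
    then have "frac (of_int (int j) * (q \<bullet> dualb B \<beta>)) = frac (of_int (int i) * (q \<bullet> dualb B \<beta>))"
      using ij(1) by (metis inner_scaleR_left qred_inner)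
    then have "real (j - i) * (q \<bullet> dualb B \<beta>) =
        of_int (\<lfloor>of_int (int j) * (q \<bullet> dualb B \<beta>)\<rfloor> - \<lfloor>of_int (int i) * (q \<bullet> dualb B \<beta>)\<rfloor>)"
      using ij(2) by (simp add: frac_def of_nat_diff left_diff_distrib)
    then show "real (j - i) * (q \<bullet> dualb B \<beta>) \<in> \<int>"
      by (simp only: Ints_of_int)
  qed
qed

text \<open>The multipliers of the finitely many coroots of \<open>S\<close> are multiplied
  together. The result provides shift vectors along the dual basis that lie in the weight
  lattice.\<close>

lemma dual_multiple: "\<exists>m::nat\<ge>1. \<forall>\<beta>\<in>B. real m *\<^sub>R dualb B \<beta> \<in> int_dual S"
proof -
  have "\<exists>m::nat\<ge>1. \<forall>\<alpha>\<in>T. \<forall>\<beta>\<in>B. real m * (coroot \<alpha> \<bullet> dualb B \<beta>) \<in> \<int>" if "finite T" "T \<subseteq> S" for T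
    using that
  proof (induction T rule: finite_induct)
    case (insert \<alpha> T)
    then have "\<exists>m::nat\<ge>1. \<forall>\<alpha>\<in>T. \<forall>\<beta>\<in>B. real m * (coroot \<alpha> \<bullet> dualb B \<beta>) \<in> \<int>" by simp
    then obtain m :: nat where m: "m \<ge> 1" "\<And>a b. a \<in> T \<Longrightarrow> b \<in> B \<Longrightarrow> real m * (coroot a \<bullet> dualb B b) \<in> \<int>" by blast
    obtain n where n: "n \<ge> 1" "\<And>b. b \<in> B \<Longrightarrow> real n * (coroot \<alpha> \<bullet> dualb B b) \<in> \<int>"
      using lattice_multiple[OF coroot_in_lattice[OF rbasis_finite[OF S], of \<alpha>]] insert.prems by blast
    show ?case
    proof (intro exI[of _ "m * n"] conjI ballI)
      show "1 \<le> m * n" using m n by simp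
      fix a b assume ab: "a \<in> insert \<alpha> T" "b \<in> B"
      show "real (m * n) * (coroot a \<bullet> dualb B b) \<in> \<int>"
      proof (cases "a = \<alpha>")
        case True
        have "real m * (real n * (coroot \<alpha> \<bullet> dualb B b)) \<in> \<int>"
          by (rule Ints_mult[OF Ints_of_nat n(2)[OF ab(2)]])
        then show ?thesis using True by (simp only: of_nat_mult mult.assoc)
      next
        case False
        then have "a \<in> T" using ab by simp
        have "real n * (real m * (coroot a \<bullet> dualb B b)) \<in> \<int>"
          by (rule Ints_mult[OF Ints_of_nat m(2)[OF \<open>a \<in> T\<close> ab(2)]])
        then show ?thesis by (simp only: of_nat_mult mult_ac)
      qed
    qed
  qed auto
  from this[OF rbasis_finite[OF S] subset_refl] show ?thesis by (auto simp: int_dual_def)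
qed

lemma int_dual_subset: "int_dual S \<subseteq> int_dual B"
  using sub coroot_lattice_inner_int by (auto simp: int_dual_def[of B])

end

section \<open>Generalized sums attached to a basis\<close>

text \<open>A finite set of pairs lies in the box spanned by its projections, where the sum of norms
  factors; this bounds all finite partial sums.\<close>

lemma abs_summable_prod_PiE:
  fixes f :: "'a \<Rightarrow> 'b \<Rightarrow> 'c :: {banach, real_normed_div_algebra, comm_semiring_1}"
  assumes "finite A" and "\<And>x. x \<in> A \<Longrightarrow> f x abs_summable_on B x"
  shows "(\<lambda>g. \<Prod>x\<in>A. f x (g x)) abs_summable_on PiE A B"
  using assms
proof (induction A rule: finite_induct)
  case (insert x A)
  have pi: "PiE (insert x A) B = (\<lambda>(g,y). g(x:=y)) ` (PiE A B \<times> B x)"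
    unfolding PiE_insert_eq by (subst swap_product [symmetric]) (simp add: image_image case_prod_unfold)
  have inj: "inj_on (\<lambda>(g, y). g(x := y)) (PiE A B \<times> B x)"
    using insert(2) by (rule inj_combinator')
  have eq: "(\<Prod>z\<in>insert x A. f z ((g(x := y)) z)) = (\<Prod>z\<in>A. f z (g z)) * f x y" for g y
  proof -
    have "(\<Prod>z\<in>A. f z ((g(x := y)) z)) = (\<Prod>z\<in>A. f z (g z))"
      using insert(2) by (intro prod.cong) auto
    then show ?thesis using insert(1,2) by (simp add: mult.commute)
  qed
  have 1: "(\<lambda>g. norm (\<Prod>z\<in>A. f z (g z))) summable_on PiE A B" using insert by auto
  have 2: "(\<lambda>y. norm (f x y)) summable_on B x" using insert by auto
  have "(\<lambda>(g, y). norm (\<Prod>z\<in>A. f z (g z)) * norm (f x y)) summable_on PiE A B \<times> B x"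
  proof (rule nonneg_bdd_above_summable_on)
    show "bdd_above (sum (\<lambda>(g, y). norm (\<Prod>z\<in>A. f z (g z)) * norm (f x y)) ` {F. F \<subseteq> PiE A B \<times> B x \<and> finite F})"
    proof (intro bdd_aboveI[of _ "infsum (\<lambda>g. norm (\<Prod>z\<in>A. f z (g z))) (PiE A B) * infsum (\<lambda>y. norm (f x y)) (B x)"], safe)
      fix F assume F: "F \<subseteq> PiE A B \<times> B x" "finite F"
      have "sum (\<lambda>(g, y). norm (\<Prod>z\<in>A. f z (g z)) * norm (f x y)) F \<le>
          sum (\<lambda>(g, y). norm (\<Prod>z\<in>A. f z (g z)) * norm (f x y)) (fst ` F \<times> snd ` F)"
        using F by (intro sum_mono2) (auto simp: subset_fst_snd)
      also have "\<dots> = (\<Sum>g\<in>fst ` F. norm (\<Prod>z\<in>A. f z (g z))) * (\<Sum>y\<in>snd ` F. norm (f x y))"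
        by (simp add: sum_product sum.cartesian_product)
      also have "\<dots> \<le> infsum (\<lambda>g. norm (\<Prod>z\<in>A. f z (g z))) (PiE A B) * infsum (\<lambda>y. norm (f x y)) (B x)"
      proof (intro mult_mono finite_sum_le_infsum 1 2 infsum_nonneg sum_nonneg)
        show "fst ` F \<subseteq> PiE A B" "snd ` F \<subseteq> B x" using F(1) by (auto dest!: subsetD simp del: PiE_iff)
      qed (use F(2) in auto)
      finally show "sum (\<lambda>(g, y). norm (\<Prod>z\<in>A. f z (g z)) * norm (f x y)) F \<le>
         infsum (\<lambda>g. norm (\<Prod>z\<in>A. f z (g z))) (PiE A B) * infsum (\<lambda>y. norm (f x y)) (B x)" .
    qed
  qed auto
  then have "((\<lambda>h. norm (\<Prod>z\<in>insert x A. f z (h z))) \<circ> (\<lambda>(g, y). g(x := y))) summable_on PiE A B \<times> B x"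
    by (simp only: o_def case_prod_unfold eq norm_mult)
  then show ?case unfolding pi by (subst summable_on_reindex[OF inj])
qed auto

lemma expi_sum: "expi (\<Sum>i\<in>A. f i) = (\<Prod>i\<in>A. expi (f i))"
  by (induction A rule: infinite_finite_induct) (auto simp: expi_add)

context basis_lattice
begin

text \<open>A product function in the integer coordinates of \<open>int_dual B\<close>, extended by
  0 because generalized sums run over the whole space.\<close>

definition coord_prod :: "('a \<Rightarrow> int \<Rightarrow> complex) \<Rightarrow> 'a \<Rightarrow> complex" where
  "coord_prod \<psi> v = (if v \<in> int_dual B then \<Prod>\<beta>\<in>B. \<psi> \<beta> \<lfloor>coroot \<beta> \<bullet> v\<rfloor> else 0)"

lemma coord_prod_has_sum:
  assumes ab: "\<And>\<beta>. \<beta> \<in> B \<Longrightarrow> (\<lambda>n. norm (\<psi> \<beta> n)) summable_on UNIV"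
    and s: "\<And>\<beta>. \<beta> \<in> B \<Longrightarrow> (\<psi> \<beta> has_sum s \<beta>) UNIV"
  shows "(coord_prod \<psi> has_sum (\<Prod>\<beta>\<in>B. s \<beta>)) UNIV"
proof -
  note fin = rbasis_finite[OF B]
  let ?P = "PiE B (\<lambda>_. UNIV :: int set)"
  define h where "h g = (\<Sum>\<beta>\<in>B. of_int (g \<beta>) *\<^sub>R dualb B \<beta>)" for g :: "'a \<Rightarrow> int"
  have h: "coroot \<beta> \<bullet> h g = of_int (g \<beta>)" if "\<beta> \<in> B" for \<beta> g
    using that sum_if_eq_inner[OF fin that, of "\<lambda>b. of_int (g b)"]
    by (simp add: h_def inner_sum_right dualb_inner_left[OF B])
  have "bij_betw h ?P (int_dual B)"
  proof (rule bij_betwI[of _ _ _ "\<lambda>v. restrict (\<lambda>\<beta>. \<lfloor>coroot \<beta> \<bullet> v\<rfloor>) B"])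
    show "h \<in> ?P \<rightarrow> int_dual B" by (auto simp: int_dual_def h)
    show "restrict (\<lambda>\<beta>. \<lfloor>coroot \<beta> \<bullet> h g\<rfloor>) B = g" if "g \<in> ?P" for g
      using that by (auto simp: h PiE_def extensional_def)
    show "h (restrict (\<lambda>\<beta>. \<lfloor>coroot \<beta> \<bullet> v\<rfloor>) B) = v" if "v \<in> int_dual B" for v
    proof -
      have "h (restrict (\<lambda>\<beta>. \<lfloor>coroot \<beta> \<bullet> v\<rfloor>) B) = (\<Sum>\<beta>\<in>B. (coroot \<beta> \<bullet> v) *\<^sub>R dualb B \<beta>)"
        unfolding h_def using that by (intro sum.cong) (auto simp: int_dual_def)
      then show ?thesis using rbasis_expand[OF B, of v] by simp
    qed
  qed auto
  have "((\<lambda>g. \<Prod>\<beta>\<in>B. \<psi> \<beta> (g \<beta>)) has_sum (\<Prod>\<beta>\<in>B. infsum (\<psi> \<beta>) UNIV)) ?P"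
    unfolding has_sum_iff
    using abs_summable_summable[OF abs_summable_prod_PiE[OF fin ab]] infsum_prod_PiE_abs[OF fin ab] by auto
  also have "(\<Prod>\<beta>\<in>B. infsum (\<psi> \<beta>) UNIV) = (\<Prod>\<beta>\<in>B. s \<beta>)"
    using s by (intro prod.cong) (auto simp: infsumI)
  also have "((\<lambda>g. \<Prod>\<beta>\<in>B. \<psi> \<beta> (g \<beta>)) has_sum (\<Prod>\<beta>\<in>B. s \<beta>)) ?P \<longleftrightarrow>
      ((\<lambda>g. coord_prod \<psi> (h g)) has_sum (\<Prod>\<beta>\<in>B. s \<beta>)) ?P"
    by (rule has_sum_cong) (auto simp: coord_prod_def int_dual_def h)
  also have "\<dots> \<longleftrightarrow> (coord_prod \<psi> has_sum (\<Prod>\<beta>\<in>B. s \<beta>)) (int_dual B)"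
    by (rule has_sum_reindex_bij_betw) fact
  also have "\<dots> \<longleftrightarrow> (coord_prod \<psi> has_sum (\<Prod>\<beta>\<in>B. s \<beta>)) UNIV"
    by (rule has_sum_cong_neutral) (auto simp: coord_prod_def)
  finally show ?thesis .
qed

text \<open>A multiple of \<open>dualb B \<beta>\<close> moves only the coordinate \<beta>, so the
  difference operator acts on a single factor.\<close>

lemma twist_diff_coord_prod:
  assumes \<beta>: "\<beta> \<in> B"
  shows "twist_diff y (real m *\<^sub>R dualb B \<beta>) (coord_prod \<psi>) =
    coord_prod (\<psi>(\<beta> := (\<lambda>n. \<psi> \<beta> n - expi (real m * (y \<bullet> dualb B \<beta>)) * \<psi> \<beta> (n - int m))))"
proof
  fix v
  let ?w = "real m *\<^sub>R dualb B \<beta>"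
  have w: "coroot b \<bullet> ?w = (if b = \<beta> then real m else 0)" if "b \<in> B" for b
    using dualb_inner_left[OF B \<beta> that] by simp
  have "coroot b \<bullet> ?w \<in> \<int>" if "b \<in> B" for b unfolding w[OF that] by simp
  then have wB: "?w \<in> int_dual B" by (simp only: int_dual_def mem_Collect_eq ball_simps) blast
  have fin: "finite B" by (rule rbasis_finite[OF B])
  show "twist_diff y ?w (coord_prod \<psi>) v = coord_prod (\<psi>(\<beta> := (\<lambda>n. \<psi> \<beta> n - expi (real m * (y \<bullet> dualb B \<beta>)) * \<psi> \<beta> (n - int m)))) v"
  proof (cases "v \<in> int_dual B")
    case True
    then have "v - ?w \<in> int_dual B" using wB by (rule int_dual_diff)
    have "(\<Prod>b\<in>B. \<psi> b \<lfloor>coroot b \<bullet> (v - ?w)\<rfloor>) = \<psi> \<beta> (\<lfloor>coroot \<beta> \<bullet> v\<rfloor> - int m) * (\<Prod>b\<in>B-{\<beta>}. \<psi> b \<lfloor>coroot b \<bullet> v\<rfloor>)"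
    proof -
      have "\<lfloor>coroot \<beta> \<bullet> (v - ?w)\<rfloor> = \<lfloor>coroot \<beta> \<bullet> v\<rfloor> - int m"
      proof -
        have "coroot \<beta> \<bullet> (v - ?w) = coroot \<beta> \<bullet> v - of_int (int m)"
          using w[OF \<beta>] by (simp add: inner_diff_right del: inner_scaleR_right)
        then show ?thesis by (simp only: floor_diff_of_int)
      qed
      moreover have "\<lfloor>coroot b \<bullet> (v - ?w)\<rfloor> = \<lfloor>coroot b \<bullet> v\<rfloor>" if "b \<in> B - {\<beta>}" for b
        using w[of b] that by (simp add: inner_diff_right del: inner_scaleR_right)
      ultimately show ?thesis using fin \<beta> by (simp add: prod.remove[of B \<beta>])
    qed
    then show ?thesis
      using True \<open>v - ?w \<in> int_dual B\<close> fin \<beta>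
      by (simp add: twist_diff_def coord_prod_def prod.remove[of B \<beta>] algebra_simps)
  next
    case False
    moreover have "v - ?w \<notin> int_dual B" using False int_dual_add[OF _ wB, of "v - ?w"] by auto
    ultimately show ?thesis by (simp add: twist_diff_def coord_prod_def)
  qed
qed

text \<open>One difference step is spent on each coordinate in \<open>J\<close>; after these steps
  all factors are absolutely summable and the product theorem applies.\<close>

lemma coord_prod_gsum:
  assumes "finite J" "J \<subseteq> B"
    and \<chi>: "\<And>\<beta>. \<beta> \<in> J \<Longrightarrow> expi (real m * (y \<bullet> dualb B \<beta>)) \<noteq> 1"
    and J1: "\<And>\<beta>. \<beta> \<in> J \<Longrightarrow> (\<lambda>n. norm (\<psi> \<beta> n - expi (real m * (y \<bullet> dualb B \<beta>)) * \<psi> \<beta> (n - int m))) summable_on UNIV"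
    and J2: "\<And>\<beta>. \<beta> \<in> J \<Longrightarrow> ((\<lambda>n. \<psi> \<beta> n - expi (real m * (y \<bullet> dualb B \<beta>)) * \<psi> \<beta> (n - int m)) has_sum
                (1 - expi (real m * (y \<bullet> dualb B \<beta>))) * s \<beta>) UNIV"
    and I1: "\<And>\<beta>. \<beta> \<in> B - J \<Longrightarrow> (\<lambda>n. norm (\<psi> \<beta> n)) summable_on UNIV"
    and I2: "\<And>\<beta>. \<beta> \<in> B - J \<Longrightarrow> (\<psi> \<beta> has_sum s \<beta>) UNIV"
  shows "gsum y (coord_prod \<psi>) (\<Prod>\<beta>\<in>B. s \<beta>)"
  using assms
proof (induction J arbitrary: \<psi> s rule: finite_induct)
  case empty
  then show ?case by (intro gsum_base coord_prod_has_sum) auto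
next
  case (insert b J)
  let ?c = "expi (real m * (y \<bullet> dualb B b))"
  let ?\<psi> = "\<psi>(b := (\<lambda>n. \<psi> b n - ?c * \<psi> b (n - int m)))"
  let ?s = "s(b := (1 - ?c) * s b)"
  have b: "b \<in> B" using insert.prems by auto
  have "gsum y (coord_prod ?\<psi>) (\<Prod>\<beta>\<in>B. ?s \<beta>)"
  proof (rule insert.IH)
    fix \<beta> assume \<beta>: "\<beta> \<in> J"
    then have "\<beta> \<noteq> b" using insert.hyps by auto
    then show "expi (real m * (y \<bullet> dualb B \<beta>)) \<noteq> 1"
      "(\<lambda>n. norm (?\<psi> \<beta> n - expi (real m * (y \<bullet> dualb B \<beta>)) * ?\<psi> \<beta> (n - int m))) summable_on UNIV"
      "((\<lambda>n. ?\<psi> \<beta> n - expi (real m * (y \<bullet> dualb B \<beta>)) * ?\<psi> \<beta> (n - int m)) has_sum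
                (1 - expi (real m * (y \<bullet> dualb B \<beta>))) * ?s \<beta>) UNIV"
      using insert.prems(2-4)[of \<beta>] \<beta> by auto
  next
    fix \<beta> assume \<beta>: "\<beta> \<in> B - J"
    show "(\<lambda>n. norm (?\<psi> \<beta> n)) summable_on UNIV" "(?\<psi> \<beta> has_sum ?s \<beta>) UNIV"
      using insert.prems(3,4)[of b] insert.prems(5,6)[of \<beta>] \<beta> by (cases "\<beta> = b"; auto)+
  qed (use insert.prems in auto)
  moreover have "(\<Prod>\<beta>\<in>B. ?s \<beta>) = (1 - ?c) * (\<Prod>\<beta>\<in>B. s \<beta>)"
    using b rbasis_finite[OF B] by (simp add: prod.remove[of B b])
  ultimately have "gsum y (twist_diff y (real m *\<^sub>R dualb B b) (coord_prod \<psi>)) ((1 - ?c) * (\<Prod>\<beta>\<in>B. s \<beta>))"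
    by (simp only: twist_diff_coord_prod[OF b])
  then show ?case
    using insert.prems(2)[of b] gsum_step[of y "real m *\<^sub>R dualb B b" "coord_prod \<psi>" "\<Prod>\<beta>\<in>B. s \<beta>"] by simp
qed

text \<open>The generalized sum over the weight lattice is reduced to one over the finer lattice
  dual to \<open>B\<close> by averaging over the characters of the quotient.\<close>

lemma basis_term_gsum:
  assumes J: "J \<subseteq> B" and m: "\<And>\<beta>. \<beta> \<in> J \<Longrightarrow> real m *\<^sub>R dualb B \<beta> \<in> int_dual S"
    and y: "\<And>\<beta>. \<beta> \<in> J \<Longrightarrow> real m * (y \<bullet> dualb B \<beta>) \<notin> \<int>"
  shows "gsum y (\<lambda>v. if v \<in> int_dual S then expi (y \<bullet> v) * (\<Prod>\<beta>\<in>B-J. if coroot \<beta> \<bullet> v = 0 then 1 else 0) *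
                   (\<Prod>\<beta>\<in>J. bc (j \<beta>) (coroot \<beta> \<bullet> v)) else 0)
     (1 / of_nat (card (quot_reps S B)) * (\<Sum>q\<in>quot_reps S B. \<Prod>\<beta>\<in>J. of_real (bpol (j \<beta>) (frac ((y + q) \<bullet> dualb B \<beta>)))))"
proof -
  \<comment> \<open>Since (y + q) \<bullet> v is a sum over the coordinates of \<open>B\<close>, the
    exponential splits into one-dimensional factors. Coordinates outside \<open>J\<close> carry a
    Kronecker delta at 0.\<close>
  define \<psi> where "\<psi> q \<beta> n = (if \<beta> \<in> J then bc (j \<beta>) (of_int n) * expi (of_int n * ((y + q) \<bullet> dualb B \<beta>))
                              else if n = 0 then 1 else 0)" for q \<beta> n
  define s where "s q \<beta> = (if \<beta> \<in> J then of_real (bpol (j \<beta>) (frac ((y + q) \<bullet> dualb B \<beta>))) else 1 :: complex)" for q \<beta>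
  note fin = rbasis_finite[OF B]
  have fJ: "finite J" using J fin finite_subset by blast
  have gs: "gsum y (coord_prod (\<psi> q)) (\<Prod>\<beta>\<in>B. s q \<beta>)" if q: "q \<in> quot_reps S B" for q
  proof (rule coord_prod_gsum[where J = J and m = m])
    have qS: "q \<in> coroot_lattice S" using q quot_reps_subset by blast
    fix \<beta> assume \<beta>: "\<beta> \<in> J"
    define x where "x = (y + q) \<bullet> dualb B \<beta>"
    \<comment> \<open>A difference step multiplies by a phase depending on \<open>y\<close> alone,
      whereas the factor oscillates with y + q. The two agree because \<open>m\<close> moves the
      shift vector into the weight lattice, on which \<open>q\<close> is integral.\<close>
    have "q \<bullet> (real m *\<^sub>R dualb B \<beta>) \<in> \<int>" by (rule coroot_lattice_inner_int[OF qS m[OF \<beta>]])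
    then have ex: "expi (real m * (y \<bullet> dualb B \<beta>)) = expi (real m * x)"
      by (simp add: x_def inner_add_left distrib_left expi_add expi_eq_1[THEN iffD2])
    show "expi (real m * (y \<bullet> dualb B \<beta>)) \<noteq> 1" using y[OF \<beta>] by (simp add: expi_eq_1)
    have per: "expi (of_int n * x) = expi (of_int n * frac x)" for n
    proof -
      have "of_int n * x = of_int n * frac x + of_int (n * \<lfloor>x\<rfloor>)" by (simp add: frac_def algebra_simps)
      then show ?thesis by (simp only: expi_add expi_int mult_1_right)
    qed
    have eq: "\<psi> q \<beta> n - expi (real m * (y \<bullet> dualb B \<beta>)) * \<psi> q \<beta> (n - int m) =
       (bc (j \<beta>) (of_int n) - bc (j \<beta>) (of_int (n - int m))) * expi (of_int n * frac x)" for n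
    proof -
      have e: "expi (real m * x) * expi (of_int (n - int m) * x) = expi (of_int n * frac x)"
        unfolding expi_add[symmetric] per[symmetric] by (rule arg_cong[of _ _ expi]) (simp add: algebra_simps)
      have "expi (real m * x) * (c * expi (of_int (n - int m) * x)) = c * expi (of_int n * frac x)" for c
        unfolding e[symmetric] by (simp only: mult_ac)
      then show ?thesis using \<beta>
        by (simp only: \<psi>_def ex x_def[symmetric] left_diff_distrib if_True per)
    qed
    have perm: "expi (real m * x) = expi (real m * frac x)" using per[of "int m"] by simp
    show "(\<lambda>n. norm (\<psi> q \<beta> n - expi (real m * (y \<bullet> dualb B \<beta>)) * \<psi> q \<beta> (n - int m))) summable_on UNIV"
      unfolding eq norm_mult norm_expi mult_1_right by (rule bc_shift_summable)
    show "((\<lambda>n. \<psi> q \<beta> n - expi (real m * (y \<bullet> dualb B \<beta>)) * \<psi> q \<beta> (n - int m)) has_sum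
            (1 - expi (real m * (y \<bullet> dualb B \<beta>))) * s q \<beta>) UNIV"
      unfolding eq unfolding ex perm using \<beta> bc_shift_has_sum[of "frac x" "j \<beta>" m]
      by (simp add: s_def x_def less_imp_le frac_lt_1)
  next
    fix \<beta> assume \<beta>: "\<beta> \<in> B - J"
    have "(\<psi> q \<beta> has_sum s q \<beta>) {0} \<longleftrightarrow> (\<psi> q \<beta> has_sum s q \<beta>) UNIV"
      using \<beta> by (intro has_sum_cong_neutral) (auto simp: \<psi>_def)
    then show "(\<psi> q \<beta> has_sum s q \<beta>) UNIV"
      using \<beta> has_sum_finite[of "{0}" "\<psi> q \<beta>"] by (simp add: \<psi>_def s_def)
    have "(\<lambda>n. norm (\<psi> q \<beta> n)) summable_on {0} \<longleftrightarrow> (\<lambda>n. norm (\<psi> q \<beta> n)) summable_on UNIV"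
      using \<beta> by (intro summable_on_cong_neutral) (auto simp: \<psi>_def)
    then show "(\<lambda>n. norm (\<psi> q \<beta> n)) summable_on UNIV" by simp
  qed (use J fJ in auto)
  have "gsum y (\<lambda>v. 1 / of_nat (card (quot_reps S B)) * (\<Sum>q\<in>quot_reps S B. coord_prod (\<psi> q) v))
     (1 / of_nat (card (quot_reps S B)) * (\<Sum>q\<in>quot_reps S B. \<Prod>\<beta>\<in>B. s q \<beta>))"
    by (intro gsum_scale gsum_sum gs)
  moreover have "(\<Prod>\<beta>\<in>B. s q \<beta>) = (\<Prod>\<beta>\<in>J. of_real (bpol (j \<beta>) (frac ((y + q) \<bullet> dualb B \<beta>))))" for q
    by (rule prod.mono_neutral_cong_right) (use J fin in \<open>auto simp: s_def\<close>)
  moreover have "1 / of_nat (card (quot_reps S B)) * (\<Sum>q\<in>quot_reps S B. coord_prod (\<psi> q) v) =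
     (if v \<in> int_dual S then expi (y \<bullet> v) * (\<Prod>\<beta>\<in>B-J. if coroot \<beta> \<bullet> v = 0 then 1 else 0) *
                   (\<Prod>\<beta>\<in>J. bc (j \<beta>) (coroot \<beta> \<bullet> v)) else 0)" for v
  proof (cases "v \<in> int_dual B")
    case False
    then show ?thesis using int_dual_subset by (auto simp: coord_prod_def)
  next
    case True
    define R where "R = (\<Prod>\<beta>\<in>B-J. if coroot \<beta> \<bullet> v = 0 then 1 else 0) * (\<Prod>\<beta>\<in>J. bc (j \<beta>) (coroot \<beta> \<bullet> v))"
    have "coord_prod (\<psi> q) v = R * expi (y \<bullet> v) * expi (q \<bullet> v)" for q
    proof -
      have fl: "of_int \<lfloor>coroot \<beta> \<bullet> v\<rfloor> = coroot \<beta> \<bullet> v" if "\<beta> \<in> B" for \<beta>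
        using True that by (simp add: int_dual_def)
      then have fl0: "\<lfloor>coroot \<beta> \<bullet> v\<rfloor> = 0 \<longleftrightarrow> coroot \<beta> \<bullet> v = 0" if "\<beta> \<in> B" for \<beta>
        using that by (metis of_int_eq_0_iff)
      have "coord_prod (\<psi> q) v = (\<Prod>\<beta>\<in>B. \<psi> q \<beta> \<lfloor>coroot \<beta> \<bullet> v\<rfloor>)"
        using True by (simp add: coord_prod_def)
      also have "\<dots> = (\<Prod>\<beta>\<in>B-J. if coroot \<beta> \<bullet> v = 0 then 1 else 0) *
         (\<Prod>\<beta>\<in>J. bc (j \<beta>) (coroot \<beta> \<bullet> v) * expi ((coroot \<beta> \<bullet> v) * ((y + q) \<bullet> dualb B \<beta>)))"
      proof -
        have "(\<Prod>\<beta>\<in>B-J. \<psi> q \<beta> \<lfloor>coroot \<beta> \<bullet> v\<rfloor>) = (\<Prod>\<beta>\<in>B-J. if coroot \<beta> \<bullet> v = 0 then 1 else 0)"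
          by (intro prod.cong refl) (simp add: \<psi>_def fl0)
        moreover have "(\<Prod>\<beta>\<in>J. \<psi> q \<beta> \<lfloor>coroot \<beta> \<bullet> v\<rfloor>) =
            (\<Prod>\<beta>\<in>J. bc (j \<beta>) (coroot \<beta> \<bullet> v) * expi ((coroot \<beta> \<bullet> v) * ((y + q) \<bullet> dualb B \<beta>)))"
        proof (intro prod.cong refl)
          fix \<beta> assume "\<beta> \<in> J"
          then show "\<psi> q \<beta> \<lfloor>coroot \<beta> \<bullet> v\<rfloor> = bc (j \<beta>) (coroot \<beta> \<bullet> v) * expi ((coroot \<beta> \<bullet> v) * ((y + q) \<bullet> dualb B \<beta>))"
            using fl[of \<beta>] J by (simp only: \<psi>_def if_True subset_eq)
        qed
        ultimately show ?thesis by (simp only: prod.subset_diff[OF J fin])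
      qed
      also have "\<dots> = R * (\<Prod>\<beta>\<in>J. expi ((coroot \<beta> \<bullet> v) * ((y + q) \<bullet> dualb B \<beta>)))"
        by (simp add: R_def prod.distrib mult_ac)
      \<comment> \<open>If a delta factor vanishes, both sides are 0. Otherwise the coordinates
        outside \<open>J\<close> are 0 and the exponential product may be extended to all of
        \<open>B\<close>.\<close>
      also have "\<dots> = R * expi ((y + q) \<bullet> v)"
      proof (cases "\<exists>\<beta>\<in>B-J. coroot \<beta> \<bullet> v \<noteq> 0")
        case True
        then show ?thesis using fin by (simp add: R_def prod_zero_iff[OF finite_Diff[OF fin]])
      next
        case False
        have "(\<Prod>\<beta>\<in>J. expi ((coroot \<beta> \<bullet> v) * ((y + q) \<bullet> dualb B \<beta>))) = (\<Prod>\<beta>\<in>B. expi ((coroot \<beta> \<bullet> v) * ((y + q) \<bullet> dualb B \<beta>)))"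
          using False J fin by (intro prod.mono_neutral_left) auto
        also have "\<dots> = expi (\<Sum>\<beta>\<in>B. (coroot \<beta> \<bullet> v) * ((y + q) \<bullet> dualb B \<beta>))"
          by (rule expi_sum[symmetric])
        finally show ?thesis by (simp add: inner_expand[OF B, of "y + q" v])
      qed
      finally show ?thesis by (simp add: inner_add_left expi_add)
    qed
    then have "(\<Sum>q\<in>quot_reps S B. coord_prod (\<psi> q) v) = R * expi (y \<bullet> v) * (\<Sum>q\<in>quot_reps S B. expi (q \<bullet> v))"
      by (simp add: sum_distrib_left)
    then show ?thesis
      using character_sum[OF True] quot_reps_nonempty finite_quot_reps by (simp add: R_def)
  qed
  ultimately show ?thesis by simp
qed

end

section \<open>Partial fractions and broken circuits\<close>

definition basis_completions :: "'a::euclidean_space set \<Rightarrow> 'a set \<Rightarrow> 'a set set" where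
  "basis_completions I E = {J. J \<subseteq> E \<and> rbasis (I \<union> J)}"

text \<open>The value at the coroot of \<gamma> of the linear form that equals \<open>t\<close> on
  the coroots of \<open>J\<close> and 0 on those of \<open>I\<close>.\<close>

definition lin_ext :: "'a::euclidean_space set \<Rightarrow> 'a set \<Rightarrow> ('a \<Rightarrow> complex) \<Rightarrow> 'a \<Rightarrow> complex" where
  "lin_ext I J t \<gamma> = (\<Sum>\<beta>\<in>J. t \<beta> * of_real (coroot \<gamma> \<bullet> dualb (I \<union> J) \<beta>))"

lemma coroot_span: "\<gamma> \<noteq> 0 \<Longrightarrow> coroot \<gamma> \<in> span S \<Longrightarrow> \<gamma> \<in> span S"
proof -
  assume "\<gamma> \<noteq> 0" "coroot \<gamma> \<in> span S"
  then have "((\<gamma> \<bullet> \<gamma>) / 2) *\<^sub>R coroot \<gamma> \<in> span S" by (intro span_scale)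
  then show ?thesis using \<open>\<gamma> \<noteq> 0\<close> by (simp add: coroot_def)
qed

lemma coroot_in_span: "\<gamma> \<in> span S \<Longrightarrow> coroot \<gamma> \<in> span S"
  unfolding coroot_def by (rule span_scale)

lemma fps_const_sum: "(\<Sum>i\<in>A. fps_const (f i)) = fps_const (\<Sum>i\<in>A. f i :: 'b::comm_ring_1)"
  by (rule fps_ext) (simp add: fps_sum_nth)

text \<open>A linear relation among the linear forms lets one remove one factor at a time from the product;
  working with formal power series in the scaling variable avoids dividing by forms that may vanish.\<close>

lemma partial_fraction:
  fixes U :: "'a::euclidean_space \<Rightarrow> complex fps"
  assumes "finite E" "I \<inter> E = {}" "0 \<notin> E" "independent I" "span (I \<union> E) = UNIV"
    and U: "\<And>\<gamma>. \<gamma> \<in> E \<Longrightarrow> U \<gamma> * (fps_const (t \<gamma>) * fps_X - fps_const (c * of_real (coroot \<gamma> \<bullet> v))) = fps_const (t \<gamma>) * fps_X"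
    and v: "\<And>\<nu>. \<nu> \<in> I \<Longrightarrow> coroot \<nu> \<bullet> v = 0"
    and reg: "\<And>J \<gamma>. J \<in> basis_completions I E \<Longrightarrow> \<gamma> \<in> E - J \<Longrightarrow> t \<gamma> - lin_ext I J t \<gamma> \<noteq> 0"
  shows "(\<Prod>\<gamma>\<in>E. U \<gamma>) = (\<Sum>J\<in>basis_completions I E.
           fps_const (\<Prod>\<gamma>\<in>E-J. t \<gamma> / (t \<gamma> - lin_ext I J t \<gamma>)) * (\<Prod>\<beta>\<in>J. U \<beta>))"
  using assms
proof (induction "card E" arbitrary: E rule: less_induct)
  case less
  note fE = less.prems(1) and IE = less.prems(2) and nz = less.prems(3) and spanE = less.prems(5) and reg = less.prems(8)
  note U = less.prems(6)
  show ?case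
  proof (cases "independent (I \<union> E)")
    case True
    have "J = E" if "J \<in> basis_completions I E" for J
    proof (rule ccontr)
      assume "J \<noteq> E"
      moreover have "J \<subseteq> E" using that by (simp add: basis_completions_def)
      ultimately obtain e where e: "e \<in> E" "e \<notin> J" by auto
      then have "I \<union> J \<subseteq> I \<union> E - {e}" using that IE by (auto simp: basis_completions_def)
      from span_mono[OF this] have "e \<in> span (I \<union> E - {e})" using that by (auto simp: basis_completions_def rbasis_def)
      then show False using True e dependent_def by blast
    qed
    moreover have "E \<in> basis_completions I E" using True spanE by (simp add: basis_completions_def rbasis_def)
    ultimately have "basis_completions I E = {E}" by auto
    then show ?thesis by simp
  next
    case False
    obtain B0 where B0: "I \<subseteq> B0" "B0 \<subseteq> I \<union> E" "independent B0" "I \<union> E \<subseteq> span B0"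
      using maximal_independent_subset_extend[of I "I \<union> E"] less.prems(4) by auto
    define J0 where "J0 = B0 - I"
    have B0eq: "B0 = I \<union> J0" and J0E: "J0 \<subseteq> E" using B0 by (auto simp: J0_def)
    have IJ0: "I \<inter> J0 = {}" by (auto simp: J0_def)
    have spanB0: "span B0 = UNIV" using B0(4) spanE by (metis span_mono span_span top.extremum_uniqueI)
    have B0b: "rbasis B0" using B0(3) spanB0 by (simp add: rbasis_def)
    have "J0 \<in> basis_completions I E" using J0E B0b B0eq by (simp add: basis_completions_def)
    have "J0 \<noteq> E" using False B0(3) B0eq by auto
    then obtain g0 where g0: "g0 \<in> E" "g0 \<notin> J0" using J0E by auto
    \<comment> \<open>Expanding \<open>g0\<close> in the basis gives a linear relation on
      \<open>C\<close> modulo the coroots of \<open>I\<close>, with coefficients \<open>r\<close>.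
      It becomes an exact relation on every vector orthogonal to \<open>I\<close>.\<close>
    define C where "C = insert g0 J0"
    define r where "r \<gamma> = (if \<gamma> = g0 then 1 else - (coroot g0 \<bullet> dualb B0 \<gamma>))" for \<gamma>
    have fJ0: "finite J0" using J0E fE finite_subset by blast
    have fI: "finite I" using rbasis_finite[OF B0b] B0(1) finite_subset by blast
    have CE: "C \<subseteq> E" using g0 J0E by (auto simp: C_def)
    have fC: "finite C" using fJ0 by (simp add: C_def)
    have sumC: "(\<Sum>\<gamma>\<in>C. f \<gamma>) = f g0 + (\<Sum>\<beta>\<in>J0. f \<beta>)" for f :: "'a \<Rightarrow> 'b::comm_monoid_add"
      using g0 fJ0 by (simp add: C_def)
    have expg0: "coroot g0 = (\<Sum>\<beta>\<in>I. (coroot g0 \<bullet> dualb B0 \<beta>) *\<^sub>R coroot \<beta>) + (\<Sum>\<beta>\<in>J0. (coroot g0 \<bullet> dualb B0 \<beta>) *\<^sub>R coroot \<beta>)"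
      using rbasis_expand_coroot[OF B0b, of "coroot g0"] unfolding B0eq
      by (subst (asm) sum.union_disjoint[OF fI fJ0 IJ0])
    have rJ0: "(\<Sum>\<beta>\<in>J0. r \<beta> *\<^sub>R f \<beta>) = - (\<Sum>\<beta>\<in>J0. (coroot g0 \<bullet> dualb B0 \<beta>) *\<^sub>R f \<beta>)" for f :: "'a \<Rightarrow> 'b::real_vector"
      unfolding sum_negf[symmetric] using g0 by (intro sum.cong) (auto simp: r_def)
    have rel: "(\<Sum>\<gamma>\<in>C. r \<gamma> *\<^sub>R coroot \<gamma>) = (\<Sum>\<beta>\<in>I. (coroot g0 \<bullet> dualb B0 \<beta>) *\<^sub>R coroot \<beta>)"
      unfolding sumC rJ0 by (simp only: r_def simp_thms if_True scaleR_one add_uminus_conv_diff diff_eq_eq) (rule expg0)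
    have rel0: "(\<Sum>\<gamma>\<in>C. r \<gamma> * (coroot \<gamma> \<bullet> w)) = 0" if "\<And>\<nu>. \<nu> \<in> I \<Longrightarrow> coroot \<nu> \<bullet> w = 0" for w
      using arg_cong[OF rel, of "\<lambda>z. z \<bullet> w"] that by (simp add: inner_sum_left)
    \<comment> \<open>The relation evaluated at \<open>t\<close>. Regularity at the completion
      \<open>J0\<close> makes it nonzero, so it can be divided out at the end.\<close>
    define \<sigma> where "\<sigma> = (\<Sum>\<gamma>\<in>C. of_real (r \<gamma>) * t \<gamma>)"
    have "\<sigma> = t g0 - lin_ext I J0 t g0"
      unfolding \<sigma>_def sumC lin_ext_def B0eq[symmetric] using rJ0[of t]
      by (simp add: r_def scaleR_conv_of_real mult.commute)
    then have \<sigma>0: "\<sigma> \<noteq> 0" using reg[OF \<open>J0 \<in> basis_completions I E\<close>] g0 by auto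
    \<comment> \<open>An element with nonzero coefficient in the relation is redundant for spanning,
      so the induction hypothesis applies after its removal.\<close>
    have spanC: "span (I \<union> (E - {\<gamma>})) = UNIV" if g: "\<gamma> \<in> C" "r \<gamma> \<noteq> 0" for \<gamma>
    proof -
      let ?S = "I \<union> (E - {\<gamma>})"
      have 1: "(\<Sum>\<gamma>\<in>C. r \<gamma> *\<^sub>R coroot \<gamma>) \<in> span ?S"
        unfolding rel by (intro span_sum span_scale coroot_in_span span_base) auto
      have 2: "(\<Sum>\<gamma>\<in>C - {\<gamma>}. r \<gamma> *\<^sub>R coroot \<gamma>) \<in> span ?S"
        using CE by (intro span_sum span_scale coroot_in_span span_base) auto
      have "r \<gamma> *\<^sub>R coroot \<gamma> = (\<Sum>\<gamma>\<in>C. r \<gamma> *\<^sub>R coroot \<gamma>) - (\<Sum>\<gamma>\<in>C - {\<gamma>}. r \<gamma> *\<^sub>R coroot \<gamma>)"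
        using g fC by (simp add: sum.remove[of C \<gamma>])
      then have "r \<gamma> *\<^sub>R coroot \<gamma> \<in> span ?S" using span_diff[OF 1 2] by simp
      from span_scale[OF this, of "1 / r \<gamma>"] have "coroot \<gamma> \<in> span ?S" using g by simp
      moreover have "\<gamma> \<noteq> 0" using g CE nz by blast
      ultimately have "\<gamma> \<in> span ?S" by (rule coroot_span[rotated])
      moreover have "?S \<subseteq> span ?S" by (rule span_superset)
      ultimately have "I \<union> E \<subseteq> span ?S" by blast
      then have "span (I \<union> E) \<subseteq> span ?S" by (rule span_minimal) (rule subspace_span)
      then show ?thesis using spanE by blast
    qed
    define d where "d J \<gamma> = t \<gamma> - lin_ext I J t \<gamma>" for J \<gamma>
    define G where "G F J = fps_const (\<Prod>\<gamma>\<in>F-J. t \<gamma> / d J \<gamma>) * (\<Prod>\<beta>\<in>J. U \<beta>)" for F J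
    have IH: "(\<Prod>\<delta>\<in>E-{\<gamma>}. U \<delta>) = (\<Sum>J\<in>{J\<in>basis_completions I E. \<gamma> \<notin> J}. G (E - {\<gamma>}) J)"
      if g: "\<gamma> \<in> C" "r \<gamma> \<noteq> 0" for \<gamma>
    proof -
      have eq: "{J\<in>basis_completions I E. \<gamma> \<notin> J} = basis_completions I (E - {\<gamma>})"
        by (auto simp: basis_completions_def)
      show ?thesis unfolding eq G_def d_def
      proof (rule less.hyps)
        show "card (E - {\<gamma>}) < card E" using g CE fE by (intro psubset_card_mono) auto
        show "span (I \<union> (E - {\<gamma>})) = UNIV" by (rule spanC[OF g])
        show "t \<gamma>' - lin_ext I J t \<gamma>' \<noteq> 0" if "J \<in> basis_completions I (E - {\<gamma>})" "\<gamma>' \<in> E - {\<gamma>} - J" for J \<gamma>'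
          using that reg[of J \<gamma>'] by (auto simp: basis_completions_def)
      qed (use fE IE nz less.prems(4) U v in auto)
    qed
    have step: "fps_const \<sigma> * (\<Prod>\<gamma>\<in>E. U \<gamma>) = (\<Sum>\<gamma>\<in>C. fps_const (of_real (r \<gamma>) * t \<gamma>) * (\<Prod>\<delta>\<in>E-{\<gamma>}. U \<delta>))"
    proof -
      \<comment> \<open>After multiplication by \<open>fps_X\<close> every term contains t X, which
        is \<open>U\<close> times its denominator. The parts of the denominators depending on
        \<open>v\<close> cancel by the relation, \<sigma> X remains, and \<open>fps_X\<close> is
        then cancelled.\<close>
      have "fps_X * (\<Sum>\<gamma>\<in>C. fps_const (of_real (r \<gamma>) * t \<gamma>) * (\<Prod>\<delta>\<in>E-{\<gamma>}. U \<delta>)) =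
          (\<Sum>\<gamma>\<in>C. fps_const (of_real (r \<gamma>)) * (fps_const (t \<gamma>) * fps_X - fps_const (c * of_real (coroot \<gamma> \<bullet> v)))) * (\<Prod>\<gamma>\<in>E. U \<gamma>)"
        unfolding sum_distrib_left sum_distrib_right
      proof (rule sum.cong[OF refl])
        fix \<gamma> assume "\<gamma> \<in> C"
        then have g: "\<gamma> \<in> E" using CE by auto
        have "fps_X * (fps_const (of_real (r \<gamma>) * t \<gamma>) * (\<Prod>\<delta>\<in>E-{\<gamma>}. U \<delta>)) =
          fps_const (of_real (r \<gamma>)) * (fps_const (t \<gamma>) * fps_X) * (\<Prod>\<delta>\<in>E-{\<gamma>}. U \<delta>)"
          unfolding fps_const_mult[symmetric] by (simp only: mult_ac)
        also have "\<dots> = fps_const (of_real (r \<gamma>)) * (fps_const (t \<gamma>) * fps_X - fps_const (c * of_real (coroot \<gamma> \<bullet> v))) * (U \<gamma> * (\<Prod>\<delta>\<in>E-{\<gamma>}. U \<delta>))"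
        proof -
          have "fps_const (of_real (r \<gamma>)) * (fps_const (t \<gamma>) * fps_X) * (\<Prod>\<delta>\<in>E-{\<gamma>}. U \<delta>) =
            fps_const (of_real (r \<gamma>)) * (U \<gamma> * (fps_const (t \<gamma>) * fps_X - fps_const (c * of_real (coroot \<gamma> \<bullet> v)))) * (\<Prod>\<delta>\<in>E-{\<gamma>}. U \<delta>)"
            by (simp only: U[OF g])
          then show ?thesis by (simp only: mult_ac)
        qed
        also have "U \<gamma> * (\<Prod>\<delta>\<in>E-{\<gamma>}. U \<delta>) = (\<Prod>\<gamma>\<in>E. U \<gamma>)" using g fE by (simp add: prod.remove)
        finally show "fps_X * (fps_const (of_real (r \<gamma>) * t \<gamma>) * (\<Prod>\<delta>\<in>E-{\<gamma>}. U \<delta>)) =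
          fps_const (of_real (r \<gamma>)) * (fps_const (t \<gamma>) * fps_X - fps_const (c * of_real (coroot \<gamma> \<bullet> v))) * (\<Prod>\<gamma>\<in>E. U \<gamma>)" .
      qed
      also have "(\<Sum>\<gamma>\<in>C. fps_const (of_real (r \<gamma>)) * (fps_const (t \<gamma>) * fps_X - fps_const (c * of_real (coroot \<gamma> \<bullet> v)))) = fps_const \<sigma> * fps_X"
      proof -
        have "(\<Sum>\<gamma>\<in>C. fps_const (of_real (r \<gamma>)) * (fps_const (t \<gamma>) * fps_X - fps_const (c * of_real (coroot \<gamma> \<bullet> v)))) =
          (\<Sum>\<gamma>\<in>C. fps_const (of_real (r \<gamma>) * t \<gamma>)) * fps_X - (\<Sum>\<gamma>\<in>C. fps_const (of_real (r \<gamma>) * (c * of_real (coroot \<gamma> \<bullet> v))))"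
          unfolding sum_distrib_right sum_subtractf[symmetric]
          by (intro sum.cong refl) (simp add: right_diff_distrib mult.assoc flip: fps_const_mult)
        also have "(\<Sum>\<gamma>\<in>C. fps_const (of_real (r \<gamma>) * (c * of_real (coroot \<gamma> \<bullet> v)))) = fps_const (c * of_real (\<Sum>\<gamma>\<in>C. r \<gamma> * (coroot \<gamma> \<bullet> v)))"
          by (simp add: fps_const_sum sum_distrib_left mult_ac)
        also have "(\<Sum>\<gamma>\<in>C. r \<gamma> * (coroot \<gamma> \<bullet> v)) = 0" by (rule rel0) (rule less.prems(7))
        finally show ?thesis by (simp add: \<sigma>_def fps_const_sum)
      qed
      finally have "fps_X * (\<Sum>\<gamma>\<in>C. fps_const (of_real (r \<gamma>) * t \<gamma>) * (\<Prod>\<delta>\<in>E-{\<gamma>}. U \<delta>)) = fps_X * (fps_const \<sigma> * (\<Prod>\<gamma>\<in>E. U \<gamma>))"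
        by (simp only: mult_ac)
      then show ?thesis by (subst (asm) mult_left_cancel) (auto simp: fps_X_neq_zero)
    qed
    also have "\<dots> = (\<Sum>\<gamma>\<in>C. \<Sum>J\<in>basis_completions I E. if \<gamma> \<in> J then 0 else fps_const (of_real (r \<gamma>) * t \<gamma>) * G (E - {\<gamma>}) J)"
    proof (rule sum.cong[OF refl])
      fix \<gamma> assume g: "\<gamma> \<in> C"
      have fin: "finite (basis_completions I E)"
        by (rule finite_subset[of _ "Pow E"]) (auto simp: basis_completions_def fE)
      show "fps_const (of_real (r \<gamma>) * t \<gamma>) * (\<Prod>\<delta>\<in>E-{\<gamma>}. U \<delta>) =
        (\<Sum>J\<in>basis_completions I E. if \<gamma> \<in> J then 0 else fps_const (of_real (r \<gamma>) * t \<gamma>) * G (E - {\<gamma>}) J)"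
      proof (cases "r \<gamma> = 0")
        case True
        then show ?thesis by (simp add: if_distrib cong: if_cong)
      next
        case False
        have "(\<Sum>J\<in>basis_completions I E. if \<gamma> \<in> J then 0 else fps_const (of_real (r \<gamma>) * t \<gamma>) * G (E - {\<gamma>}) J) =
          (\<Sum>J\<in>{J\<in>basis_completions I E. \<gamma> \<notin> J}. fps_const (of_real (r \<gamma>) * t \<gamma>) * G (E - {\<gamma>}) J)"
          using fin by (intro sum.mono_neutral_cong_right) auto
        then show ?thesis unfolding IH[OF g False] by (simp only: sum_distrib_left)
      qed
    qed
    also have "\<dots> = (\<Sum>J\<in>basis_completions I E. \<Sum>\<gamma>\<in>C. if \<gamma> \<in> J then 0 else fps_const (of_real (r \<gamma>) * t \<gamma>) * G (E - {\<gamma>}) J)"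
      by (rule sum.swap)
    also have "\<dots> = (\<Sum>J\<in>basis_completions I E. fps_const \<sigma> * G E J)"
    proof (rule sum.cong[OF refl])
      fix J assume J: "J \<in> basis_completions I E"
      then have JE: "J \<subseteq> E" and Jb: "rbasis (I \<union> J)" by (auto simp: basis_completions_def)
      have fJ: "finite J" using JE fE finite_subset by blast
      have dJ: "d J \<gamma> = 0" if "\<gamma> \<in> J" for \<gamma>
      proof -
        have "lin_ext I J t \<gamma> = (\<Sum>\<beta>\<in>J. if \<beta> = \<gamma> then t \<beta> else 0)"
          unfolding lin_ext_def using that by (intro sum.cong refl) (auto simp: dualb_inner_left[OF Jb])
        then show ?thesis using that fJ by (simp add: d_def)
      qed
      \<comment> \<open>The form extending \<open>t\<close> from \<open>J\<close> respects the
        relation, so subtracting it does not change \<sigma>. Thus \<sigma> splits into the weights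
        \<open>r \<gamma> * d J \<gamma>\<close>, each of which restores the factor missing over
        \<open>E - {\<gamma>}\<close>.\<close>
      have "(\<Sum>\<gamma>\<in>C. of_real (r \<gamma>) * lin_ext I J t \<gamma>) = (\<Sum>\<beta>\<in>J. t \<beta> * of_real (\<Sum>\<gamma>\<in>C. r \<gamma> * (coroot \<gamma> \<bullet> dualb (I \<union> J) \<beta>)))"
        unfolding lin_ext_def sum_distrib_left of_real_sum by (subst sum.swap) (simp add: mult_ac)
      also have "\<dots> = 0"
      proof (rule sum.neutral, rule ballI)
        fix \<beta> assume \<beta>: "\<beta> \<in> J"
        have "(\<Sum>\<gamma>\<in>C. r \<gamma> * (coroot \<gamma> \<bullet> dualb (I \<union> J) \<beta>)) = 0"
          using \<beta> JE IE by (intro rel0) (auto simp: dualb_inner_left[OF Jb])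
        then show "t \<beta> * of_real (\<Sum>\<gamma>\<in>C. r \<gamma> * (coroot \<gamma> \<bullet> dualb (I \<union> J) \<beta>)) = 0" by simp
      qed
      finally have \<sigma>d: "(\<Sum>\<gamma>\<in>C. of_real (r \<gamma>) * d J \<gamma>) = \<sigma>"
        by (simp add: d_def \<sigma>_def right_diff_distrib sum_subtractf)
      have "(if \<gamma> \<in> J then 0 else fps_const (of_real (r \<gamma>) * t \<gamma>) * G (E - {\<gamma>}) J) = fps_const (of_real (r \<gamma>) * d J \<gamma>) * G E J"
        if g: "\<gamma> \<in> C" for \<gamma>
      proof (cases "\<gamma> \<in> J")
        case True
        then show ?thesis by (simp add: dJ)
      next
        case False
        have gE: "\<gamma> \<in> E - J" using g CE False by auto
        have d0: "d J \<gamma> \<noteq> 0" unfolding d_def by (rule reg[OF J gE])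
        have "(\<Prod>\<gamma>\<in>E-J. t \<gamma> / d J \<gamma>) = t \<gamma> / d J \<gamma> * (\<Prod>\<gamma>\<in>E-{\<gamma>}-J. t \<gamma> / d J \<gamma>)"
          using gE fE by (subst prod.remove[of _ \<gamma>]) (auto intro!: prod.cong)
        then have "(of_real (r \<gamma>) * t \<gamma>) * (\<Prod>\<gamma>\<in>E-{\<gamma>}-J. t \<gamma> / d J \<gamma>) = (of_real (r \<gamma>) * d J \<gamma>) * (\<Prod>\<gamma>\<in>E-J. t \<gamma> / d J \<gamma>)"
          using d0 by simp
        then show ?thesis using False by (simp add: G_def mult.assoc[symmetric])
      qed
      then have "(\<Sum>\<gamma>\<in>C. if \<gamma> \<in> J then 0 else fps_const (of_real (r \<gamma>) * t \<gamma>) * G (E - {\<gamma>}) J) = (\<Sum>\<gamma>\<in>C. fps_const (of_real (r \<gamma>) * d J \<gamma>)) * G E J"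
        unfolding sum_distrib_right by (intro sum.cong refl)
      then show "(\<Sum>\<gamma>\<in>C. if \<gamma> \<in> J then 0 else fps_const (of_real (r \<gamma>) * t \<gamma>) * G (E - {\<gamma>}) J) = fps_const \<sigma> * G E J"
        by (simp add: fps_const_sum \<sigma>d)
    qed
    finally have "fps_const \<sigma> * (\<Prod>\<gamma>\<in>E. U \<gamma>) = fps_const \<sigma> * (\<Sum>J\<in>basis_completions I E. G E J)"
      by (simp only: sum_distrib_left)
    then show ?thesis using \<sigma>0 by (simp add: G_def d_def)
  qed
qed

text \<open>The subsets of the list containing no broken circuit, where a broken circuit is a circuit
  without its last element.\<close>

definition nbc :: "'a::euclidean_space list \<Rightarrow> 'a set \<Rightarrow> bool" where
  "nbc nus I \<longleftrightarrow> I \<subseteq> set nus \<and> (\<forall>j<length nus. nus ! j \<notin> span (I \<inter> set (take j nus)))"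

lemma nbc_independent:
  assumes "nbc nus I" shows "independent I"
proof -
  have "independent (I \<inter> set (take j nus))" if "j \<le> length nus" for j
    using that
  proof (induction j)
    case (Suc j)
    then have "set (take (Suc j) nus) = insert (nus ! j) (set (take j nus))"
      by (simp add: take_Suc_conv_app_nth)
    moreover have "nus ! j \<notin> span (I \<inter> set (take j nus))" using assms Suc.prems by (simp add: nbc_def)
    ultimately show ?case using Suc by (cases "nus ! j \<in> I") (auto simp: independent_insert)
  qed (simp add: independent_empty)
  from this[of "length nus"] show ?thesis using assms by (simp add: nbc_def Int_absorb2)
qed

text \<open>Whitney's broken circuit theorem; the involution toggles the last element of the flat.\<close>

lemma nbc_alternating_sum:
  assumes dist: "distinct nus" and nz: "0 \<notin> set nus"
  shows "(\<Sum>I | nbc nus I \<and> (\<forall>\<nu>\<in>I. \<nu> \<bullet> v = 0). (-1) ^ card I) = (if \<exists>\<nu>\<in>set nus. \<nu> \<bullet> v = 0 then 0 else (1::complex))"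
proof (cases "\<exists>\<nu>\<in>set nus. \<nu> \<bullet> v = 0")
  case False
  have "{I. nbc nus I \<and> (\<forall>\<nu>\<in>I. \<nu> \<bullet> v = 0)} = {{}}"
    using False nz by (auto simp: nbc_def; metis nth_mem)
  then show ?thesis using False by simp
next
  case True
  define i where "i = Max {i. i < length nus \<and> (nus ! i) \<bullet> v = 0}"
  have ne: "{i. i < length nus \<and> (nus ! i) \<bullet> v = 0} \<noteq> {}" using True by (auto simp: in_set_conv_nth)
  have i: "i < length nus" "(nus ! i) \<bullet> v = 0"
    using Max_in[OF _ ne] by (auto simp: i_def)
  have imax: "(nus ! j) \<bullet> v \<noteq> 0" if "j > i" "j < length nus" for j
    using that Max_ge[of "{i. i < length nus \<and> (nus ! i) \<bullet> v = 0}" j] by (fastforce simp: i_def)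
  define a where "a = nus ! i"
  \<comment> \<open>Inserting \<open>a\<close> leaves the prefixes up to its own position unchanged.
    Later elements are not orthogonal to \<open>v\<close> by maximality, hence cannot lie in a span
    of vectors that are.\<close>
  have iff: "nbc nus (insert a I) \<longleftrightarrow> nbc nus I" if I: "\<forall>\<nu>\<in>I. \<nu> \<bullet> v = 0" for I
  proof
    assume n: "nbc nus (insert a I)"
    have "span (I \<inter> set (take j nus)) \<subseteq> span (insert a I \<inter> set (take j nus))" for j
      by (rule span_mono) auto
    then show "nbc nus I" using n by (auto simp: nbc_def)
  next
    assume n: "nbc nus I"
    show "nbc nus (insert a I)" unfolding nbc_def
    proof (intro conjI allI impI)
      show "insert a I \<subseteq> set nus" using n i by (auto simp: nbc_def a_def)
      fix j assume j: "j < length nus"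
      show "nus ! j \<notin> span (insert a I \<inter> set (take j nus))"
      proof (cases "j \<le> i")
        case True
        have "a \<notin> set (take j nus)"
          using True dist i j by (auto simp: a_def in_set_conv_nth nth_eq_iff_index_eq)
        then show ?thesis using n j by (simp add: nbc_def)
      next
        case False
        have "orthogonal v x" if "x \<in> span (insert a I \<inter> set (take j nus))" for x
          using that by (rule orthogonal_to_span) (use I i in \<open>auto simp: orthogonal_def a_def inner_commute[of v]\<close>)
        then show ?thesis using imax[of j] False j by (auto simp: orthogonal_def inner_commute[of v])
      qed
    qed
  qed
  let ?N = "{I. nbc nus I \<and> (\<forall>\<nu>\<in>I. \<nu> \<bullet> v = 0)}"
  have fin: "finite ?N" by (rule finite_subset[of _ "Pow (set nus)"]) (auto simp: nbc_def)
  have finN: "finite {I\<in>?N. a \<notin> I}" by (rule finite_subset[OF _ fin]) auto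
  have split: "?N = {I\<in>?N. a \<notin> I} \<union> insert a ` {I\<in>?N. a \<notin> I}"
  proof (intro equalityI subsetI)
    fix I assume I: "I \<in> ?N"
    show "I \<in> {I\<in>?N. a \<notin> I} \<union> insert a ` {I\<in>?N. a \<notin> I}"
    proof (cases "a \<in> I")
      case True
      then have "I = insert a (I - {a})" by auto
      moreover have "nbc nus (I - {a})" using iff[of "I - {a}"] I True by (simp add: insert_absorb)
      ultimately show ?thesis using I by blast
    qed (use I in auto)
  next
    fix I assume "I \<in> {I\<in>?N. a \<notin> I} \<union> insert a ` {I\<in>?N. a \<notin> I}"
    then show "I \<in> ?N" using iff i by (auto simp: a_def)
  qed
  have "(\<Sum>I\<in>?N. (-1) ^ card I) = (\<Sum>I\<in>{I\<in>?N. a \<notin> I}. (-1) ^ card I) + (\<Sum>I\<in>insert a ` {I\<in>?N. a \<notin> I}. (-1::complex) ^ card I)"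
    by (subst split, rule sum.union_disjoint[OF finN finite_imageI[OF finN]]) auto
  also have "(\<Sum>I\<in>insert a ` {I\<in>?N. a \<notin> I}. (-1::complex) ^ card I) = (\<Sum>I\<in>{I\<in>?N. a \<notin> I}. (-1) ^ card (insert a I))"
    by (rule sum.reindex_cong[of "insert a"]) (auto simp: inj_on_def)
  also have "\<dots> = - (\<Sum>I\<in>{I\<in>?N. a \<notin> I}. (-1) ^ card I)"
  proof (subst sum_negf[symmetric], rule sum.cong[OF refl])
    fix I assume "I \<in> {I\<in>?N. a \<notin> I}"
    then have "finite I" "a \<notin> I" by (auto simp: nbc_def intro: finite_subset)
    then show "(-1) ^ card (insert a I) = - ((-1::complex) ^ card I)" by simp
  qed
  finally show ?thesis using True by simp
qed

section \<open>The Weyl group\<close>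

lemma linear_reflection: "linear (reflection \<alpha>)"
  unfolding reflection_def
  by (intro linearI) (simp_all add: inner_add_right algebra_simps)

lemma coroot_inner_self: "\<alpha> \<noteq> 0 \<Longrightarrow> coroot \<alpha> \<bullet> \<alpha> = 2"
  by (simp add: coroot_def)

lemma reflection_self: "\<alpha> \<noteq> 0 \<Longrightarrow> reflection \<alpha> \<alpha> = - \<alpha>"
  by (simp add: reflection_def coroot_inner_self scaleR_2)

lemma reflection_reflection: "\<alpha> \<noteq> 0 \<Longrightarrow> reflection \<alpha> (reflection \<alpha> v) = v"
  by (simp add: reflection_def inner_diff_right coroot_inner_self algebra_simps)

lemma coroot_swap: "(coroot \<alpha> \<bullet> v) * (\<alpha> \<bullet> w) = (coroot \<alpha> \<bullet> w) * (\<alpha> \<bullet> v)"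
  by (simp add: coroot_def)

lemma reflection_inner_left: "reflection \<alpha> v \<bullet> w = v \<bullet> reflection \<alpha> w"
  using coroot_swap[of \<alpha> v w]
  by (simp add: reflection_def inner_diff_left inner_diff_right inner_commute[of v \<alpha>] mult.commute)

lemma reflection_isometry: "\<alpha> \<noteq> 0 \<Longrightarrow> reflection \<alpha> v \<bullet> reflection \<alpha> w = v \<bullet> w"
  by (simp add: reflection_inner_left reflection_reflection)

lemma reflection_alt: "reflection \<alpha> v = v - (\<alpha> \<bullet> v) *\<^sub>R coroot \<alpha>"
  by (simp add: reflection_def coroot_def)

lemma coroot_uminus: "coroot (- \<alpha>) = - coroot \<alpha>"
  by (simp add: coroot_def)

lemma reflection_uminus: "reflection (- \<alpha>) = reflection \<alpha>"
  by (auto simp: reflection_def coroot_uminus)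

locale root_datum =
  fixes D Sim :: "'a::euclidean_space set"
  assumes rs: "root_system D" and red: "reduced_rs D" and fund: "fundamental_system D Sim"
begin

abbreviation "Dp \<equiv> positive_roots D Sim"

lemma finite_D: "finite D" and D_nonzero: "\<alpha> \<in> D \<Longrightarrow> \<alpha> \<noteq> 0"
  and reflection_D: "\<alpha> \<in> D \<Longrightarrow> \<beta> \<in> D \<Longrightarrow> reflection \<alpha> \<beta> \<in> D"
  and coroot_D_int: "\<alpha> \<in> D \<Longrightarrow> \<beta> \<in> D \<Longrightarrow> coroot \<alpha> \<bullet> \<beta> \<in> \<int>" and span_D: "span D = UNIV"
  using rs by (auto simp: root_system_def)

lemma uminus_D: "\<alpha> \<in> D \<Longrightarrow> - \<alpha> \<in> D"
  using reflection_D[of \<alpha> \<alpha>] D_nonzero[of \<alpha>] by (simp add: reflection_self)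

lemma Sim_sub: "Sim \<subseteq> D" and Sim_rbasis: "rbasis Sim"
  using fund by (auto simp: fundamental_system_def rbasis_def)

lemma finite_Sim: "finite Sim" by (rule rbasis_finite[OF Sim_rbasis])

lemma Sim_nonzero: "\<alpha> \<in> Sim \<Longrightarrow> \<alpha> \<noteq> 0" using Sim_sub D_nonzero by auto

lemma Dp_sub: "Dp \<subseteq> D" by (auto simp: positive_roots_def)

lemma finite_Dp: "finite Dp" using Dp_sub finite_D finite_subset by blast

lemma Dp_nonzero: "\<alpha> \<in> Dp \<Longrightarrow> \<alpha> \<noteq> 0" using Dp_sub D_nonzero by auto

abbreviation "wt \<alpha> \<equiv> dualb Sim \<alpha>"

lemma simple_inner_wt: "\<alpha> \<in> Sim \<Longrightarrow> \<beta> \<in> Sim \<Longrightarrow> \<beta> \<bullet> wt \<alpha> = (if \<beta> = \<alpha> then (\<alpha> \<bullet> \<alpha>) / 2 else 0)"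
  using dualb_inner_left[OF Sim_rbasis, of \<alpha> \<beta>] Sim_nonzero[of \<beta>]
  by (auto simp: coroot_inner_eq field_simps split: if_splits)

lemma sum_inner_wt: "\<alpha> \<in> Sim \<Longrightarrow> (\<Sum>\<beta>\<in>Sim. c \<beta> *\<^sub>R \<beta>) \<bullet> wt \<alpha> = c \<alpha> * ((\<alpha> \<bullet> \<alpha>) / 2)"
  using finite_Sim by (simp add: inner_sum_left simple_inner_wt if_distrib[of "(*) _"] cong: if_cong)

text \<open>Pairing with a fundamental weight reads off a simple coordinate up to a positive factor,
  so positivity of a root becomes a sign condition.\<close>

lemma D_cases_wt:
  assumes "\<beta> \<in> D"
  shows "(\<forall>\<alpha>\<in>Sim. \<beta> \<bullet> wt \<alpha> \<ge> 0) \<and> \<beta> \<in> Dp \<or> (\<forall>\<alpha>\<in>Sim. \<beta> \<bullet> wt \<alpha> \<le> 0) \<and> - \<beta> \<in> Dp"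
proof -
  obtain n :: "'a \<Rightarrow> int" where n: "\<beta> = (\<Sum>\<alpha>\<in>Sim. of_int (n \<alpha>) *\<^sub>R \<alpha>)"
    "(\<forall>\<alpha>\<in>Sim. n \<alpha> \<ge> 0) \<or> (\<forall>\<alpha>\<in>Sim. n \<alpha> \<le> 0)"
    using fund assms unfolding fundamental_system_def by blast
  have w: "\<beta> \<bullet> wt \<alpha> = of_int (n \<alpha>) * ((\<alpha> \<bullet> \<alpha>) / 2)" if "\<alpha> \<in> Sim" for \<alpha>
    unfolding n(1) by (rule sum_inner_wt[OF that])
  from n(2) show ?thesis
  proof
    assume p: "\<forall>\<alpha>\<in>Sim. n \<alpha> \<ge> 0"
    have "\<beta> = (\<Sum>\<alpha>\<in>Sim. of_nat (nat (n \<alpha>)) *\<^sub>R \<alpha>)"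
      unfolding n(1) using p by (intro sum.cong) auto
    then have "\<exists>m::'a \<Rightarrow> nat. \<beta> = (\<Sum>\<alpha>\<in>Sim. of_nat (m \<alpha>) *\<^sub>R \<alpha>)" by (rule exI[of _ "\<lambda>\<alpha>. nat (n \<alpha>)"])
    then have "\<beta> \<in> Dp" using assms by (simp add: positive_roots_def)
    moreover have "\<beta> \<bullet> wt \<alpha> \<ge> 0" if "\<alpha> \<in> Sim" for \<alpha>
      unfolding w[OF that] using p that by (intro mult_nonneg_nonneg) auto
    ultimately show ?thesis by blast
  next
    assume p: "\<forall>\<alpha>\<in>Sim. n \<alpha> \<le> 0"
    have "- \<beta> = (\<Sum>\<alpha>\<in>Sim. of_nat (nat (- n \<alpha>)) *\<^sub>R \<alpha>)"
      unfolding n(1) sum_negf[symmetric] using p by (intro sum.cong) auto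
    then have "\<exists>m::'a \<Rightarrow> nat. - \<beta> = (\<Sum>\<alpha>\<in>Sim. of_nat (m \<alpha>) *\<^sub>R \<alpha>)" by (rule exI[of _ "\<lambda>\<alpha>. nat (- n \<alpha>)"])
    then have "- \<beta> \<in> Dp" using uminus_D[OF assms] by (simp add: positive_roots_def)
    moreover have "\<beta> \<bullet> wt \<alpha> \<le> 0" if "\<alpha> \<in> Sim" for \<alpha>
      unfolding w[OF that] using p that by (intro mult_nonpos_nonneg) auto
    ultimately show ?thesis by blast
  qed
qed

lemma Dp_wt_nonneg: "\<beta> \<in> Dp \<Longrightarrow> \<alpha> \<in> Sim \<Longrightarrow> \<beta> \<bullet> wt \<alpha> \<ge> 0"
proof -
  assume "\<beta> \<in> Dp" and a: "\<alpha> \<in> Sim"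
  then obtain m :: "'a \<Rightarrow> nat" where m: "\<beta> = (\<Sum>\<alpha>\<in>Sim. of_nat (m \<alpha>) *\<^sub>R \<alpha>)"
    by (auto simp: positive_roots_def)
  show ?thesis unfolding m sum_inner_wt[OF a] by simp
qed

lemma D_expand: "v = (\<Sum>\<alpha>\<in>Sim. (v \<bullet> wt \<alpha>) *\<^sub>R coroot \<alpha>)"
  by (rule rbasis_expand_coroot[OF Sim_rbasis])

lemma Dp_wt_pos: "\<beta> \<in> Dp \<Longrightarrow> \<exists>\<alpha>\<in>Sim. \<beta> \<bullet> wt \<alpha> > 0"
proof (rule ccontr)
  assume b: "\<beta> \<in> Dp" and "\<not> (\<exists>\<alpha>\<in>Sim. \<beta> \<bullet> wt \<alpha> > 0)"
  then have "\<beta> \<bullet> wt \<alpha> = 0" if "\<alpha> \<in> Sim" for \<alpha> using Dp_wt_nonneg[OF b that] that by force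
  then have "\<beta> = 0" by (subst D_expand) simp
  then show False using b Dp_nonzero by auto
qed

lemma Dp_uminus_notin: "\<beta> \<in> Dp \<Longrightarrow> - \<beta> \<notin> Dp"
  using Dp_wt_pos[of \<beta>] Dp_wt_nonneg[of "- \<beta>"] by force

lemma D_pos_iff: "\<beta> \<in> D \<Longrightarrow> \<alpha> \<in> Sim \<Longrightarrow> \<beta> \<bullet> wt \<alpha> > 0 \<Longrightarrow> \<beta> \<in> Dp"
  using D_cases_wt[of \<beta>] by force

lemma Sim_Dp: "Sim \<subseteq> Dp"
proof
  fix \<alpha> assume a: "\<alpha> \<in> Sim"
  then show "\<alpha> \<in> Dp"
    using D_pos_iff[of \<alpha> \<alpha>] Sim_sub simple_inner_wt[OF a a] Sim_nonzero[OF a] by auto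
qed

lemma Dp_inner_pos:
  assumes "\<beta> \<in> Dp" and "\<And>\<alpha>. \<alpha> \<in> Sim \<Longrightarrow> \<alpha> \<bullet> v > 0" shows "\<beta> \<bullet> v > 0"
proof -
  have eq: "\<beta> \<bullet> v = (\<Sum>\<alpha>\<in>Sim. (\<beta> \<bullet> wt \<alpha>) * (coroot \<alpha> \<bullet> v))"
    by (subst D_expand[of \<beta>]) (simp add: inner_sum_left)
  have c: "coroot \<alpha> \<bullet> v > 0" if "\<alpha> \<in> Sim" for \<alpha>
    using assms(2)[OF that] Sim_nonzero[OF that] by (simp add: coroot_inner_eq)
  obtain a where a: "a \<in> Sim" "\<beta> \<bullet> wt a > 0" using Dp_wt_pos[OF assms(1)] by auto
  show ?thesis unfolding eq
    by (rule sum_pos2[OF finite_Sim a(1)]) (use a c Dp_wt_nonneg[OF assms(1)] in \<open>auto intro: less_imp_le mult_nonneg_nonneg\<close>)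
qed

text \<open>Reducedness gives a positive root other than \<alpha> a second positive simple
  coordinate. The reflection leaves that coordinate alone, and one positive coordinate decides the
  sign of a root.\<close>

lemma simple_reflection_Dp:
  assumes a: "\<alpha> \<in> Sim" and b: "\<beta> \<in> Dp" "\<beta> \<noteq> \<alpha>" shows "reflection \<alpha> \<beta> \<in> Dp"
proof -
  have bD: "\<beta> \<in> D" using b Dp_sub by auto
  have "\<exists>\<gamma>\<in>Sim. \<gamma> \<noteq> \<alpha> \<and> \<beta> \<bullet> wt \<gamma> > 0"
  proof (rule ccontr)
    assume neg: "\<not> (\<exists>\<gamma>\<in>Sim. \<gamma> \<noteq> \<alpha> \<and> \<beta> \<bullet> wt \<gamma> > 0)"
    then have "\<beta> \<bullet> wt \<gamma> = 0" if "\<gamma> \<in> Sim" "\<gamma> \<noteq> \<alpha>" for \<gamma>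
      using Dp_wt_nonneg[OF b(1) that(1)] that by force
    then have "\<beta> = (\<beta> \<bullet> wt \<alpha>) *\<^sub>R coroot \<alpha>"
      using D_expand[of \<beta>] sum.remove[OF finite_Sim a, of "\<lambda>\<gamma>. (\<beta> \<bullet> wt \<gamma>) *\<^sub>R coroot \<gamma>"] by simp
    moreover define x where "x = (\<beta> \<bullet> wt \<alpha>) * (2 / (\<alpha> \<bullet> \<alpha>))"
    ultimately have eq: "\<beta> = x *\<^sub>R \<alpha>" by (simp add: coroot_def)
    then have "x = 1 \<or> x = -1"
      using red a Sim_sub bD unfolding reduced_rs_def by (metis subsetD)
    moreover have "x \<ge> 0" unfolding x_def using Dp_wt_nonneg[OF b(1) a] by simp
    ultimately have "x = 1" by auto
    then have "\<beta> = \<alpha>" using eq by simp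
    then show False using b by simp
  qed
  then obtain \<gamma> where g: "\<gamma> \<in> Sim" "\<gamma> \<noteq> \<alpha>" "\<beta> \<bullet> wt \<gamma> > 0" by auto
  have "reflection \<alpha> \<beta> \<bullet> wt \<gamma> = \<beta> \<bullet> wt \<gamma>"
    using simple_inner_wt[OF g(1) a] g(2) by (simp add: reflection_def inner_diff_left)
  then show ?thesis using D_pos_iff[OF reflection_D[of \<alpha> \<beta>] g(1)] g a Sim_sub bD by auto
qed

section \<open>Words in the reflections and the exchange argument\<close>

definition word :: "'a list \<Rightarrow> 'a \<Rightarrow> 'a" where
  "word as = foldr (\<lambda>\<alpha> f. reflection \<alpha> \<circ> f) as id"

lemma word_Nil [simp]: "word [] = id" and word_Cons [simp]: "word (a # as) = reflection a \<circ> word as"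
  by (simp_all add: word_def)

lemma word_append: "word (as @ bs) = word as \<circ> word bs"
  by (induction as) (auto simp: o_def)

lemma word_linear: "linear (word as)"
proof (induction as)
  case (Cons a as)
  show ?case unfolding word_Cons using linear_compose[OF Cons linear_reflection] .
next
  case Nil
  show ?case unfolding word_Nil by (rule linear_id)
qed

lemma word_isometry: "set as \<subseteq> D \<Longrightarrow> word as v \<bullet> word as w = v \<bullet> w"
  by (induction as) (auto simp: reflection_isometry D_nonzero)

lemma word_rev: "set as \<subseteq> D \<Longrightarrow> word as (word (rev as) v) = v"
  by (induction as arbitrary: v) (auto simp: word_append reflection_reflection D_nonzero)

lemma word_D: "set as \<subseteq> D \<Longrightarrow> \<beta> \<in> D \<Longrightarrow> word as \<beta> \<in> D"
  by (induction as) (auto intro: reflection_D)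

lemma isometry_coroot:
  assumes "linear w" "\<And>v u. w v \<bullet> w u = v \<bullet> u" shows "coroot (w \<alpha>) = w (coroot \<alpha>)"
  by (simp add: coroot_def assms(2) linear_scale[OF assms(1)])

lemma isometry_reflection:
  assumes "linear w" "\<And>v u. w v \<bullet> w u = v \<bullet> u" shows "reflection (w \<alpha>) (w v) = w (reflection \<alpha> v)"
  by (simp add: reflection_def isometry_coroot[OF assms] assms(2) linear_diff[OF assms(1)] linear_scale[OF assms(1)])

lemma word_reflection: "set as \<subseteq> D \<Longrightarrow> reflection (word as \<alpha>) (word as v) = word as (reflection \<alpha> v)"
  by (intro isometry_reflection word_linear word_isometry)

abbreviation "rho \<equiv> \<Sum>\<alpha>\<in>Sim. wt \<alpha>"

lemma coroot_rho: "\<alpha> \<in> Sim \<Longrightarrow> coroot \<alpha> \<bullet> rho = 1"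
  using finite_Sim by (simp add: inner_sum_right dualb_inner_left[OF Sim_rbasis])

lemma simple_rho: "\<alpha> \<in> Sim \<Longrightarrow> \<alpha> \<bullet> rho > 0"
  using coroot_rho[of \<alpha>] Sim_nonzero[of \<alpha>] inner_gt_zero_iff[of \<alpha>] by (auto simp: coroot_inner_eq field_simps)

text \<open>Induction on the number of positive roots with smaller pairing with \<open>rho\<close>.
  A non-simple positive root has positive inner product with some simple root, since otherwise its
  squared norm would be at most 0; reflecting in that root lowers the pairing.\<close>

lemma Dp_word: "\<beta> \<in> Dp \<Longrightarrow> \<exists>as a. set as \<subseteq> Sim \<and> a \<in> Sim \<and> \<beta> = word as a"
proof (induction "card {\<gamma>\<in>Dp. \<gamma> \<bullet> rho < \<beta> \<bullet> rho}" arbitrary: \<beta> rule: less_induct)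
  case less
  show ?case
  proof (cases "\<beta> \<in> Sim")
    case True
    then show ?thesis by (intro exI[of _ "[]"] exI[of _ \<beta>]) auto
  next
    case False
    have "\<exists>\<alpha>\<in>Sim. \<alpha> \<bullet> \<beta> > 0"
    proof (rule ccontr)
      assume neg: "\<not> (\<exists>\<alpha>\<in>Sim. \<alpha> \<bullet> \<beta> > 0)"
      have "\<beta> \<bullet> \<beta> = (\<Sum>\<alpha>\<in>Sim. (\<beta> \<bullet> wt \<alpha>) * (coroot \<alpha> \<bullet> \<beta>))"
        by (subst D_expand[of \<beta>]) (simp add: inner_sum_left)
      also have "\<dots> \<le> 0"
        using neg Dp_wt_nonneg[OF less.prems]
        by (intro sum_nonpos mult_nonneg_nonpos) (auto simp: coroot_inner_eq divide_nonpos_nonneg not_less)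
      finally show False using Dp_nonzero[OF less.prems] inner_gt_zero_iff[of \<beta>] by linarith
    qed
    then obtain \<alpha> where \<alpha>: "\<alpha> \<in> Sim" "\<alpha> \<bullet> \<beta> > 0" by auto
    define \<gamma> where "\<gamma> = reflection \<alpha> \<beta>"
    have g: "\<gamma> \<in> Dp" using simple_reflection_Dp[OF \<alpha>(1) less.prems] False \<alpha> by (auto simp: \<gamma>_def)
    have "0 < (coroot \<alpha> \<bullet> \<beta>) * (\<alpha> \<bullet> rho)"
      using \<alpha> Sim_nonzero[OF \<alpha>(1)] simple_rho[OF \<alpha>(1)] by (intro mult_pos_pos) (auto simp: coroot_inner_eq)
    then have lt: "\<gamma> \<bullet> rho < \<beta> \<bullet> rho"
      by (simp add: \<gamma>_def reflection_def inner_diff_left)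
    then have "{\<delta>\<in>Dp. \<delta> \<bullet> rho < \<gamma> \<bullet> rho} \<subset> {\<delta>\<in>Dp. \<delta> \<bullet> rho < \<beta> \<bullet> rho}" using g by auto
    then have "card {\<delta>\<in>Dp. \<delta> \<bullet> rho < \<gamma> \<bullet> rho} < card {\<delta>\<in>Dp. \<delta> \<bullet> rho < \<beta> \<bullet> rho}"
      using finite_Dp by (intro psubset_card_mono) auto
    from less.hyps[OF this g] obtain as a where as: "set as \<subseteq> Sim" "a \<in> Sim" "\<gamma> = word as a" by blast
    have "\<beta> = word (\<alpha> # as) a"
      using as(3) reflection_reflection[OF Sim_nonzero[OF \<alpha>(1)], of \<beta>] by (simp add: \<gamma>_def)
    then show ?thesis using as \<alpha> by (intro exI[of _ "\<alpha> # as"] exI[of _ a]) auto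
  qed
qed

text \<open>Integrality makes simple reflections preserve the lattice of simple coroots, and every
  positive coroot is the image of a simple one.\<close>

lemma coroot_Dp_lattice: "\<beta> \<in> Dp \<Longrightarrow> coroot \<beta> \<in> coroot_lattice Sim"
proof -
  assume "\<beta> \<in> Dp"
  then obtain as a where as: "set as \<subseteq> Sim" "a \<in> Sim" "\<beta> = word as a" using Dp_word by blast
  have refl: "reflection \<alpha> q \<in> coroot_lattice Sim" if \<alpha>: "\<alpha> \<in> Sim" and q: "q \<in> coroot_lattice Sim" for \<alpha> q
  proof -
    obtain n :: "'a \<Rightarrow> int" where n: "q = (\<Sum>\<gamma>\<in>Sim. of_int (n \<gamma>) *\<^sub>R coroot \<gamma>)"
      using q by (auto simp: coroot_lattice_def)
    have "coroot \<gamma> \<bullet> \<alpha> \<in> \<int>" if "\<gamma> \<in> Sim" for \<gamma> using that \<alpha> Sim_sub coroot_D_int by auto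
    then have "\<alpha> \<bullet> q \<in> \<int>"
      unfolding n by (auto simp: inner_sum_right inner_commute[of \<alpha>] intro!: Ints_sum Ints_mult)
    then obtain m where "\<alpha> \<bullet> q = of_int m" by (auto elim: Ints_cases)
    then show ?thesis unfolding reflection_alt
      using coroot_in_lattice[OF finite_Sim \<alpha>] q by (auto intro!: coroot_lattice_diff coroot_lattice_scale)
  qed
  have "word as q \<in> coroot_lattice Sim" if "set as \<subseteq> Sim" "q \<in> coroot_lattice Sim" for as q
    using that by (induction as) (auto intro: refl)
  moreover have "coroot \<beta> = word as (coroot a)"
    unfolding as(3) using as(1) Sim_sub by (intro isometry_coroot word_linear word_isometry) auto
  ultimately show ?thesis using as coroot_in_lattice[OF finite_Sim] by simp
qed

lemma coroot_int_dual: "\<beta> \<in> D \<Longrightarrow> v \<in> int_dual Sim \<Longrightarrow> coroot \<beta> \<bullet> v \<in> \<int>"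
  using D_cases_wt[of \<beta>] coroot_Dp_lattice[of \<beta>] coroot_Dp_lattice[of "-\<beta>"]
    coroot_lattice_inner_int[of "coroot \<beta>" Sim v] coroot_lattice_inner_int[of "coroot (-\<beta>)" Sim v]
  by (auto simp: coroot_uminus)

text \<open>The reflection in \<open>word as a\<close> is the conjugate of the reflection in
  \<open>a\<close> by \<open>word as\<close>, so all reflections are words in simple ones.\<close>

lemma weyl_props:
  assumes "w \<in> weyl_group D"
  shows weyl_linear: "linear w" and weyl_isometry: "\<And>v u. w v \<bullet> w u = v \<bullet> u"
    and weyl_D: "\<And>\<beta>. \<beta> \<in> D \<Longrightarrow> w \<beta> \<in> D" and weyl_word: "\<exists>as. set as \<subseteq> Sim \<and> w = word as"
proof -
  have refl_word: "\<exists>as. set as \<subseteq> Sim \<and> reflection \<beta> = word as" if b: "\<beta> \<in> D" for \<beta>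
  proof -
    obtain \<beta>' where b': "\<beta>' \<in> Dp" "reflection \<beta> = reflection \<beta>'"
      using D_cases_wt[OF b] reflection_uminus[of \<beta>] by metis
    then obtain as a where as: "set as \<subseteq> Sim" "a \<in> Sim" "\<beta>' = word as a" using Dp_word by blast
    have asD: "set as \<subseteq> D" using as Sim_sub by auto
    have "reflection \<beta>' v = word (as @ a # rev as) v" for v
      using word_reflection[OF asD, of a "word (rev as) v"] word_rev[OF asD, of v] by (simp add: as(3) word_append)
    then show ?thesis using b'(2) as by (intro exI[of _ "as @ a # rev as"]) auto
  qed
  have "\<exists>as. set as \<subseteq> Sim \<and> w = word as"
    using assms
  proof induction
    case weyl_id
    show ?case by (intro exI[of _ "[]"]) auto
  next
    case (weyl_step w \<alpha>)
    then show ?case using refl_word[of \<alpha>] word_append by (metis Un_subset_iff set_append)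
  qed
  then obtain as where as: "set as \<subseteq> Sim" "w = word as" by blast
  then have asD: "set as \<subseteq> D" using Sim_sub by auto
  show "\<exists>as. set as \<subseteq> Sim \<and> w = word as" using as by blast
  show "linear w" "\<And>v u. w v \<bullet> w u = v \<bullet> u" "\<And>\<beta>. \<beta> \<in> D \<Longrightarrow> w \<beta> \<in> D"
    using as(2) word_linear word_isometry[OF asD] word_D[OF asD] by auto
qed

lemma word_weyl: "set as \<subseteq> D \<Longrightarrow> word as \<in> weyl_group D"
  by (induction as) (auto intro: weyl_group.intros)

lemma weyl_bij: assumes "w \<in> weyl_group D" shows "bij w" "inv w \<in> weyl_group D"
proof -
  obtain as where as: "set as \<subseteq> Sim" "w = word as" using weyl_word[OF assms] by blast
  then have asD: "set as \<subseteq> D" "set (rev as) \<subseteq> D" using Sim_sub by auto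
  have 1: "word as (word (rev as) v) = v" and 2: "word (rev as) (word as v) = v" for v
    using word_rev[OF asD(1), of v] word_rev[OF asD(2), of v] by auto
  show "bij w" unfolding as(2) using 1 2 by (intro bij_betwI[of _ _ _ "word (rev as)"]) auto
  have "inv w = word (rev as)" unfolding as(2) using 1 2 by (intro inv_unique_comp) (auto simp: fun_eq_iff)
  then show "inv w \<in> weyl_group D" using word_weyl[OF asD(2)] by simp
qed

lemma weyl_adjoint: assumes "w \<in> weyl_group D" shows "inv w v \<bullet> u = v \<bullet> w u"
  using weyl_isometry[OF assms, of "inv w v" u] weyl_bij(1)[OF assms] by (simp add: bij_is_surj surj_f_inv_f)

lemma weyl_comp: assumes "w \<in> weyl_group D" "u \<in> weyl_group D" shows "w \<circ> u \<in> weyl_group D"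
  using assms by induction (auto intro: weyl_group.intros simp: comp_assoc)

text \<open>An element is determined by its action on the finite set of roots, because the roots
  span.\<close>

lemma finite_weyl: "finite (weyl_group D)"
proof -
  have "inj_on (\<lambda>w. restrict w D) (weyl_group D)"
  proof (rule inj_onI)
    fix w u assume wu: "w \<in> weyl_group D" "u \<in> weyl_group D" "restrict w D = restrict u D"
    have "w x = u x" if "x \<in> D" for x using that wu(3) by (metis restrict_apply')
    then have "w x = u x" for x
      using linear_eq_on_span[OF weyl_linear[OF wu(1)] weyl_linear[OF wu(2)], of D x] span_D by auto
    then show "w = u" by auto
  qed
  moreover have "(\<lambda>w. restrict w D) ` weyl_group D \<subseteq> PiE D (\<lambda>_. D)" using weyl_D by auto
  ultimately show ?thesis using finite_PiE[OF finite_D, of "\<lambda>_. D"] finite_D by (meson finite_imageD finite_subset)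
qed

text \<open>At the letter where the image of \<open>a\<close> turns negative, that image must be the
  letter itself: a simple reflection permutes the other positive roots.\<close>

lemma word_exchange:
  assumes "set bs \<subseteq> Sim" "a \<in> Sim" "word bs a \<notin> Dp"
  shows "\<exists>cs b ds. bs = cs @ b # ds \<and> word ds a = b"
  using assms
proof (induction bs)
  case Nil
  then show ?case using Sim_Dp by auto
next
  case (Cons b bs)
  show ?case
  proof (cases "word bs a \<in> Dp")
    case True
    then have "word bs a = b" using simple_reflection_Dp[of b "word bs a"] Cons.prems by auto
    then show ?thesis by (intro exI[of _ "[]"] exI[of _ b] exI[of _ bs]) auto
  next
    case False
    then obtain cs c ds where "bs = cs @ c # ds" "word ds a = c" using Cons by auto
    then show ?thesis by (intro exI[of _ "b # cs"] exI[of _ c] exI[of _ ds]) auto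
  qed
qed

text \<open>The exchange lemma moves the last reflection across \<open>ds\<close> until it meets its
  equal and both cancel. This shortens the word by two letters without changing the map.\<close>

lemma word_positive_id:
  "set as \<subseteq> Sim \<Longrightarrow> (\<And>\<beta>. \<beta> \<in> Dp \<Longrightarrow> word as \<beta> \<in> Dp) \<Longrightarrow> word as = id"
proof (induction "length as" arbitrary: as rule: less_induct)
  case less
  show ?case
  proof (cases as rule: rev_cases)
    case (snoc bs a)
    have a: "a \<in> Sim" and bs: "set bs \<subseteq> Sim" using less.prems(1) snoc by auto
    have "word as a \<in> Dp" using less.prems(2) a Sim_Dp by auto
    moreover have "word as a = - word bs a"
      using linear_neg[OF word_linear] by (simp add: snoc word_append reflection_self Sim_nonzero[OF a])
    ultimately have "word bs a \<notin> Dp" using Dp_uminus_notin by auto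
    then obtain cs b ds where d: "bs = cs @ b # ds" "word ds a = b" using word_exchange[OF bs a] by blast
    have dsD: "set ds \<subseteq> D" using bs d Sim_sub by auto
    have "word as v = word (cs @ ds) v" for v
      using word_reflection[OF dsD, of a "reflection a v"] d(2)
      by (simp add: snoc d(1) word_append reflection_reflection Sim_nonzero[OF a])
    then have eq: "word as = word (cs @ ds)" by auto
    moreover have "word (cs @ ds) = id"
      by (rule less.hyps) (use less.prems snoc d eq in auto)
    ultimately show ?thesis by simp
  qed auto
qed

text \<open>A positive root pairs positively with \<open>v\<close>, hence its image pairs positively
  with \<open>w v\<close> and is again positive.\<close>

lemma weyl_dominant_id:
  assumes w: "w \<in> weyl_group D" and v: "\<And>\<alpha>. \<alpha> \<in> Sim \<Longrightarrow> \<alpha> \<bullet> v > 0" and wv: "\<And>\<alpha>. \<alpha> \<in> Sim \<Longrightarrow> \<alpha> \<bullet> w v > 0"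
  shows "w = id"
proof -
  obtain as where as: "set as \<subseteq> Sim" "w = word as" using weyl_word[OF w] by blast
  have "word as \<beta> \<in> Dp" if b: "\<beta> \<in> Dp" for \<beta>
  proof (rule ccontr)
    assume n: "word as \<beta> \<notin> Dp"
    have "w \<beta> \<in> D" using weyl_D[OF w] b Dp_sub by auto
    then have "- w \<beta> \<in> Dp" using n D_cases_wt[of "w \<beta>"] as by auto
    then have "- w \<beta> \<bullet> w v > 0" by (rule Dp_inner_pos[OF _ wv])
    moreover have "w \<beta> \<bullet> w v > 0" using Dp_inner_pos[OF b v] weyl_isometry[OF w] by simp
    ultimately show False by simp
  qed
  then show ?thesis using word_positive_id[OF as(1)] as(2) by auto
qed

text \<open>An orbit point of maximal pairing with \<open>rho\<close> is dominant, since reflecting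
  in a simple root with negative pairing would increase it.\<close>

lemma weyl_to_dominant:
  assumes reg: "\<And>\<alpha>. \<alpha> \<in> D \<Longrightarrow> \<alpha> \<bullet> v \<noteq> 0"
  shows "\<exists>w\<in>weyl_group D. \<forall>\<alpha>\<in>Sim. \<alpha> \<bullet> w v > 0"
proof -
  have ne: "weyl_group D \<noteq> {}" using weyl_id by auto
  have "Max ((\<lambda>w. w v \<bullet> rho) ` weyl_group D) \<in> (\<lambda>w. w v \<bullet> rho) ` weyl_group D"
    using finite_weyl ne by (intro Max_in) auto
  then obtain w where w: "w \<in> weyl_group D" and weq: "Max ((\<lambda>w. w v \<bullet> rho) ` weyl_group D) = w v \<bullet> rho"
    by blast
  have mx: "u v \<bullet> rho \<le> w v \<bullet> rho" if "u \<in> weyl_group D" for u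
    unfolding weq[symmetric] using finite_weyl that by (intro Max_ge) auto
  have "\<alpha> \<bullet> w v > 0" if a: "\<alpha> \<in> Sim" for \<alpha>
  proof (rule ccontr)
    assume n: "\<not> \<alpha> \<bullet> w v > 0"
    have "inv w \<alpha> \<in> D" using weyl_D[OF weyl_bij(2)[OF w]] a Sim_sub by auto
    then have "\<alpha> \<bullet> w v \<noteq> 0" using reg weyl_adjoint[OF w, of \<alpha> v] by auto
    then have "\<alpha> \<bullet> w v < 0" using n by auto
    then have "(coroot \<alpha> \<bullet> w v) * (\<alpha> \<bullet> rho) < 0"
      using simple_rho[OF a] Sim_nonzero[OF a] by (intro mult_neg_pos) (auto simp: coroot_inner_eq divide_neg_pos)
    moreover have "reflection \<alpha> (w v) \<bullet> rho \<le> w v \<bullet> rho"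
      using mx[of "reflection \<alpha> \<circ> w"] weyl_step[OF w] a Sim_sub by auto
    ultimately show False by (simp add: reflection_def inner_diff_left)
  qed
  then show ?thesis using w by blast
qed

section \<open>Regular weights and chambers\<close>

definition regular_weights :: "'a set" where
  "regular_weights = {v \<in> int_dual Sim. \<forall>\<alpha>\<in>Dp. coroot \<alpha> \<bullet> v \<noteq> 0}"

lemma regular_weights_D: "v \<in> regular_weights \<Longrightarrow> \<alpha> \<in> D \<Longrightarrow> \<alpha> \<bullet> v \<noteq> 0"
  using D_cases_wt[of \<alpha>] D_nonzero[of \<alpha>] unfolding regular_weights_def
  by (auto simp: coroot_inner_eq)

lemma Ppp_eq: "Ppp Sim = {v \<in> int_dual Sim. \<forall>\<alpha>\<in>Sim. \<alpha> \<bullet> v > 0}"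
proof (intro equalityI subsetI)
  fix v assume "v \<in> Ppp Sim"
  then obtain m :: "'a \<Rightarrow> nat" where m: "\<forall>\<alpha>\<in>Sim. m \<alpha> \<ge> 1" "v = (\<Sum>\<alpha>\<in>Sim. of_nat (m \<alpha>) *\<^sub>R wt \<alpha>)"
    by (auto simp: Ppp_def fund_weight_def)
  have c: "coroot \<alpha> \<bullet> v = m \<alpha>" if "\<alpha> \<in> Sim" for \<alpha>
    using that sum_if_eq_inner[OF finite_Sim that, of "\<lambda>b. real (m b)"]
    by (simp add: m(2) inner_sum_right dualb_inner_left[OF Sim_rbasis])
  have "\<alpha> \<bullet> v > 0" if "\<alpha> \<in> Sim" for \<alpha>
  proof -
    have "coroot \<alpha> \<bullet> v > 0" using c[OF that] m(1) that by force
    then show ?thesis using inner_ge_zero[of \<alpha>] by (auto simp: coroot_inner_eq zero_less_divide_iff)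
  qed
  then show "v \<in> {v \<in> int_dual Sim. \<forall>\<alpha>\<in>Sim. \<alpha> \<bullet> v > 0}" using c by (auto simp: int_dual_def)
next
  fix v assume v: "v \<in> {v \<in> int_dual Sim. \<forall>\<alpha>\<in>Sim. \<alpha> \<bullet> v > 0}"
  define m where "m \<alpha> = nat \<lfloor>coroot \<alpha> \<bullet> v\<rfloor>" for \<alpha>
  have m: "real (m \<alpha>) = coroot \<alpha> \<bullet> v \<and> m \<alpha> \<ge> 1" if a: "\<alpha> \<in> Sim" for \<alpha>
  proof -
    have pos: "coroot \<alpha> \<bullet> v > 0" using v a Sim_nonzero[OF a] by (auto simp: coroot_inner_eq)
    have "coroot \<alpha> \<bullet> v \<in> \<int>" using v a by (auto simp: int_dual_def)
    then obtain k where "coroot \<alpha> \<bullet> v = of_int k" by (rule Ints_cases)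
    then show ?thesis using pos by (simp add: m_def)
  qed
  have "v = (\<Sum>\<alpha>\<in>Sim. of_nat (m \<alpha>) *\<^sub>R fund_weight Sim \<alpha>)"
    using rbasis_expand[OF Sim_rbasis, of v] m by (simp add: fund_weight_def)
  then show "v \<in> Ppp Sim" unfolding Ppp_def using m by blast
qed

lemma weyl_int_dual: "w \<in> weyl_group D \<Longrightarrow> v \<in> int_dual Sim \<Longrightarrow> w v \<in> int_dual Sim"
proof -
  assume w: "w \<in> weyl_group D" and v: "v \<in> int_dual Sim"
  note iw = weyl_bij(2)[OF w]
  have "coroot \<alpha> \<bullet> w v \<in> \<int>" if "\<alpha> \<in> Sim" for \<alpha>
  proof -
    have "coroot \<alpha> \<bullet> w v = coroot (inv w \<alpha>) \<bullet> v"
      by (simp add: isometry_coroot[OF weyl_linear[OF iw] weyl_isometry[OF iw]] weyl_adjoint[OF w])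
    moreover have "inv w \<alpha> \<in> D" using weyl_D[OF iw] that Sim_sub by auto
    ultimately show ?thesis using coroot_int_dual v by simp
  qed
  then show ?thesis by (simp add: int_dual_def)
qed

lemma Ppp_regular: "Ppp Sim \<subseteq> regular_weights"
proof
  fix v assume v: "v \<in> Ppp Sim"
  have "coroot \<alpha> \<bullet> v \<noteq> 0" if "\<alpha> \<in> Dp" for \<alpha>
    using Dp_inner_pos[OF that, of v] v Dp_nonzero[OF that] by (auto simp: Ppp_eq coroot_inner_eq_0)
  then show "v \<in> regular_weights" using v by (auto simp: regular_weights_def Ppp_eq)
qed

lemma weyl_regular: "w \<in> weyl_group D \<Longrightarrow> v \<in> regular_weights \<Longrightarrow> w v \<in> regular_weights"
proof -
  assume w: "w \<in> weyl_group D" and v: "v \<in> regular_weights"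
  note iw = weyl_bij(2)[OF w]
  have "coroot \<alpha> \<bullet> w v \<noteq> 0" if a: "\<alpha> \<in> Dp" for \<alpha>
  proof -
    have "inv w \<alpha> \<in> D" using weyl_D[OF iw] a Dp_sub by auto
    then show ?thesis using regular_weights_D[OF v, of "inv w \<alpha>"] weyl_adjoint[OF w, of \<alpha> v] Dp_nonzero[OF a]
      by (simp add: coroot_inner_eq_0)
  qed
  then show ?thesis using weyl_int_dual[OF w] v by (auto simp: regular_weights_def)
qed

lemma regular_weights_partition:
  "regular_weights = (\<Union>w\<in>weyl_group D. w ` Ppp Sim)"
  "\<And>w u. w \<in> weyl_group D \<Longrightarrow> u \<in> weyl_group D \<Longrightarrow> w \<noteq> u \<Longrightarrow> w ` Ppp Sim \<inter> u ` Ppp Sim = {}"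
proof -
  show "regular_weights = (\<Union>w\<in>weyl_group D. w ` Ppp Sim)"
  proof (intro equalityI subsetI)
    fix v assume v: "v \<in> regular_weights"
    obtain w where w: "w \<in> weyl_group D" "\<forall>\<alpha>\<in>Sim. \<alpha> \<bullet> w v > 0"
      using weyl_to_dominant[of v] regular_weights_D[OF v] by auto
    then have "w v \<in> Ppp Sim" using weyl_int_dual[OF w(1)] v by (auto simp: Ppp_eq regular_weights_def)
    moreover have "inv w (w v) = v" using weyl_bij(1)[OF w(1)] by (simp add: bij_is_inj)
    ultimately show "v \<in> (\<Union>w\<in>weyl_group D. w ` Ppp Sim)" using weyl_bij(2)[OF w(1)] by (metis UN_I imageI)
  qed (use Ppp_regular weyl_regular in auto)
  fix w u assume wu: "w \<in> weyl_group D" "u \<in> weyl_group D" "w \<noteq> u"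
  show "w ` Ppp Sim \<inter> u ` Ppp Sim = {}"
  proof (rule ccontr)
    assume "w ` Ppp Sim \<inter> u ` Ppp Sim \<noteq> {}"
    then obtain v v' where v: "v \<in> Ppp Sim" "v' \<in> Ppp Sim" "w v = u v'" by auto
    have iu: "inv u (u x) = x" "u (inv u x) = x" for x
      using weyl_bij(1)[OF wu(2)] by (simp_all add: bij_is_inj bij_is_surj surj_f_inv_f)
    have "(inv u \<circ> w) v = v'" using v iu by simp
    then have "inv u \<circ> w = id"
      using v by (intro weyl_dominant_id[of "inv u \<circ> w" v] weyl_comp weyl_bij(2) wu) (auto simp: Ppp_eq)
    then have "w x = u x" for x using iu(2)[of "w x"] by (metis comp_apply id_apply)
    then show False using wu(3) by auto
  qed
qed

end

section \<open>Sums over regular weights\<close>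

context root_datum
begin

definition weight_term :: "('a \<Rightarrow> nat) \<Rightarrow> 'a \<Rightarrow> 'a \<Rightarrow> complex" where
  "weight_term k y v = expi (y \<bullet> v) * (\<Prod>\<alpha>\<in>Dp. inverse (of_real (coroot \<alpha> \<bullet> v) ^ k \<alpha>))"

definition weyl_sign :: "('a \<Rightarrow> nat) \<Rightarrow> ('a \<Rightarrow> 'a) \<Rightarrow> complex" where
  "weyl_sign k w = (\<Prod>\<alpha>\<in>{\<alpha>\<in>Dp. \<alpha> \<in> w ` (uminus ` Dp)}. (-1::complex) ^ k \<alpha>)"

lemma weyl_sign_square: "weyl_sign k w * weyl_sign k w = 1"
  unfolding weyl_sign_def prod.distrib[symmetric] power_mult_distrib[symmetric] by simp

lemma norm_weyl_sign: "norm (weyl_sign k w) = 1"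
  unfolding weyl_sign_def by (simp add: norm_power flip: prod_norm)

text \<open>The map \<alpha> to the positive one of \<plusminus>w \<alpha> permutes the positive
  roots. Every root whose sign has to be changed contributes one power of -1, and these are
  collected in \<open>weyl_sign\<close>.\<close>

lemma zeta_term_weyl:
  assumes w: "w \<in> weyl_group D"
  shows "zeta_term Dp (param_act Dp (inv w) k) (inv w y) v = weyl_sign k w * weight_term k y (w v)"
proof -
  define p where "p \<beta> = (if \<beta> \<in> Dp then \<beta> else - \<beta>)" for \<beta>
  have bw: "bij w" by (rule weyl_bij(1)[OF w])
  have lin: "linear w" by (rule weyl_linear[OF w])
  have iwD: "inv w \<beta> \<in> D" if "\<beta> \<in> D" for \<beta> using weyl_D[OF weyl_bij(2)[OF w] that] .
  have winv: "w (inv w x) = x" "inv w (w x) = x" for x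
    using bw by (simp_all add: bij_is_inj bij_is_surj surj_f_inv_f)
  have pD: "p \<beta> \<in> Dp" if "\<beta> \<in> D" for \<beta> using D_cases_wt[OF that] by (auto simp: p_def)
  have wneg: "w (- x) = - w x" for x using lin by (rule linear_neg)
  have winvneg: "inv w (- x) = - inv w x" for x
    using weyl_linear[OF weyl_bij(2)[OF w]] by (rule linear_neg)
  have wDp: "w \<beta> \<in> D" if "\<beta> \<in> Dp" for \<beta> using weyl_D[OF w] that Dp_sub by auto
  have bij: "bij_betw (\<lambda>\<alpha>. p (w \<alpha>)) Dp Dp"
  proof (rule bij_betwI[of _ _ _ "\<lambda>\<alpha>. p (inv w \<alpha>)"])
    show "(\<lambda>\<alpha>. p (w \<alpha>)) \<in> Dp \<rightarrow> Dp" using pD wDp by auto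
    show "(\<lambda>\<alpha>. p (inv w \<alpha>)) \<in> Dp \<rightarrow> Dp" using pD iwD Dp_sub by auto
    show "p (inv w (p (w x))) = x" if "x \<in> Dp" for x
      using that Dp_uminus_notin[OF that] by (auto simp: p_def winv winvneg)
    show "p (w (p (inv w x))) = x" if "x \<in> Dp" for x
      using that Dp_uminus_notin[OF that] by (auto simp: p_def winv wneg)
  qed
  have mem: "\<gamma> \<in> w ` (uminus ` Dp) \<longleftrightarrow> - inv w \<gamma> \<in> Dp" for \<gamma>
  proof
    assume "\<gamma> \<in> w ` (uminus ` Dp)"
    then show "- inv w \<gamma> \<in> Dp" by (auto simp: winv)
  next
    assume "- inv w \<gamma> \<in> Dp"
    then have "w (- (- inv w \<gamma>)) \<in> w ` (uminus ` Dp)" by blast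
    then show "\<gamma> \<in> w ` (uminus ` Dp)" by (simp add: winv)
  qed
  let ?f = "\<lambda>\<gamma>. inverse (of_real (coroot \<gamma> \<bullet> w v) ^ k \<gamma>) :: complex"
  let ?s = "\<lambda>\<gamma>. if \<gamma> \<in> w ` (uminus ` Dp) then (-1::complex) ^ k \<gamma> else 1"
  have tm: "inverse (of_real (coroot \<alpha> \<bullet> v) ^ param_act Dp (inv w) k \<alpha>) = ?s (p (w \<alpha>)) * ?f (p (w \<alpha>))" if a: "\<alpha> \<in> Dp" for \<alpha>
  proof -
    have c: "coroot \<alpha> \<bullet> v = coroot (w \<alpha>) \<bullet> w v"
      by (simp add: isometry_coroot[OF lin weyl_isometry[OF w]] weyl_isometry[OF w])
    have pa: "param_act Dp (inv w) k \<alpha> = k (p (w \<alpha>))"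
      using bw by (simp add: param_act_def p_def inv_inv_eq Let_def)
    show ?thesis
    proof (cases "w \<alpha> \<in> Dp")
      case True
      then have "w \<alpha> \<notin> w ` (uminus ` Dp)" using Dp_uminus_notin[OF a] by (simp add: mem winv)
      then show ?thesis using True by (simp add: c pa) (simp add: p_def)
    next
      case False
      then have p: "p (w \<alpha>) = - w \<alpha>" by (simp add: p_def)
      have "- w \<alpha> \<in> w ` (uminus ` Dp)" using a by (simp add: mem winv winvneg)
      moreover have "of_real (coroot \<alpha> \<bullet> v) = - (of_real (coroot (- w \<alpha>) \<bullet> w v) :: complex)"
        by (simp add: c coroot_uminus)
      ultimately show ?thesis unfolding pa p by (simp add: power_minus[of "of_real (coroot (- w \<alpha>) \<bullet> w v) :: complex"] flip: power_inverse)
    qed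
  qed
  have "(\<Prod>\<alpha>\<in>Dp. inverse (of_real (coroot \<alpha> \<bullet> v) ^ param_act Dp (inv w) k \<alpha>) :: complex) = (\<Prod>\<alpha>\<in>Dp. ?s (p (w \<alpha>)) * ?f (p (w \<alpha>)))"
    by (rule prod.cong[OF refl tm])
  also have "\<dots> = (\<Prod>\<gamma>\<in>Dp. ?s \<gamma> * ?f \<gamma>)" by (rule prod.reindex_bij_betw[OF bij])
  also have "\<dots> = weyl_sign k w * (\<Prod>\<gamma>\<in>Dp. ?f \<gamma>)"
    unfolding prod.distrib weyl_sign_def
    by (intro arg_cong2[of _ _ _ _ "(*)"] refl prod.mono_neutral_cong_right) (auto simp: finite_Dp)
  finally show ?thesis
    by (simp add: zeta_term_def weight_term_def expi_def weyl_adjoint[OF w])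
qed

lemma weyl_zeta_sum:
  assumes summ: "\<forall>w\<in>weyl_group D. (\<lambda>v. norm (zeta_term Dp (param_act Dp (inv w) k) (inv w y) v)) summable_on Ppp Sim"
  shows "(weight_term k y has_sum (\<Sum>w\<in>weyl_group D. weyl_sign k w * zeta_rs Dp Sim (param_act Dp (inv w) k) (inv w y))) regular_weights"
    and "(\<lambda>v. norm (weight_term k y v)) summable_on regular_weights"
proof -
  have eq: "weyl_sign k w * zeta_term Dp (param_act Dp (inv w) k) (inv w y) v = weight_term k y (w v)"
    if "w \<in> weyl_group D" for w v
    using weyl_sign_square[of k w] by (simp add: zeta_term_weyl[OF that] mult.assoc[symmetric])
  have inj: "inj_on w (Ppp Sim)" if "w \<in> weyl_group D" for w
    using weyl_bij(1)[OF that] by (auto simp: bij_def intro: inj_on_subset)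
  have "(weight_term k y has_sum (\<Sum>w\<in>weyl_group D. weyl_sign k w * zeta_rs Dp Sim (param_act Dp (inv w) k) (inv w y)))
      (\<Union>w\<in>weyl_group D. w ` Ppp Sim)"
  proof (rule sum_has_sum)
    fix w assume w: "w \<in> weyl_group D"
    have "(zeta_term Dp (param_act Dp (inv w) k) (inv w y) has_sum zeta_rs Dp Sim (param_act Dp (inv w) k) (inv w y)) (Ppp Sim)"
      unfolding zeta_rs_def by (rule has_sum_infsum[OF abs_summable_summable[OF bspec[OF summ w]]])
    from has_sum_cmult_right[OF this, of "weyl_sign k w"]
    have "((weight_term k y \<circ> w) has_sum weyl_sign k w * zeta_rs Dp Sim (param_act Dp (inv w) k) (inv w y)) (Ppp Sim)"
      by (simp add: eq[OF w] o_def)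
    then show "(weight_term k y has_sum weyl_sign k w * zeta_rs Dp Sim (param_act Dp (inv w) k) (inv w y)) (w ` Ppp Sim)"
      by (simp only: has_sum_reindex[OF inj[OF w]])
  qed (fact finite_weyl, fact regular_weights_partition(2))
  then show "(weight_term k y has_sum (\<Sum>w\<in>weyl_group D. weyl_sign k w * zeta_rs Dp Sim (param_act Dp (inv w) k) (inv w y))) regular_weights"
    by (simp only: regular_weights_partition(1))
  have "((\<lambda>v. norm (weight_term k y v)) has_sum (\<Sum>w\<in>weyl_group D. infsum (\<lambda>v. norm (zeta_term Dp (param_act Dp (inv w) k) (inv w y) v)) (Ppp Sim)))
      (\<Union>w\<in>weyl_group D. w ` Ppp Sim)"
  proof (rule sum_has_sum)
    fix w assume w: "w \<in> weyl_group D"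
    have n: "norm (zeta_term Dp (param_act Dp (inv w) k) (inv w y) v) = norm (weight_term k y (w v))" for v
      by (simp add: zeta_term_weyl[OF w] norm_mult norm_weyl_sign)
    have "((\<lambda>v. norm (weight_term k y v)) \<circ> w has_sum infsum (\<lambda>v. norm (zeta_term Dp (param_act Dp (inv w) k) (inv w y) v)) (Ppp Sim)) (Ppp Sim)"
      using has_sum_infsum[OF bspec[OF summ w]] by (simp only: o_def n)
    then show "((\<lambda>v. norm (weight_term k y v)) has_sum infsum (\<lambda>v. norm (zeta_term Dp (param_act Dp (inv w) k) (inv w y) v)) (Ppp Sim)) (w ` Ppp Sim)"
      by (simp only: has_sum_reindex[OF inj[OF w]])
  qed (fact finite_weyl, fact regular_weights_partition(2))
  then show "(\<lambda>v. norm (weight_term k y v)) summable_on regular_weights"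
    unfolding regular_weights_partition(1) summable_on_def by blast
qed

text \<open>If the roots with nonzero exponent did not span, infinitely many regular weights near a
  line orthogonal to them would contribute terms bounded away from zero.\<close>

lemma summable_imp_span:
  assumes sub: "Ds \<subseteq> Dp" and k0: "\<forall>\<alpha>\<in>Dp - Ds. k \<alpha> = 0"
    and summ: "(\<lambda>v. norm (weight_term k y v)) summable_on regular_weights"
  shows "span Ds = UNIV"
proof (rule ccontr)
  assume "span Ds \<noteq> UNIV"
  then obtain u where u: "u \<noteq> 0" "\<forall>x\<in>span Ds. u \<bullet> x = 0" using span_not_UNIV_orthogonal by blast
  \<comment> \<open>The point N u rounded to the weight lattice, with an error bounded independently
    of \<open>N\<close>.\<close>
  define b where "b N = (\<Sum>\<alpha>\<in>Sim. of_int \<lfloor>real N * (coroot \<alpha> \<bullet> u)\<rfloor> *\<^sub>R wt \<alpha>)" for N :: nat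
  have cb: "coroot \<alpha> \<bullet> b N = of_int \<lfloor>real N * (coroot \<alpha> \<bullet> u)\<rfloor>" if "\<alpha> \<in> Sim" for \<alpha> N
    using that sum_if_eq_inner[OF finite_Sim that, of "\<lambda>\<alpha>. of_int \<lfloor>real N * (coroot \<alpha> \<bullet> u)\<rfloor>"]
    by (simp add: b_def inner_sum_right dualb_inner_left[OF Sim_rbasis])
  have bdist: "norm (b N - real N *\<^sub>R u) \<le> (\<Sum>\<alpha>\<in>Sim. norm (wt \<alpha>))" for N
  proof -
    have "b N - real N *\<^sub>R u = (\<Sum>\<alpha>\<in>Sim. (coroot \<alpha> \<bullet> (b N - real N *\<^sub>R u)) *\<^sub>R wt \<alpha>)"
      by (rule rbasis_expand[OF Sim_rbasis])
    then have "norm (b N - real N *\<^sub>R u) \<le> (\<Sum>\<alpha>\<in>Sim. norm ((coroot \<alpha> \<bullet> (b N - real N *\<^sub>R u)) *\<^sub>R wt \<alpha>))"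
      by (metis norm_sum)
    also have "\<dots> \<le> (\<Sum>\<alpha>\<in>Sim. norm (wt \<alpha>))"
    proof (rule sum_mono)
      fix \<alpha> assume a: "\<alpha> \<in> Sim"
      have "\<bar>coroot \<alpha> \<bullet> (b N - real N *\<^sub>R u)\<bar> \<le> 1"
        using cb[OF a, of N] by (simp add: inner_diff_right) linarith
      then show "norm ((coroot \<alpha> \<bullet> (b N - real N *\<^sub>R u)) *\<^sub>R wt \<alpha>) \<le> norm (wt \<alpha>)"
        by (simp add: mult_left_le_one_le)
    qed
    finally show ?thesis .
  qed
  have rho_int: "rho \<in> int_dual Sim" by (auto simp: int_dual_def coroot_rho)
  \<comment> \<open>A positive root is orthogonal to at most one of the translates by multiples of
    \<open>rho\<close>, because it pairs nontrivially with \<open>rho\<close>;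
    \<open>card Dp + 1\<close> translates therefore suffice.\<close>
  have "\<exists>m\<le>card Dp. b N + real m *\<^sub>R rho \<in> regular_weights" for N
  proof (rule ccontr)
    assume neg: "\<not> (\<exists>m\<le>card Dp. b N + real m *\<^sub>R rho \<in> regular_weights)"
    have int: "b N + real m *\<^sub>R rho \<in> int_dual Sim" for m
      by (auto simp: int_dual_def inner_add_right cb coroot_rho)
    have "\<exists>\<alpha>\<in>Dp. coroot \<alpha> \<bullet> (b N + real m *\<^sub>R rho) = 0" if "m \<le> card Dp" for m
      using neg that int by (auto simp: regular_weights_def)
    then have "\<exists>f. \<forall>m\<in>{..card Dp}. f m \<in> Dp \<and> coroot (f m) \<bullet> (b N + real m *\<^sub>R rho) = 0"
      by (intro bchoice) auto
    then obtain f where f: "\<And>m. m \<le> card Dp \<Longrightarrow> f m \<in> Dp \<and> coroot (f m) \<bullet> (b N + real m *\<^sub>R rho) = 0"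
      by blast
    have "inj_on f {..card Dp}"
    proof (rule inj_onI)
      fix m m' assume m: "m \<in> {..card Dp}" "m' \<in> {..card Dp}" "f m = f m'"
      have "f m \<bullet> rho > 0" using Dp_inner_pos[OF _ simple_rho] f[of m] m by auto
      then have "coroot (f m) \<bullet> rho \<noteq> 0" using f[of m] m Dp_nonzero by (auto simp: coroot_inner_eq_0)
      moreover have "coroot (f m) \<bullet> (b N + real m *\<^sub>R rho) = coroot (f m) \<bullet> (b N + real m' *\<^sub>R rho)"
        using f[of m] f[of m'] m by auto
      then have "real m * (coroot (f m) \<bullet> rho) = real m' * (coroot (f m) \<bullet> rho)"
        by (simp only: inner_add_right inner_scaleR_right add_left_cancel)
      ultimately show "m = m'" by simp
    qed
    moreover have "f ` {..card Dp} \<subseteq> Dp" using f by auto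
    ultimately have "card {..card Dp} \<le> card Dp" using finite_Dp card_inj_on_le by blast
    then show False by simp
  qed
  then have "\<exists>m. \<forall>N. m N \<le> card Dp \<and> b N + real (m N) *\<^sub>R rho \<in> regular_weights" by (intro choice) auto
  then obtain m where m: "\<And>N. m N \<le> card Dp" "\<And>N. b N + real (m N) *\<^sub>R rho \<in> regular_weights" by blast
  define p where "p N = b N + real (m N) *\<^sub>R rho" for N
  define K where "K = (\<Sum>\<alpha>\<in>Sim. norm (wt \<alpha>)) + real (card Dp) * norm rho"
  have pdist: "norm (p N - real N *\<^sub>R u) \<le> K" for N
  proof -
    have "norm (p N - real N *\<^sub>R u) = norm ((b N - real N *\<^sub>R u) + real (m N) *\<^sub>R rho)" by (simp add: p_def algebra_simps)
    also have "\<dots> \<le> norm (b N - real N *\<^sub>R u) + real (m N) * norm rho"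
      using norm_triangle_ineq[of "b N - real N *\<^sub>R u" "real (m N) *\<^sub>R rho"] by simp
    also have "\<dots> \<le> K" unfolding K_def using bdist[of N] m(1)[of N] by (intro add_mono mult_right_mono) auto
    finally show ?thesis .
  qed
  have K0: "K \<ge> 0" using pdist[of 0] norm_ge_zero order_trans by blast
  \<comment> \<open>Roots in \<open>Ds\<close> do not see the direction \<open>u\<close>, so
    \<open>M\<close> bounds their pairings with every \<open>p N\<close>, and \<open>c\<close> is a
    common lower bound for the terms. The summand 1 keeps \<open>M\<close> positive.\<close>
  define M where "M = 1 + (\<Sum>\<alpha>\<in>Dp. norm (coroot \<alpha>) * K)"
  define c where "c = (\<Prod>\<alpha>\<in>Dp. inverse (M ^ k \<alpha>))"
  have M1: "M \<ge> 1" unfolding M_def using K0 by (simp add: sum_nonneg)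
  have c0: "c > 0" unfolding c_def using M1 by (intro prod_pos) auto
  have lb: "norm (weight_term k y (p N)) \<ge> c" for N
  proof -
    have "norm (weight_term k y (p N)) = (\<Prod>\<alpha>\<in>Dp. inverse (\<bar>coroot \<alpha> \<bullet> p N\<bar> ^ k \<alpha>))"
      by (simp add: weight_term_def norm_mult norm_inverse norm_power flip: prod_norm)
    also have "\<dots> \<ge> c" unfolding c_def
    proof (rule prod_mono, intro conjI)
      fix \<alpha> assume a: "\<alpha> \<in> Dp"
      show "0 \<le> inverse (M ^ k \<alpha>)" using M1 by simp
      show "inverse (M ^ k \<alpha>) \<le> inverse (\<bar>coroot \<alpha> \<bullet> p N\<bar> ^ k \<alpha>)"
      proof (cases "\<alpha> \<in> Ds")
        case False
        then show ?thesis using k0 a by simp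
      next
        case True
        have ne: "coroot \<alpha> \<bullet> p N \<noteq> 0" using m(2)[of N] a by (simp add: regular_weights_def p_def)
        have "\<alpha> \<bullet> u = 0" using u(2) span_base[OF True] by (simp add: inner_commute)
        then have "coroot \<alpha> \<bullet> p N = coroot \<alpha> \<bullet> (p N - real N *\<^sub>R u)"
          by (simp add: inner_diff_right coroot_inner_eq)
        then have "\<bar>coroot \<alpha> \<bullet> p N\<bar> \<le> norm (coroot \<alpha>) * norm (p N - real N *\<^sub>R u)"
          by (metis Cauchy_Schwarz_ineq2)
        also have "\<dots> \<le> norm (coroot \<alpha>) * K" using pdist by (intro mult_left_mono) auto
        also have "\<dots> \<le> (\<Sum>\<alpha>\<in>Dp. norm (coroot \<alpha>) * K)"
          using K0 by (intro member_le_sum[OF a] finite_Dp) auto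
        also have "\<dots> \<le> M" by (simp add: M_def)
        finally show ?thesis using ne by (intro le_imp_inverse_le power_mono) auto
      qed
    qed
    finally show ?thesis .
  qed
  have inf: "infinite (range p)"
  proof
    assume "finite (range p)"
    then obtain R where R: "\<And>N. norm (p N) \<le> R" using finite_imp_bounded bounded_iff by (metis rangeI)
    obtain N :: nat where N: "real N * norm u > R + K" using u(1) reals_Archimedean3[of "norm u"] by auto
    have "norm (real N *\<^sub>R u) \<le> norm (p N) + norm (p N - real N *\<^sub>R u)"
      using norm_triangle_ineq4[of "p N" "p N - real N *\<^sub>R u"] by simp
    then show False using R[of N] pdist[of N] N by simp
  qed
  define S where "S = infsum (\<lambda>v. norm (weight_term k y v)) regular_weights"
  obtain n :: nat where n: "real n * c > S" using reals_Archimedean3[OF c0] by auto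
  obtain T where T: "finite T" "card T = n" "T \<subseteq> range p" using infinite_arbitrarily_large[OF inf] by blast
  have "real n * c = (\<Sum>v\<in>T. c)" using T by simp
  also have "\<dots> \<le> (\<Sum>v\<in>T. norm (weight_term k y v))" using T lb by (intro sum_mono) auto
  also have "\<dots> \<le> S" unfolding S_def
    using T m(2) by (intro finite_sum_le_infsum summ) (auto simp: p_def)
  finally show False using n by simp
qed

end

section \<open>Power series in several variables\<close>

definition hom_idx :: "'a set \<Rightarrow> nat \<Rightarrow> ('a \<Rightarrow> nat) set" where
  "hom_idx S n = {k \<in> multi_idx S. sum k S = n}"

text \<open>Multi-indices are matched with multisets because the coefficient formula
  \<open>fps_prod_nth'\<close> sums over multisets.\<close>

lemma hom_idx_eq: "hom_idx S n = count ` multisets_of_size S n" if "finite S"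
proof (intro equalityI subsetI)
  fix k assume k: "k \<in> hom_idx S n"
  have sub: "{x. k x > 0} \<subseteq> S" using k by (auto simp: hom_idx_def multi_idx_def)
  then have fin: "finite {x. k x > 0}" using that finite_subset by blast
  have c: "count (Abs_multiset k) = k" using fin by (simp add: Abs_multiset_inverse)
  have sm: "set_mset (Abs_multiset k) = {x. k x > 0}" by (simp add: set_mset_def c)
  have "size (Abs_multiset k) = sum k {x. k x > 0}"
    by (simp add: size_multiset_overloaded_eq c sm)
  also have "\<dots> = sum k S" using that sub by (intro sum.mono_neutral_left) auto
  finally have "Abs_multiset k \<in> multisets_of_size S n"
    using k sub by (simp add: multisets_of_size_def hom_idx_def sm)
  then show "k \<in> count ` multisets_of_size S n" using c by force
next
  fix k assume "k \<in> count ` multisets_of_size S n"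
  then obtain X where X: "set_mset X \<subseteq> S" "size X = n" "k = count X" by (auto simp: multisets_of_size_def)
  have "sum (count X) S = sum (count X) (set_mset X)"
    using that X by (intro sum.mono_neutral_right) (auto simp: not_in_iff)
  then show "k \<in> hom_idx S n"
    using X by (auto simp: hom_idx_def multi_idx_def size_multiset_overloaded_eq count_eq_zero_iff)
qed

lemma finite_hom_idx: "finite S \<Longrightarrow> finite (hom_idx S n)"
  by (simp add: hom_idx_eq finite_multisets_of_size)

lemma fps_nth_prod:
  assumes "finite S"
  shows "fps_nth (\<Prod>x\<in>S. f x) n = (\<Sum>k\<in>hom_idx S n. \<Prod>x\<in>S. fps_nth (f x) (k x))"
  unfolding hom_idx_eq[OF assms] fps_prod_nth'[OF assms]
  by (subst sum.reindex) (auto simp: inj_on_def count_inject)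

lemma expi_power: "expi x ^ n = expi (real n * x)"
  by (induction n) (simp_all add: expi_add[symmetric] distrib_right)

section \<open>Coefficient extraction on a torus\<close>

lemma sum_root_of_unity:
  assumes "\<bar>d\<bar> < int N"
  shows "(\<Sum>i<N. expi (real i * (of_int d / real N))) = (if d = 0 then of_nat N else 0)"
proof (cases "d = 0")
  case False
  have N: "N > 0" using assms by auto
  let ?w = "expi (of_int d / real N)"
  have pw: "expi (real i * (of_int d / real N)) = ?w ^ i" for i
    by (rule expi_power[symmetric])
  have "?w \<noteq> 1"
  proof
    assume "?w = 1"
    then obtain m :: int where "of_int d / real N = of_int m" by (auto simp: expi_eq_1 elim: Ints_cases)
    then have "real_of_int d = of_int (m * int N)" using N by (simp add: field_simps)
    then have "d = m * int N" by linarith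
    then show False using assms False by (auto simp: abs_mult)
  qed
  moreover have "?w ^ N = 1" unfolding pw[symmetric] using N by simp
  moreover have "(\<Sum>i<N. expi (real i * (of_int d / real N))) = (\<Sum>i<N. ?w ^ i)" by (simp only: pw)
  ultimately show ?thesis using False by (simp add: sum_gp_strict)
qed simp

definition torus_pt :: "('a \<Rightarrow> real) \<Rightarrow> nat \<Rightarrow> ('a \<Rightarrow> nat) \<Rightarrow> 'a \<Rightarrow> complex" where
  "torus_pt \<delta> N e \<alpha> = of_real (\<delta> \<alpha>) * expi (real (e \<alpha>) / real N)"

text \<open>Inverse discrete Fourier transform in each variable, rescaled by the radii. As a finite
  linear combination of values of \<open>R\<close> it commutes with generalized sums and with
  limits.\<close>

definition coef_extract :: "'a set \<Rightarrow> ('a \<Rightarrow> real) \<Rightarrow> nat \<Rightarrow> ('a \<Rightarrow> nat) \<Rightarrow> (('a \<Rightarrow> complex) \<Rightarrow> complex) \<Rightarrow> complex" where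
  "coef_extract S \<delta> n k R = (\<Sum>e\<in>PiE S (\<lambda>_. {..<Suc n}).
     (\<Prod>\<alpha>\<in>S. expi (- (real (e \<alpha>) * real (k \<alpha>) / real (Suc n)))) / (of_nat (Suc n ^ card S) * (\<Prod>\<alpha>\<in>S. of_real (\<delta> \<alpha>) ^ k \<alpha>))
       * R (torus_pt \<delta> (Suc n) e))"

lemma hom_idx_le: "finite S \<Longrightarrow> k \<in> hom_idx S n \<Longrightarrow> \<alpha> \<in> S \<Longrightarrow> k \<alpha> \<le> n"
  using member_le_sum[of \<alpha> S k] by (auto simp: hom_idx_def)

text \<open>In degree \<open>n\<close> all exponents are at most \<open>n\<close>, so their
  differences are smaller than n + 1 in absolute value and the roots of unity of that order separate
  them.\<close>

lemma coef_extract_poly: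
  assumes fin: "finite S" and \<delta>: "\<And>\<alpha>. \<alpha> \<in> S \<Longrightarrow> \<delta> \<alpha> > 0" and k: "k \<in> hom_idx S n"
  shows "coef_extract S \<delta> n k (\<lambda>t. \<Sum>k'\<in>hom_idx S n. c k' * (\<Prod>\<alpha>\<in>S. t \<alpha> ^ k' \<alpha>)) = c k"
proof -
  let ?N = "Suc n"
  let ?w = "of_nat (?N ^ card S) * (\<Prod>\<alpha>\<in>S. of_real (\<delta> \<alpha>) ^ k \<alpha>) :: complex"
  have orth: "(\<Sum>e\<in>PiE S (\<lambda>_. {..<?N}). (\<Prod>\<alpha>\<in>S. expi (- (real (e \<alpha>) * real (k \<alpha>) / real ?N))) * (\<Prod>\<alpha>\<in>S. torus_pt \<delta> ?N e \<alpha> ^ k' \<alpha>))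
     = (if k' = k then ?w else 0)" if k': "k' \<in> hom_idx S n" for k'
  proof -
    have "(\<Sum>e\<in>PiE S (\<lambda>_. {..<?N}). (\<Prod>\<alpha>\<in>S. expi (- (real (e \<alpha>) * real (k \<alpha>) / real ?N))) * (\<Prod>\<alpha>\<in>S. torus_pt \<delta> ?N e \<alpha> ^ k' \<alpha>))
      = (\<Sum>e\<in>PiE S (\<lambda>_. {..<?N}). \<Prod>\<alpha>\<in>S. of_real (\<delta> \<alpha>) ^ k' \<alpha> * expi (real (e \<alpha>) * (of_int (int (k' \<alpha>) - int (k \<alpha>)) / real ?N)))"
    proof (rule sum.cong[OF refl], unfold prod.distrib[symmetric], rule prod.cong[OF refl])
      fix e :: "'a \<Rightarrow> nat" and \<alpha> :: 'a
      have "expi (real (e \<alpha>) / real ?N) ^ j = expi (real j * (real (e \<alpha>) / real ?N))" for j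
        by (rule expi_power)
      then have "expi (- (real (e \<alpha>) * real (k \<alpha>) / real ?N)) * expi (real (e \<alpha>) / real ?N) ^ k' \<alpha> =
          expi (- (real (e \<alpha>) * real (k \<alpha>) / real ?N) + real (k' \<alpha>) * (real (e \<alpha>) / real ?N))"
        by (simp only: expi_add)
      also have "- (real (e \<alpha>) * real (k \<alpha>) / real ?N) + real (k' \<alpha>) * (real (e \<alpha>) / real ?N) =
          real (e \<alpha>) * (of_int (int (k' \<alpha>) - int (k \<alpha>)) / real ?N)"
        by (simp add: diff_divide_distrib right_diff_distrib mult_ac del: of_nat_Suc)
      finally show "expi (- (real (e \<alpha>) * real (k \<alpha>) / real ?N)) * torus_pt \<delta> ?N e \<alpha> ^ k' \<alpha> =
          of_real (\<delta> \<alpha>) ^ k' \<alpha> * expi (real (e \<alpha>) * (of_int (int (k' \<alpha>) - int (k \<alpha>)) / real ?N))"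
        by (simp only: torus_pt_def power_mult_distrib mult_ac)
    qed
    also have "\<dots> = (\<Prod>\<alpha>\<in>S. \<Sum>i<?N. of_real (\<delta> \<alpha>) ^ k' \<alpha> * expi (real i * (of_int (int (k' \<alpha>) - int (k \<alpha>)) / real ?N)))"
      by (rule prod_sum_PiE[symmetric]) (use fin in auto)
    also have "\<dots> = (\<Prod>\<alpha>\<in>S. of_real (\<delta> \<alpha>) ^ k' \<alpha> * (if k' \<alpha> = k \<alpha> then of_nat ?N else 0))"
    proof (rule prod.cong[OF refl])
      fix \<alpha> assume a: "\<alpha> \<in> S"
      have "\<bar>int (k' \<alpha>) - int (k \<alpha>)\<bar> < int ?N"
        using hom_idx_le[OF fin k a] hom_idx_le[OF fin k' a] by auto
      from sum_root_of_unity[OF this]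
      show "(\<Sum>i<?N. of_real (\<delta> \<alpha>) ^ k' \<alpha> * expi (real i * (of_int (int (k' \<alpha>) - int (k \<alpha>)) / real ?N))) =
        of_real (\<delta> \<alpha>) ^ k' \<alpha> * (if k' \<alpha> = k \<alpha> then of_nat ?N else 0)"
        by (simp only: sum_distrib_left[symmetric]) (simp del: of_nat_Suc)
    qed
    also have "\<dots> = (if k' = k then ?w else 0)"
    proof (cases "k' = k")
      case True
      then show ?thesis by (simp add: prod.distrib mult.commute del: of_nat_Suc)
    next
      case False
      then obtain \<alpha> where "k' \<alpha> \<noteq> k \<alpha>" by auto
      moreover then have "\<alpha> \<in> S" using k k' unfolding hom_idx_def multi_idx_def by (metis (mono_tags, lifting) mem_Collect_eq)
      ultimately show ?thesis using False fin by (simp add: prod_zero_iff) blast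
    qed
    finally show ?thesis .
  qed
  have w0: "?w \<noteq> 0" using fin \<delta> by (auto simp: prod_zero_iff less_imp_neq[symmetric] simp del: of_nat_Suc)
  have "coef_extract S \<delta> n k (\<lambda>t. \<Sum>k'\<in>hom_idx S n. c k' * (\<Prod>\<alpha>\<in>S. t \<alpha> ^ k' \<alpha>)) =
    (\<Sum>e\<in>PiE S (\<lambda>_. {..<?N}). \<Sum>k'\<in>hom_idx S n. c k' / ?w * ((\<Prod>\<alpha>\<in>S. expi (- (real (e \<alpha>) * real (k \<alpha>) / real ?N))) * (\<Prod>\<alpha>\<in>S. torus_pt \<delta> ?N e \<alpha> ^ k' \<alpha>)))"
    unfolding coef_extract_def by (intro sum.cong refl) (simp add: sum_distrib_left divide_inverse mult_ac del: of_nat_Suc)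
  also have "\<dots> = (\<Sum>k'\<in>hom_idx S n. c k' / ?w * (if k' = k then ?w else 0))"
    by (subst sum.swap) (simp only: sum_distrib_left[symmetric] orth cong: sum.cong)
  also have "\<dots> = (\<Sum>k'\<in>hom_idx S n. if k' = k then c k else 0)"
    using w0 by (intro sum.cong refl) auto
  also have "\<dots> = c k" using k finite_hom_idx[OF fin, of n] by simp
  finally show ?thesis .
qed

text \<open>A discrete form of the Cauchy estimate: the average over the grid points is bounded by
  the maximum on the torus.\<close>

lemma norm_coef_extract_le:
  assumes fin: "finite S" and \<delta>: "\<And>\<alpha>. \<alpha> \<in> S \<Longrightarrow> \<delta> \<alpha> > 0"
    and R: "\<And>e. norm (R (torus_pt \<delta> (Suc n) e)) \<le> C"
  shows "norm (coef_extract S \<delta> n k R) \<le> C / (\<Prod>\<alpha>\<in>S. \<delta> \<alpha> ^ k \<alpha>)"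
proof -
  have \<delta>k: "0 < (\<Prod>\<alpha>\<in>S. \<delta> \<alpha> ^ k \<alpha>)" using \<delta> by (intro prod_pos) auto
  have nd: "norm (\<Prod>\<alpha>\<in>S. of_real (\<delta> \<alpha>) ^ k \<alpha> :: complex) = (\<Prod>\<alpha>\<in>S. \<delta> \<alpha> ^ k \<alpha>)"
    unfolding prod_norm[symmetric] using \<delta> by (intro prod.cong refl) (simp add: norm_power less_imp_le)
  have ne: "norm (\<Prod>\<alpha>\<in>S. expi (f \<alpha>)) = 1" for f by (simp flip: prod_norm)
  have C: "norm (R (torus_pt \<delta> (Suc n) e)) / (real (Suc n ^ card S) * (\<Prod>\<alpha>\<in>S. \<delta> \<alpha> ^ k \<alpha>)) \<le> C / (real (Suc n ^ card S) * (\<Prod>\<alpha>\<in>S. \<delta> \<alpha> ^ k \<alpha>))" for e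
    using \<delta>k by (intro divide_right_mono R) auto
  have "norm (coef_extract S \<delta> n k R) \<le> (\<Sum>e\<in>PiE S (\<lambda>_. {..<Suc n}). norm (R (torus_pt \<delta> (Suc n) e)) / (real (Suc n ^ card S) * (\<Prod>\<alpha>\<in>S. \<delta> \<alpha> ^ k \<alpha>)))"
    unfolding coef_extract_def
    by (rule order_trans[OF norm_sum], rule sum_mono)
       (simp only: norm_mult norm_divide ne nd norm_of_nat, simp)
  also have "\<dots> \<le> (\<Sum>e\<in>PiE S (\<lambda>_. {..<Suc n}). C / (real (Suc n ^ card S) * (\<Prod>\<alpha>\<in>S. \<delta> \<alpha> ^ k \<alpha>)))"
    by (rule sum_mono) (rule C)
  also have "\<dots> = C / (\<Prod>\<alpha>\<in>S. \<delta> \<alpha> ^ k \<alpha>)"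
    using fin by (simp add: card_PiE del: of_nat_Suc)
  finally show ?thesis .
qed

text \<open>The radii form a hierarchy. Each new variable is so small that it cannot offset forms
  already nonzero in the earlier ones; a form supported on the new variable alone is bounded below
  by its own size.\<close>

lemma torus_radii:
  assumes "finite S" "finite L" "\<And>l. l \<in> L \<Longrightarrow> \<exists>\<alpha>\<in>S. l \<alpha> \<noteq> 0"
  shows "\<exists>\<delta> \<kappa>. (\<forall>\<alpha>. 0 < \<delta> \<alpha> \<and> \<delta> \<alpha> \<le> 1) \<and> 0 < \<kappa> \<and>
     (\<forall>l\<in>L. \<forall>t::'a \<Rightarrow> complex. (\<forall>\<alpha>\<in>S. norm (t \<alpha>) = \<delta> \<alpha>) \<longrightarrow> \<kappa> \<le> norm (\<Sum>\<alpha>\<in>S. t \<alpha> * l \<alpha>))"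
  using assms
proof (induction S arbitrary: L rule: finite_induct)
  case empty
  then have "L = {}" by auto
  then show ?case by (intro exI[of _ "\<lambda>_. 1"] exI[of _ 1]) auto
next
  case (insert x S)
  define L1 where "L1 = {l\<in>L. \<exists>\<alpha>\<in>S. l \<alpha> \<noteq> 0}"
  have fL1: "finite L1" using insert.prems by (simp add: L1_def)
  have "\<exists>\<delta> \<kappa>. (\<forall>\<alpha>. 0 < \<delta> \<alpha> \<and> \<delta> \<alpha> \<le> 1) \<and> 0 < \<kappa> \<and>
     (\<forall>l\<in>L1. \<forall>t::'a \<Rightarrow> complex. (\<forall>\<alpha>\<in>S. norm (t \<alpha>) = \<delta> \<alpha>) \<longrightarrow> \<kappa> \<le> norm (\<Sum>\<alpha>\<in>S. t \<alpha> * l \<alpha>))"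
    by (rule insert.IH[OF fL1]) (simp add: L1_def)
  then obtain \<delta> \<kappa> where d: "\<And>\<alpha>. 0 < \<delta> \<alpha>" "\<And>\<alpha>. \<delta> \<alpha> \<le> 1" "0 < \<kappa>"
    and L1: "\<And>l t. l \<in> L1 \<Longrightarrow> (\<forall>\<alpha>\<in>S. norm (t \<alpha>) = \<delta> \<alpha>) \<Longrightarrow> \<kappa> \<le> norm (\<Sum>\<alpha>\<in>S. t \<alpha> * l \<alpha>)"
    by blast
  define M where "M = 1 + (\<Sum>l\<in>L. norm (l x))"
  have M: "M \<ge> 1" "\<And>l. l \<in> L \<Longrightarrow> norm (l x) \<le> M"
  proof -
    show "M \<ge> 1" by (simp add: M_def sum_nonneg)
    show "norm (l x) \<le> M" if "l \<in> L" for l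
      using member_le_sum[OF that, of "\<lambda>l. norm (l x)"] insert.prems by (simp add: M_def)
  qed
  \<comment> \<open>With this radius the new variable uses up at most half of the previous lower
    bound.\<close>
  define dx where "dx = min 1 (\<kappa> / (2 * M))"
  have dx: "0 < dx" "dx \<le> 1" "dx * M \<le> \<kappa> / 2"
  proof -
    show "0 < dx" "dx \<le> 1" using d M by (auto simp: dx_def)
    have "dx \<le> \<kappa> / (2 * M)" by (simp add: dx_def)
    then show "dx * M \<le> \<kappa> / 2" using M(1) by (simp add: field_simps)
  qed
  define \<kappa>' where "\<kappa>' = Min (insert (\<kappa> / 2) ((\<lambda>l. dx * norm (l x)) ` (L - L1)))"
  have fin: "finite (insert (\<kappa> / 2) ((\<lambda>l. dx * norm (l x)) ` (L - L1)))" using insert.prems by simp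
  have pos: "dx * norm (l x) > 0" if "l \<in> L - L1" for l
    using that insert.prems(2)[of l] dx by (auto simp: L1_def)
  have \<kappa>': "0 < \<kappa>'" unfolding \<kappa>'_def using fin d pos by (subst Min_gr_iff) auto
  show ?case
  proof (intro exI[of _ "\<delta>(x := dx)"] exI[of _ \<kappa>'] conjI ballI allI impI)
    fix l and t :: "'a \<Rightarrow> complex" assume l: "l \<in> L" and t: "\<forall>\<alpha>\<in>insert x S. norm (t \<alpha>) = (\<delta>(x := dx)) \<alpha>"
    have tS: "\<forall>\<alpha>\<in>S. norm (t \<alpha>) = \<delta> \<alpha>" using t insert.hyps by auto
    have tx: "norm (t x) = dx" using t by simp
    have sum: "(\<Sum>\<alpha>\<in>insert x S. t \<alpha> * l \<alpha>) = t x * l x + (\<Sum>\<alpha>\<in>S. t \<alpha> * l \<alpha>)" using insert.hyps by simp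
    show "\<kappa>' \<le> norm (\<Sum>\<alpha>\<in>insert x S. t \<alpha> * l \<alpha>)"
    proof (cases "l \<in> L1")
      case True
      have "norm (t x * l x) \<le> \<kappa> / 2"
      proof -
        have "dx * norm (l x) \<le> dx * M" using M(2)[OF l] dx(1) by (intro mult_left_mono) auto
        then show ?thesis using dx(3) by (simp add: norm_mult tx)
      qed
      moreover have "\<kappa> \<le> norm (\<Sum>\<alpha>\<in>S. t \<alpha> * l \<alpha>)" by (rule L1[OF True tS])
      moreover have "\<kappa>' \<le> \<kappa> / 2" unfolding \<kappa>'_def using fin by (intro Min_le) auto
      ultimately show ?thesis
        unfolding sum using norm_diff_ineq[of "\<Sum>\<alpha>\<in>S. t \<alpha> * l \<alpha>" "t x * l x"] by (simp add: add.commute)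
    next
      case False
      then have "(\<Sum>\<alpha>\<in>S. t \<alpha> * l \<alpha>) = 0" using l by (intro sum.neutral) (auto simp: L1_def)
      moreover have "\<kappa>' \<le> dx * norm (l x)" unfolding \<kappa>'_def using fin l False by (intro Min_le) auto
      ultimately show ?thesis unfolding sum by (simp add: norm_mult tx)
    qed
  qed (use d dx \<kappa>' in auto)
qed

section \<open>Summation by degree and uniqueness of coefficients\<close>

lemma summable_geometric_multi_idx:
  assumes fin: "finite S" and r: "0 \<le> r" "r < (1::real)"
  shows "(\<lambda>k. r ^ sum k S) summable_on multi_idx S"
proof -
  have geo: "(\<lambda>j::nat. norm (r ^ j)) summable_on UNIV"
    using r by (intro summable_nonneg_imp_summable_on) (auto simp: norm_power)
  have "(\<lambda>g. \<Prod>\<alpha>\<in>S. r ^ g \<alpha>) summable_on PiE S (\<lambda>_. UNIV :: nat set)"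
    using abs_summable_summable[OF abs_summable_prod_PiE[OF fin geo]] by simp
  moreover have "bij_betw (\<lambda>g \<alpha>. if \<alpha> \<in> S then g \<alpha> else 0) (PiE S (\<lambda>_. UNIV :: nat set)) (multi_idx S)"
    by (rule bij_betwI[of _ _ _ "\<lambda>k. restrict k S"])
       (auto simp: multi_idx_def PiE_def extensional_def fun_eq_iff)
  from summable_on_reindex_bij_betw[OF this, of "\<lambda>k. r ^ sum k S"]
  have "(\<lambda>g. r ^ (\<Sum>\<alpha>\<in>S. if \<alpha> \<in> S then g \<alpha> else 0)) summable_on PiE S (\<lambda>_. UNIV :: nat set) \<longleftrightarrow>
    (\<lambda>k. r ^ sum k S) summable_on multi_idx S" by simp
  ultimately show ?thesis by (simp add: power_sum)
qed

lemma has_sum_by_degree: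
  fixes f :: "('a \<Rightarrow> nat) \<Rightarrow> complex"
  assumes fin: "finite S" and f: "(f has_sum s) (multi_idx S)"
  shows "(\<lambda>n. \<Sum>k\<in>hom_idx S n. f k) sums s"
proof -
  have bij: "bij_betw snd (SIGMA n:UNIV. hom_idx S n) (multi_idx S)"
    by (rule bij_betwI[of _ _ _ "\<lambda>k. (sum k S, k)"]) (auto simp: hom_idx_def)
  have "((\<lambda>(n, k). f k) has_sum s) (SIGMA n:UNIV. hom_idx S n)"
    using has_sum_reindex_bij_betw[OF bij, of f s] f by (simp add: case_prod_unfold)
  then have "((\<lambda>n. \<Sum>k\<in>hom_idx S n. f k) has_sum s) UNIV"
    by (rule has_sum_SigmaD) (use finite_hom_idx[OF fin] in auto)
  then show ?thesis by (rule has_sum_imp_sums)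
qed


text \<open>Vanishing is known only at small positive reals. Coefficients are therefore peeled off
  one at a time: after division by s^j, the next one is the limit along the points r / (m +
  1).\<close>

lemma powser_zero_coef:
  fixes q :: "nat \<Rightarrow> complex"
  assumes r: "r > 0" and q: "\<And>s::real. 0 < s \<Longrightarrow> s \<le> r \<Longrightarrow> (\<lambda>j. q j * of_real s ^ j) sums 0"
  shows "q j = 0"
proof (induction j rule: less_induct)
  case (less j)
  have q': "(\<lambda>i. q (i + j) * of_real s ^ i) sums 0" if s: "0 < s" "s \<le> r" for s :: real
  proof -
    have "(\<lambda>i. q (i + j) * of_real s ^ (i + j)) sums (0 - (\<Sum>i<j. q i * of_real s ^ i))"
      by (rule sums_split_initial_segment[OF q[OF s]])
    then have "(\<lambda>i. q (i + j) * of_real s ^ (i + j)) sums 0" using less by simp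
    from sums_divide[OF this, of "of_real s ^ j"] show ?thesis using s by (simp add: power_add)
  qed
  define f where "f x = (\<Sum>i. q (i + j) * x ^ i)" for x
  have "(f \<longlongrightarrow> q (0 + j)) (at 0)"
  proof (rule powser_limit_0[OF r])
    fix x :: complex assume x: "norm x < r"
    have "summable (\<lambda>i. q (i + j) * x ^ i)"
      by (rule powser_inside[OF sums_summable[OF q'[OF r order_refl]]]) (use x r in simp)
    then show "(\<lambda>i. q (i + j) * x ^ i) sums f x" unfolding f_def by (rule summable_sums)
  qed
  moreover have "filterlim (\<lambda>m. of_real (r * inverse (real (Suc m))) :: complex) (at 0) sequentially"
  proof (rule filterlim_atI)
    have "(\<lambda>m. r * inverse (real (Suc m))) \<longlonglongrightarrow> r * 0"
      by (intro tendsto_intros LIMSEQ_inverse_real_of_nat)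
    then show "(\<lambda>m. of_real (r * inverse (real (Suc m))) :: complex) \<longlonglongrightarrow> 0"
      using tendsto_of_real[of "\<lambda>m. r * inverse (real (Suc m))" "r * 0" sequentially, where 'a = complex]
      by (simp only: mult_zero_right of_real_0)
    show "\<forall>\<^sub>F m in sequentially. of_real (r * inverse (real (Suc m))) \<noteq> (0::complex)"
      using r by (intro always_eventually allI) (simp del: of_nat_Suc)
  qed
  ultimately have "(\<lambda>m. f (of_real (r * inverse (real (Suc m))))) \<longlonglongrightarrow> q (0 + j)"
    by (rule filterlim_compose)
  moreover have "f (of_real (r * inverse (real (Suc m)))) = 0" for m
  proof -
    have "0 < r * inverse (real (Suc m))" "r * inverse (real (Suc m)) \<le> r"
      using r by (auto simp: field_simps)
    from sums_unique[OF q'[OF this]] show ?thesis by (simp add: f_def)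
  qed
  ultimately have "(\<lambda>m::nat. 0::complex) \<longlonglongrightarrow> q j" by (simp only: add_0)
  then show ?case by (simp add: LIMSEQ_const_iff)
qed

text \<open>Scaling by \<open>s\<close> separates the degrees, and the torus then separates the
  monomials within one degree.\<close>

lemma multi_series_coef_zero:
  fixes d :: "('a \<Rightarrow> nat) \<Rightarrow> complex"
  assumes fin: "finite S" and \<delta>: "\<And>\<alpha>. \<alpha> \<in> S \<Longrightarrow> \<delta> \<alpha> > 0" and r: "r > 0"
    and z: "\<And>N e s. 0 < s \<Longrightarrow> s \<le> r \<Longrightarrow> ((\<lambda>k. d k * (\<Prod>\<alpha>\<in>S. (of_real s * torus_pt \<delta> N e \<alpha>) ^ k \<alpha>)) has_sum 0) (multi_idx S)"
    and k: "k \<in> multi_idx S"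
  shows "d k = 0"
proof -
  define n where "n = sum k S"
  define R where "R j t = (\<Sum>k\<in>hom_idx S j. d k * (\<Prod>\<alpha>\<in>S. t \<alpha> ^ k \<alpha>))" for j and t :: "'a \<Rightarrow> complex"
  have R0: "R j (torus_pt \<delta> (Suc n) e) = 0" for j e
  proof (rule powser_zero_coef[OF r, where q = "\<lambda>j. R j (torus_pt \<delta> (Suc n) e)"])
    fix s :: real assume s: "0 < s" "s \<le> r"
    have "(\<Sum>k\<in>hom_idx S j. d k * (\<Prod>\<alpha>\<in>S. (of_real s * torus_pt \<delta> (Suc n) e \<alpha>) ^ k \<alpha>)) = R j (torus_pt \<delta> (Suc n) e) * of_real s ^ j" for j
      unfolding R_def sum_distrib_right
      by (intro sum.cong refl) (auto simp: power_mult_distrib prod.distrib hom_idx_def simp flip: power_sum)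
    with has_sum_by_degree[OF fin z[OF s, of "Suc n" e]]
    show "(\<lambda>j. R j (torus_pt \<delta> (Suc n) e) * of_real s ^ j) sums 0" by simp
  qed
  have "k \<in> hom_idx S n" using k by (simp add: hom_idx_def n_def)
  from coef_extract_poly[OF fin \<delta> this, where c = d]
  have "d k = coef_extract S \<delta> n k (R n)" by (simp add: R_def[abs_def])
  also have "\<dots> = 0" by (simp add: coef_extract_def R0)
  finally show ?thesis .
qed

text \<open>Uniqueness for the definite description in \<open>Pcoef\<close>. The expansion is
  demanded at regular \<open>t\<close> only, so two candidates are compared on scaled tori that
  consist of regular points.\<close>

lemma Pcoef_eqI:
  assumes fin: "finite Ds" and \<delta>: "\<And>\<alpha>. 0 < \<delta> \<alpha> \<and> \<delta> \<alpha> \<le> 1"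
    and reg: "\<And>N e s. 0 < s \<Longrightarrow> F_regular Dp Ds nus (\<lambda>\<alpha>. of_real s * torus_pt \<delta> N e \<alpha>)"
    and c0: "\<forall>k. k \<notin> multi_idx Ds \<longrightarrow> c k = 0"
    and c: "\<epsilon> > 0" "\<And>t. (\<forall>\<alpha>\<in>Ds. norm (t \<alpha>) < \<epsilon>) \<Longrightarrow> F_regular Dp Ds nus t \<Longrightarrow>
        ((\<lambda>k. c k * (\<Prod>\<alpha>\<in>Ds. t \<alpha> ^ k \<alpha> / of_nat (fact (k \<alpha>)))) has_sum Fgen Dp Sim Ds nus \<phi> y t) (multi_idx Ds)"
  shows "Pcoef Dp Sim Ds nus \<phi> y = c"
  unfolding Pcoef_def
proof (rule the_equality)
  show "(\<forall>k. k \<notin> multi_idx Ds \<longrightarrow> c k = 0) \<and> (\<exists>\<epsilon>>0. \<forall>t. (\<forall>\<alpha>\<in>Ds. norm (t \<alpha>) < \<epsilon>) \<and> F_regular Dp Ds nus t \<longrightarrow>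
        ((\<lambda>k. c k * (\<Prod>\<alpha>\<in>Ds. t \<alpha> ^ k \<alpha> / of_nat (fact (k \<alpha>)))) has_sum Fgen Dp Sim Ds nus \<phi> y t) (multi_idx Ds))"
    using c0 c by blast
next
  fix b assume b: "(\<forall>k. k \<notin> multi_idx Ds \<longrightarrow> b k = 0) \<and> (\<exists>\<epsilon>>0. \<forall>t. (\<forall>\<alpha>\<in>Ds. norm (t \<alpha>) < \<epsilon>) \<and> F_regular Dp Ds nus t \<longrightarrow>
        ((\<lambda>k. b k * (\<Prod>\<alpha>\<in>Ds. t \<alpha> ^ k \<alpha> / of_nat (fact (k \<alpha>)))) has_sum Fgen Dp Sim Ds nus \<phi> y t) (multi_idx Ds))"
  then obtain \<epsilon>' where \<epsilon>': "\<epsilon>' > 0" "\<And>t. (\<forall>\<alpha>\<in>Ds. norm (t \<alpha>) < \<epsilon>') \<Longrightarrow> F_regular Dp Ds nus t \<Longrightarrow>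
        ((\<lambda>k. b k * (\<Prod>\<alpha>\<in>Ds. t \<alpha> ^ k \<alpha> / of_nat (fact (k \<alpha>)))) has_sum Fgen Dp Sim Ds nus \<phi> y t) (multi_idx Ds)"
    by blast
  define d where "d k = (b k - c k) / (\<Prod>\<alpha>\<in>Ds. of_nat (fact (k \<alpha>)))" for k
  define r where "r = min \<epsilon> \<epsilon>' / 2"
  have r: "r > 0" "r < \<epsilon>" "r < \<epsilon>'" using c(1) \<epsilon>'(1) by (auto simp: r_def)
  have "d k = 0" if k: "k \<in> multi_idx Ds" for k
  proof (rule multi_series_coef_zero[OF fin _ r(1) _ k])
    show "\<And>\<alpha>. 0 < \<delta> \<alpha>" using \<delta> by auto
    fix N e and s :: real assume s: "0 < s" "s \<le> r"
    let ?t = "\<lambda>\<alpha>. of_real s * torus_pt \<delta> N e \<alpha>"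
    have "norm (?t \<alpha>) \<le> r" for \<alpha>
      using \<delta>[of \<alpha>] s mult_mono[of s r "\<delta> \<alpha>" 1] by (simp add: torus_pt_def norm_mult)
    then have "\<forall>\<alpha>\<in>Ds. norm (?t \<alpha>) < \<epsilon>" "\<forall>\<alpha>\<in>Ds. norm (?t \<alpha>) < \<epsilon>'"
      using r by (auto intro: le_less_trans)
    from has_sum_add[OF \<epsilon>'(2)[OF this(2) reg[OF s(1)]] has_sum_cmult_right[OF c(2)[OF this(1) reg[OF s(1)]], of "-1"]]
    have "((\<lambda>k. b k * (\<Prod>\<alpha>\<in>Ds. ?t \<alpha> ^ k \<alpha> / of_nat (fact (k \<alpha>))) + -1 * (c k * (\<Prod>\<alpha>\<in>Ds. ?t \<alpha> ^ k \<alpha> / of_nat (fact (k \<alpha>))))) has_sum 0) (multi_idx Ds)"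
      by simp
    also have "(\<lambda>k. b k * (\<Prod>\<alpha>\<in>Ds. ?t \<alpha> ^ k \<alpha> / of_nat (fact (k \<alpha>))) + -1 * (c k * (\<Prod>\<alpha>\<in>Ds. ?t \<alpha> ^ k \<alpha> / of_nat (fact (k \<alpha>))))) =
       (\<lambda>k. d k * (\<Prod>\<alpha>\<in>Ds. ?t \<alpha> ^ k \<alpha>))"
      by (rule ext) (simp add: d_def prod_dividef left_diff_distrib diff_divide_distrib)
    finally show "((\<lambda>k. d k * (\<Prod>\<alpha>\<in>Ds. ?t \<alpha> ^ k \<alpha>)) has_sum 0) (multi_idx Ds)" .
  qed
  then have "b k = c k" if "k \<in> multi_idx Ds" for k
    using that fin by (auto simp: d_def prod_zero_iff)
  moreover have "b k = c k" if "k \<notin> multi_idx Ds" for k using that b c0 by auto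
  ultimately show "b = c" by blast
qed

text \<open>A quarter of the radii contributes 4^(-n) against the growth 2^n, which leaves a
  geometric series of ratio 1/2 and justifies ungrouping the sum over degrees.\<close>

lemma has_sum_multi_idx:
  fixes p :: "('a \<Rightarrow> nat) \<Rightarrow> complex"
  assumes fin: "finite S" and \<delta>: "\<And>\<alpha>. \<alpha> \<in> S \<Longrightarrow> \<delta> \<alpha> > 0"
    and p: "\<And>n k. k \<in> hom_idx S n \<Longrightarrow> norm (p k) \<le> C * 2 ^ n / (\<Prod>\<alpha>\<in>S. \<delta> \<alpha> ^ k \<alpha>)"
    and t: "\<And>\<alpha>. \<alpha> \<in> S \<Longrightarrow> norm (t \<alpha>) \<le> \<delta> \<alpha> / 4"
    and s: "(\<lambda>n. \<Sum>k\<in>hom_idx S n. p k * (\<Prod>\<alpha>\<in>S. t \<alpha> ^ k \<alpha>)) sums s"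
  shows "((\<lambda>k. p k * (\<Prod>\<alpha>\<in>S. t \<alpha> ^ k \<alpha>)) has_sum s) (multi_idx S)"
proof -
  have "(\<lambda>k. C * (1/2) ^ sum k S) summable_on multi_idx S"
    by (intro summable_on_cmult_right summable_geometric_multi_idx fin) auto
  then have "(\<lambda>k. norm (p k * (\<Prod>\<alpha>\<in>S. t \<alpha> ^ k \<alpha>))) summable_on multi_idx S"
  proof (rule summable_on_comparison_test)
    fix k assume k: "k \<in> multi_idx S"
    then have kh: "k \<in> hom_idx S (sum k S)" by (simp add: hom_idx_def)
    have \<delta>k: "0 < (\<Prod>\<alpha>\<in>S. \<delta> \<alpha> ^ k \<alpha>)" using \<delta> by (intro prod_pos) auto
    have "norm (\<Prod>\<alpha>\<in>S. t \<alpha> ^ k \<alpha>) \<le> (\<Prod>\<alpha>\<in>S. (\<delta> \<alpha> / 4) ^ k \<alpha>)"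
      unfolding prod_norm[symmetric] norm_power by (intro prod_mono conjI power_mono t) auto
    also have "\<dots> = (\<Prod>\<alpha>\<in>S. \<delta> \<alpha> ^ k \<alpha>) * (1/4) ^ sum k S"
    proof -
      have "\<delta> \<alpha> / 4 = \<delta> \<alpha> * (1/4)" for \<alpha> by simp
      then show ?thesis by (simp only: power_sum power_mult_distrib prod.distrib)
    qed
    finally have t': "norm (\<Prod>\<alpha>\<in>S. t \<alpha> ^ k \<alpha>) \<le> (\<Prod>\<alpha>\<in>S. \<delta> \<alpha> ^ k \<alpha>) * (1/4) ^ sum k S" .
    have "0 \<le> C * 2 ^ sum k S / (\<Prod>\<alpha>\<in>S. \<delta> \<alpha> ^ k \<alpha>)" using p[OF kh] norm_ge_zero order_trans by blast
    then have "norm (p k * (\<Prod>\<alpha>\<in>S. t \<alpha> ^ k \<alpha>)) \<le>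
       (C * 2 ^ sum k S / (\<Prod>\<alpha>\<in>S. \<delta> \<alpha> ^ k \<alpha>)) * ((\<Prod>\<alpha>\<in>S. \<delta> \<alpha> ^ k \<alpha>) * (1/4) ^ sum k S)"
      unfolding norm_mult by (intro mult_mono p[OF kh] t') auto
    also have "\<dots> = C * (2 ^ sum k S * (1/4) ^ sum k S)" using \<delta>k by simp
    also have "\<dots> = C * (1/2) ^ sum k S" by (simp flip: power_mult_distrib)
    finally show "norm (p k * (\<Prod>\<alpha>\<in>S. t \<alpha> ^ k \<alpha>)) \<le> C * (1/2) ^ sum k S" .
  qed auto
  then have "(\<lambda>k. p k * (\<Prod>\<alpha>\<in>S. t \<alpha> ^ k \<alpha>)) summable_on multi_idx S" by (rule abs_summable_summable)
  then obtain s' where s': "((\<lambda>k. p k * (\<Prod>\<alpha>\<in>S. t \<alpha> ^ k \<alpha>)) has_sum s') (multi_idx S)"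
    by (auto simp: summable_on_def)
  from has_sum_by_degree[OF fin this] s have "s' = s" by (rule sums_unique2)
  then show ?thesis using s' by simp
qed

section \<open>The generating function\<close>

lemma bc_rec: "2 * pi * \<i> * of_real x * bc (Suc j) x = bc j x - (if j = 0 then 1 else 0)"
  by (auto simp: bc_def field_simps)

text \<open>The series is t X / (t X - 2 pi i x) for \<open>x \<noteq> 0\<close> and 1 for
  \<open>x = 0\<close>. The multiplied-out identity covers both cases and is the form that
  \<open>partial_fraction\<close> expects.\<close>

lemma bc_fps_rec:
  "Abs_fps (\<lambda>j. bc j x * t ^ j) * (fps_const t * fps_X - fps_const (2 * pi * \<i> * of_real x)) = fps_const t * fps_X"
proof (rule fps_ext)
  fix n
  let ?U = "Abs_fps (\<lambda>j. bc j x * t ^ j)"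
  have "fps_nth (?U * (fps_const t * fps_X - fps_const (2 * pi * \<i> * of_real x))) n =
     (if n = 0 then 0 else t * (bc (n - 1) x * t ^ (n - 1))) - 2 * pi * \<i> * of_real x * (bc n x * t ^ n)"
  proof -
    have "?U * (fps_const t * fps_X - fps_const (2 * pi * \<i> * of_real x)) =
      fps_const t * (?U * fps_X) - fps_const (2 * pi * \<i> * of_real x) * ?U"
      by (simp only: right_diff_distrib mult_ac)
    then show ?thesis by simp
  qed
  also have "\<dots> = fps_nth (fps_const t * fps_X) n"
  proof (cases n)
    case 0
    have "2 * pi * \<i> * of_real x * bc 0 x = 0" by (simp add: bc_def)
    then show ?thesis using 0 by simp
  next
    case (Suc m)
    have "2 * pi * \<i> * of_real x * (bc n x * t ^ n) = (2 * pi * \<i> * of_real x * bc (Suc m) x) * t ^ n"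
      by (simp only: Suc mult.assoc)
    also have "\<dots> = (bc m x - (if m = 0 then 1 else 0)) * t ^ n" by (simp only: bc_rec)
    finally have e: "2 * pi * \<i> * of_real x * (bc n x * t ^ n) = (bc m x - (if m = 0 then 1 else 0)) * t ^ n" .
    show ?thesis unfolding e using Suc by (cases m) (auto simp: algebra_simps)
  qed
  finally show "fps_nth (?U * (fps_const t * fps_X - fps_const (2 * pi * \<i> * of_real x))) n = fps_nth (fps_const t * fps_X) n" .
qed

locale zeta_setup = root_datum D Sim for D Sim :: "'a::euclidean_space set" +
  fixes Ds :: "'a set" and nus :: "'a list" and \<phi> :: 'a
  assumes Ds_sub: "Ds \<subseteq> Dp" and Ds_span: "span Ds = UNIV"
    and nus_dist: "distinct nus" and nus_set: "set nus = Dp - Ds"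
    and phi: "\<forall>B\<in>bases_in Dp. \<forall>\<beta>\<in>B. \<phi> \<bullet> dualb B \<beta> \<noteq> 0"
begin

lemma finite_Ds: "finite Ds" using Ds_sub finite_Dp finite_subset by blast

text \<open>The listed roots all lie outside \<open>Ds\<close>, so the defining condition concerns
  only \<open>B - Ds\<close> and says that this part contains no broken circuit.\<close>

lemma VA_iff: "B \<in> VA Dp nus \<longleftrightarrow> B \<subseteq> Dp \<and> rbasis B \<and> nbc nus (B - Ds)"
proof -
  have "B \<inter> set (take j nus) = (B - Ds) \<inter> set (take j nus)" for j
    using set_take_subset[of j nus] nus_set by auto
  moreover have "B \<subseteq> Dp \<Longrightarrow> B - Ds \<subseteq> set nus" using nus_set by auto
  ultimately show ?thesis by (auto simp: VA_def bases_in_def rbasis_def nbc_def)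
qed

lemma finite_VA: "finite (VA Dp nus)"
  by (rule finite_subset[of _ "Pow Dp"]) (auto simp: VA_iff finite_Dp)

lemma VA_lattice: "B \<in> VA Dp nus \<Longrightarrow> basis_lattice Sim B"
  by (intro basis_lattice.intro Sim_rbasis coroot_Dp_lattice) (auto simp: VA_iff)

lemma VA_minus: "B \<in> VA Dp nus \<Longrightarrow> B - (Dp - Ds) = B \<inter> Ds"
  by (auto simp: VA_iff)

lemma VA_finite: "B \<in> VA Dp nus \<Longrightarrow> finite B"
  by (auto simp: VA_iff intro: rbasis_finite)

lemma VA_phi: "B \<in> VA Dp nus \<Longrightarrow> \<beta> \<in> B \<Longrightarrow> \<phi> \<bullet> dualb B \<beta> \<noteq> 0"
  using phi by (auto simp: VA_def)

text \<open>A basis splits into its part outside \<open>Ds\<close> and a completion inside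
  \<open>Ds\<close>. The outer sum is then governed by Whitney's theorem, the inner one by partial
  fractions.\<close>

lemma sum_VA:
  "(\<Sum>B\<in>VA Dp nus. h B) = (\<Sum>I | nbc nus I. \<Sum>J\<in>basis_completions I Ds. h (I \<union> J) :: 'b::comm_monoid_add)"
proof -
  have fin: "finite {I. nbc nus I}" by (rule finite_subset[of _ "Pow (set nus)"]) (auto simp: nbc_def)
  have fin': "finite (basis_completions I Ds)" for I
    by (rule finite_subset[of _ "Pow Ds"]) (auto simp: basis_completions_def finite_Ds)
  have bij: "bij_betw (\<lambda>(I, J). I \<union> J) (SIGMA I:{I. nbc nus I}. basis_completions I Ds) (VA Dp nus)"
  proof (rule bij_betwI[of _ _ _ "\<lambda>B. (B - Ds, B \<inter> Ds)"])
    show "(\<lambda>(I, J). I \<union> J) \<in> (SIGMA I:{I. nbc nus I}. basis_completions I Ds) \<rightarrow> VA Dp nus"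
    proof safe
      fix I J assume I: "nbc nus I" and J: "J \<in> basis_completions I Ds"
      have "I \<union> J - Ds = I" "I \<union> J \<subseteq> Dp" using I J nus_set Ds_sub by (auto simp: nbc_def basis_completions_def)
      then show "I \<union> J \<in> VA Dp nus" using I J by (simp add: VA_iff basis_completions_def)
    qed
    show "(\<lambda>B. (B - Ds, B \<inter> Ds)) \<in> VA Dp nus \<rightarrow> (SIGMA I:{I. nbc nus I}. basis_completions I Ds)"
    proof -
      have "B - Ds \<union> B \<inter> Ds = B" for B by auto
      then show ?thesis by (auto simp: VA_iff basis_completions_def)
    qed
    show "((case p of (I, J) \<Rightarrow> I \<union> J) - Ds, (case p of (I, J) \<Rightarrow> I \<union> J) \<inter> Ds) = p"
      if "p \<in> (SIGMA I:{I. nbc nus I}. basis_completions I Ds)" for p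
      using that nus_set by (auto simp: nbc_def basis_completions_def)
  qed auto
  show ?thesis
    using sum.reindex_bij_betw[OF bij, of h] sum.Sigma[of "{I. nbc nus I}" "\<lambda>I. basis_completions I Ds" "\<lambda>I J. h (I \<union> J)"] fin fin'
    by (simp add: case_prod_unfold)
qed

definition bcoef :: "('a \<Rightarrow> complex) \<Rightarrow> 'a set \<Rightarrow> complex" where
  "bcoef t B = (\<Prod>\<gamma>\<in>Dp - (B \<union> (Dp - Ds)). t \<gamma> / Fden Dp Ds B \<gamma> t)"

lemma span_union_Ds: "span (I \<union> Ds) = UNIV"
  using span_mono[of Ds "I \<union> Ds"] Ds_span by auto

text \<open>Only sets \<open>I\<close> orthogonal to \<open>v\<close> survive. For each of them the
  partial fractions modulo \<open>I\<close> give back the same product over \<open>Ds\<close>, so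
  the alternating sum over \<open>I\<close> factors out and becomes the indicator of avoiding the
  hyperplanes.\<close>

lemma nbc_partial_fraction:
  assumes reg: "F_regular Dp Ds nus t"
  defines "U \<equiv> \<lambda>v \<gamma>. Abs_fps (\<lambda>j. bc j (coroot \<gamma> \<bullet> v) * t \<gamma> ^ j)"
  shows "fps_const (if \<exists>\<nu>\<in>Dp - Ds. \<nu> \<bullet> v = 0 then 0 else 1) * (\<Prod>\<gamma>\<in>Ds. U v \<gamma>) =
    (\<Sum>B\<in>VA Dp nus. fps_const ((-1) ^ card (B - Ds) * bcoef t B * (\<Prod>\<nu>\<in>B - Ds. if coroot \<nu> \<bullet> v = 0 then 1 else 0)) * (\<Prod>\<beta>\<in>B \<inter> Ds. U v \<beta>))"
proof -
  have nz: "0 \<notin> Ds" "0 \<notin> set nus" using Ds_sub nus_set Dp_nonzero by auto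
  have inner: "(\<Sum>J\<in>basis_completions I Ds. fps_const ((-1) ^ card ((I \<union> J) - Ds) * bcoef t (I \<union> J) *
       (\<Prod>\<nu>\<in>(I \<union> J) - Ds. if coroot \<nu> \<bullet> v = 0 then 1 else 0)) * (\<Prod>\<beta>\<in>(I \<union> J) \<inter> Ds. U v \<beta>)) =
     (if \<forall>\<nu>\<in>I. \<nu> \<bullet> v = 0 then fps_const ((-1) ^ card I) * (\<Prod>\<gamma>\<in>Ds. U v \<gamma>) else 0)" if I: "nbc nus I" for I
  proof -
    have IDs: "I \<inter> Ds = {}" and Inz: "\<nu> \<in> I \<Longrightarrow> \<nu> \<noteq> 0" for \<nu> using I nus_set nz by (auto simp: nbc_def)
    have fI: "finite I" using I finite_subset by (auto simp: nbc_def)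
    have sets: "(I \<union> J) - Ds = I" "(I \<union> J) \<inter> Ds = J" if "J \<in> basis_completions I Ds" for J
      using that IDs by (auto simp: basis_completions_def)
    have ind: "(\<Prod>\<nu>\<in>I. if coroot \<nu> \<bullet> v = 0 then 1 else 0) = (if \<forall>\<nu>\<in>I. \<nu> \<bullet> v = 0 then 1 else (0::complex))"
      using fI Inz by (auto simp: prod_zero_iff coroot_inner_eq_0)
    show ?thesis
    proof (cases "\<forall>\<nu>\<in>I. \<nu> \<bullet> v = 0")
      case False
      then have "(\<Prod>\<nu>\<in>I. if coroot \<nu> \<bullet> v = 0 then 1 else 0) = (0::complex)" unfolding ind by simp
      then show ?thesis using False by (intro trans[OF sum.neutral]) (auto simp: sets)
    next
      case True
      have Fd: "Fden Dp Ds (I \<union> J) \<gamma> t = t \<gamma> - lin_ext I J t \<gamma>" if J: "J \<in> basis_completions I Ds" for J \<gamma>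
      proof -
        have "I \<union> J - (Dp - Ds) = J" using I J nus_set Ds_sub by (auto simp: nbc_def basis_completions_def)
        then show ?thesis by (simp add: Fden_def lin_ext_def)
      qed
      have dom: "Dp - ((I \<union> J) \<union> (Dp - Ds)) = Ds - J" if "J \<in> basis_completions I Ds" for J
        using Ds_sub IDs by auto
      have inVA: "I \<union> J \<in> VA Dp nus" if J: "J \<in> basis_completions I Ds" for J
        using I J nus_set Ds_sub sets[OF J] by (auto simp: VA_iff nbc_def basis_completions_def)
      have "(\<Prod>\<gamma>\<in>Ds. U v \<gamma>) = (\<Sum>J\<in>basis_completions I Ds. fps_const (\<Prod>\<gamma>\<in>Ds-J. t \<gamma> / (t \<gamma> - lin_ext I J t \<gamma>)) * (\<Prod>\<beta>\<in>J. U v \<beta>))"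
      proof (rule partial_fraction[OF finite_Ds IDs nz(1) nbc_independent[OF I] span_union_Ds])
        show "U v \<gamma> * (fps_const (t \<gamma>) * fps_X - fps_const (2 * pi * \<i> * of_real (coroot \<gamma> \<bullet> v))) = fps_const (t \<gamma>) * fps_X" for \<gamma>
          unfolding U_def by (rule bc_fps_rec)
        show "coroot \<nu> \<bullet> v = 0" if "\<nu> \<in> I" for \<nu> using True that Inz by (simp add: coroot_inner_eq)
        show "t \<gamma> - lin_ext I J t \<gamma> \<noteq> 0" if J: "J \<in> basis_completions I Ds" "\<gamma> \<in> Ds - J" for J \<gamma>
          using reg inVA[OF J(1)] dom[OF J(1)] J(2) Fd[OF J(1)] unfolding F_regular_def by metis
      qed
      also have "\<dots> = (\<Sum>J\<in>basis_completions I Ds. fps_const (bcoef t (I \<union> J)) * (\<Prod>\<beta>\<in>J. U v \<beta>))"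
        by (intro sum.cong refl) (simp add: bcoef_def dom Fd)
      finally have eq: "(\<Prod>\<gamma>\<in>Ds. U v \<gamma>) = (\<Sum>J\<in>basis_completions I Ds. fps_const (bcoef t (I \<union> J)) * (\<Prod>\<beta>\<in>J. U v \<beta>))" .
      have "(\<Sum>J\<in>basis_completions I Ds. fps_const ((-1) ^ card ((I \<union> J) - Ds) * bcoef t (I \<union> J) *
         (\<Prod>\<nu>\<in>(I \<union> J) - Ds. if coroot \<nu> \<bullet> v = 0 then 1 else 0)) * (\<Prod>\<beta>\<in>(I \<union> J) \<inter> Ds. U v \<beta>)) =
        (\<Sum>J\<in>basis_completions I Ds. fps_const ((-1) ^ card I) * (fps_const (bcoef t (I \<union> J)) * (\<Prod>\<beta>\<in>J. U v \<beta>)))"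
      proof (intro sum.cong refl)
        fix J assume J: "J \<in> basis_completions I Ds"
        have ind1: "(\<Prod>\<nu>\<in>I. if coroot \<nu> \<bullet> v = 0 then 1 else 0) = (1::complex)" unfolding ind using True by simp
        show "fps_const ((-1) ^ card ((I \<union> J) - Ds) * bcoef t (I \<union> J) *
         (\<Prod>\<nu>\<in>(I \<union> J) - Ds. if coroot \<nu> \<bullet> v = 0 then 1 else 0)) * (\<Prod>\<beta>\<in>(I \<union> J) \<inter> Ds. U v \<beta>) =
         fps_const ((-1) ^ card I) * (fps_const (bcoef t (I \<union> J)) * (\<Prod>\<beta>\<in>J. U v \<beta>))"
          unfolding sets[OF J] ind1 fps_const_mult[symmetric] by (simp only: mult.assoc mult_1_right fps_const_1_eq_1 mult_1_left)
      qed
      then show ?thesis unfolding if_P[OF True] eq by (simp only: sum_distrib_left)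
    qed
  qed
  have "(\<Sum>B\<in>VA Dp nus. fps_const ((-1) ^ card (B - Ds) * bcoef t B * (\<Prod>\<nu>\<in>B - Ds. if coroot \<nu> \<bullet> v = 0 then 1 else 0)) * (\<Prod>\<beta>\<in>B \<inter> Ds. U v \<beta>)) =
    (\<Sum>I | nbc nus I. if \<forall>\<nu>\<in>I. \<nu> \<bullet> v = 0 then fps_const ((-1) ^ card I) * (\<Prod>\<gamma>\<in>Ds. U v \<gamma>) else 0)"
    unfolding sum_VA by (intro sum.cong refl inner) simp
  also have "\<dots> = (\<Sum>I | nbc nus I \<and> (\<forall>\<nu>\<in>I. \<nu> \<bullet> v = 0). fps_const ((-1) ^ card I) * (\<Prod>\<gamma>\<in>Ds. U v \<gamma>))"
    by (rule sum.mono_neutral_cong_right) (auto intro: finite_subset[of _ "Pow (set nus)"] simp: nbc_def)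
  also have "\<dots> = fps_const (\<Sum>I | nbc nus I \<and> (\<forall>\<nu>\<in>I. \<nu> \<bullet> v = 0). (-1) ^ card I) * (\<Prod>\<gamma>\<in>Ds. U v \<gamma>)"
    by (simp only: sum_distrib_right fps_const_sum[symmetric])
  finally show ?thesis
    using nbc_alternating_sum[OF nus_dist nz(2), of v] by (simp only: nus_set)
qed

text \<open>The coefficient of the monomial with exponents \<open>k\<close> in the summand of the
  generating series at \<open>v\<close>, extended by 0 off the weight lattice.\<close>

definition freq_term :: "('a \<Rightarrow> nat) \<Rightarrow> 'a \<Rightarrow> 'a \<Rightarrow> complex" where
  "freq_term k y v = (if v \<in> int_dual Sim then expi (y \<bullet> v) * (if \<exists>\<nu>\<in>Dp - Ds. \<nu> \<bullet> v = 0 then 0 else 1) *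
      (\<Prod>\<alpha>\<in>Ds. bc (k \<alpha>) (coroot \<alpha> \<bullet> v)) else 0)"

definition basis_term :: "'a set \<Rightarrow> ('a \<Rightarrow> nat) \<Rightarrow> 'a \<Rightarrow> 'a \<Rightarrow> complex" where
  "basis_term B j y v = (if v \<in> int_dual Sim then expi (y \<bullet> v) * (\<Prod>\<nu>\<in>B - Ds. if coroot \<nu> \<bullet> v = 0 then 1 else 0) *
      (\<Prod>\<beta>\<in>B \<inter> Ds. bc (j \<beta>) (coroot \<beta> \<bullet> v)) else 0)"

text \<open>Coefficients of X^n in \<open>nbc_partial_fraction\<close>. The left side is polynomial
  in \<open>t\<close>, although the single basis coefficients on the right are rational.\<close>

lemma freq_term_expand:
  assumes reg: "F_regular Dp Ds nus t"
  shows "(\<Sum>k\<in>hom_idx Ds n. freq_term k y v * (\<Prod>\<alpha>\<in>Ds. t \<alpha> ^ k \<alpha>)) =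
    (\<Sum>B\<in>VA Dp nus. ((-1) ^ card (B - Ds) * bcoef t B) * (\<Sum>j\<in>hom_idx (B \<inter> Ds) n. (\<Prod>\<beta>\<in>B \<inter> Ds. t \<beta> ^ j \<beta>) * basis_term B j y v))"
proof (cases "v \<in> int_dual Sim")
  case True
  have "fps_nth (fps_const (if \<exists>\<nu>\<in>Dp - Ds. \<nu> \<bullet> v = 0 then 0 else 1) * (\<Prod>\<gamma>\<in>Ds. Abs_fps (\<lambda>j. bc j (coroot \<gamma> \<bullet> v) * t \<gamma> ^ j))) n =
    fps_nth (\<Sum>B\<in>VA Dp nus. fps_const ((-1) ^ card (B - Ds) * bcoef t B * (\<Prod>\<nu>\<in>B - Ds. if coroot \<nu> \<bullet> v = 0 then 1 else 0)) *
      (\<Prod>\<gamma>\<in>B \<inter> Ds. Abs_fps (\<lambda>j. bc j (coroot \<gamma> \<bullet> v) * t \<gamma> ^ j))) n"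
    by (simp only: nbc_partial_fraction[OF reg])
  then have eq: "(if \<exists>\<nu>\<in>Dp - Ds. \<nu> \<bullet> v = 0 then 0 else 1) * (\<Sum>k\<in>hom_idx Ds n. \<Prod>\<gamma>\<in>Ds. bc (k \<gamma>) (coroot \<gamma> \<bullet> v) * t \<gamma> ^ k \<gamma>) =
    (\<Sum>B\<in>VA Dp nus. ((-1) ^ card (B - Ds) * bcoef t B * (\<Prod>\<nu>\<in>B - Ds. if coroot \<nu> \<bullet> v = 0 then 1 else 0)) *
      (\<Sum>j\<in>hom_idx (B \<inter> Ds) n. \<Prod>\<gamma>\<in>B \<inter> Ds. bc (j \<gamma>) (coroot \<gamma> \<bullet> v) * t \<gamma> ^ j \<gamma>))"
    by (simp only: fps_sum_nth fps_mult_left_const_nth fps_nth_prod[OF finite_Ds] fps_nth_prod[OF finite_Int[OF disjI2[OF finite_Ds]]] fps_nth_Abs_fps)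
  have "(\<Sum>k\<in>hom_idx Ds n. freq_term k y v * (\<Prod>\<alpha>\<in>Ds. t \<alpha> ^ k \<alpha>)) =
     expi (y \<bullet> v) * ((if \<exists>\<nu>\<in>Dp - Ds. \<nu> \<bullet> v = 0 then 0 else 1) * (\<Sum>k\<in>hom_idx Ds n. \<Prod>\<gamma>\<in>Ds. bc (k \<gamma>) (coroot \<gamma> \<bullet> v) * t \<gamma> ^ k \<gamma>))"
    unfolding sum_distrib_left by (intro sum.cong refl) (simp add: freq_term_def True prod.distrib)
  also have "\<dots> = (\<Sum>B\<in>VA Dp nus. ((-1) ^ card (B - Ds) * bcoef t B) * (\<Sum>j\<in>hom_idx (B \<inter> Ds) n. (\<Prod>\<beta>\<in>B \<inter> Ds. t \<beta> ^ j \<beta>) * basis_term B j y v))"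
    unfolding eq unfolding sum_distrib_left
    by (intro sum.cong refl) (simp only: basis_term_def True if_True prod.distrib mult_ac)
  finally show ?thesis .
next
  case False
  then show ?thesis by (simp add: freq_term_def basis_term_def)
qed

definition mult_of :: "'a set \<Rightarrow> nat" where
  "mult_of B = (SOME m. m \<ge> 1 \<and> (\<forall>\<beta>\<in>B. real m *\<^sub>R dualb B \<beta> \<in> int_dual Sim))"

lemma mult_of:
  assumes "B \<in> VA Dp nus"
  shows "mult_of B \<ge> 1" "\<And>\<beta>. \<beta> \<in> B \<Longrightarrow> real (mult_of B) *\<^sub>R dualb B \<beta> \<in> int_dual Sim"
  using someI_ex[of "\<lambda>m. m \<ge> 1 \<and> (\<forall>\<beta>\<in>B. real m *\<^sub>R dualb B \<beta> \<in> int_dual Sim)"]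
    basis_lattice.dual_multiple[OF VA_lattice[OF assms]] unfolding mult_of_def by blast+

text \<open>Serves two purposes: the factors \<open>1 - expi\<close> of the difference steps are
  nonzero, and the brackets stay away from the jumps, where they depend on \<phi>.\<close>

definition generic :: "'a \<Rightarrow> bool" where
  "generic y \<longleftrightarrow> (\<forall>B\<in>VA Dp nus. \<forall>\<beta>\<in>B. real (mult_of B) * (y \<bullet> dualb B \<beta>) \<notin> \<int>)"

definition bracket_fps :: "'a set \<Rightarrow> ('a \<Rightarrow> complex) \<Rightarrow> 'a \<Rightarrow> 'a \<Rightarrow> complex fps" where
  "bracket_fps B t y \<beta> = Abs_fps (\<lambda>j. of_real (bpol j (bracket \<phi> B \<beta> y)) * t \<beta> ^ j)"

text \<open>\<open>Fcoef n t y\<close> is the coefficient of \<open>s\<^sup>n\<close> in \<open>F(st, y)\<close>.\<close>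

definition Fcoef :: "nat \<Rightarrow> ('a \<Rightarrow> complex) \<Rightarrow> 'a \<Rightarrow> complex" where
  "Fcoef n t y = (\<Sum>B\<in>VA Dp nus. (-1) ^ card ((Dp - Ds) - B) * bcoef t B * (1 / of_nat (card (quot_reps Sim B))) *
      (\<Sum>q\<in>quot_reps Sim B. fps_nth (\<Prod>\<beta>\<in>B \<inter> Ds. bracket_fps B t (y + q) \<beta>) n))"

lemma bracket_generic:
  assumes y: "generic y" and BV: "B \<in> VA Dp nus" "\<beta> \<in> B" and q: "q \<in> quot_reps Sim B"
  shows "bracket \<phi> B \<beta> (y + q) = frac ((y + q) \<bullet> dualb B \<beta>)"
proof -
  interpret basis_lattice Sim B by (rule VA_lattice[OF BV(1)])
  have "q \<bullet> (real (mult_of B) *\<^sub>R dualb B \<beta>) \<in> \<int>"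
    using q quot_reps_subset mult_of(2)[OF BV] by (intro coroot_lattice_inner_int[of q Sim]) auto
  then have 1: "real (mult_of B) * (q \<bullet> dualb B \<beta>) \<in> \<int>" by simp
  have "(y + q) \<bullet> dualb B \<beta> \<notin> \<int>"
  proof
    assume "(y + q) \<bullet> dualb B \<beta> \<in> \<int>"
    then have "real (mult_of B) * ((y + q) \<bullet> dualb B \<beta>) \<in> \<int>" by (intro Ints_mult) auto
    from Ints_diff[OF this 1] have "real (mult_of B) * (y \<bullet> dualb B \<beta>) \<in> \<int>"
      by (simp add: inner_add_left distrib_left)
    then show False using y BV by (auto simp: generic_def)
  qed
  then show ?thesis by (simp add: bracket_def frac_neg)
qed

lemma freq_gsum:
  assumes reg: "F_regular Dp Ds nus t" and y: "generic y"
  shows "gsum y (\<lambda>v. \<Sum>k\<in>hom_idx Ds n. freq_term k y v * (\<Prod>\<alpha>\<in>Ds. t \<alpha> ^ k \<alpha>)) ((-1) ^ card (Dp - Ds) * Fcoef n t y)"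
proof -
  have term_gsum: "gsum y (basis_term B j y) (1 / of_nat (card (quot_reps Sim B)) *
      (\<Sum>q\<in>quot_reps Sim B. \<Prod>\<beta>\<in>B \<inter> Ds. of_real (bpol (j \<beta>) (bracket \<phi> B \<beta> (y + q)))))" if BV: "B \<in> VA Dp nus" for B j
  proof -
    interpret basis_lattice Sim B by (rule VA_lattice[OF BV])
    have "B - B \<inter> Ds = B - Ds" by auto
    moreover have "(\<Sum>q\<in>quot_reps Sim B. \<Prod>\<beta>\<in>B \<inter> Ds. of_real (bpol (j \<beta>) (bracket \<phi> B \<beta> (y + q)))) =
      (\<Sum>q\<in>quot_reps Sim B. \<Prod>\<beta>\<in>B \<inter> Ds. of_real (bpol (j \<beta>) (frac ((y + q) \<bullet> dualb B \<beta>))) :: complex)"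
      using bracket_generic[OF y BV] by (intro sum.cong prod.cong refl) auto
    moreover have "gsum y (\<lambda>v. if v \<in> int_dual Sim then expi (y \<bullet> v) * (\<Prod>\<beta>\<in>B-B \<inter> Ds. if coroot \<beta> \<bullet> v = 0 then 1 else 0) *
                   (\<Prod>\<beta>\<in>B \<inter> Ds. bc (j \<beta>) (coroot \<beta> \<bullet> v)) else 0)
     (1 / of_nat (card (quot_reps Sim B)) * (\<Sum>q\<in>quot_reps Sim B. \<Prod>\<beta>\<in>B \<inter> Ds. of_real (bpol (j \<beta>) (frac ((y + q) \<bullet> dualb B \<beta>)))))"
      using y BV mult_of[OF BV] by (intro basis_term_gsum[where m = "mult_of B"]) (auto simp: generic_def)
    ultimately show ?thesis by (simp only: basis_term_def[abs_def])
  qed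
  have "gsum y (\<lambda>v. \<Sum>B\<in>VA Dp nus. ((-1) ^ card (B - Ds) * bcoef t B) * (\<Sum>j\<in>hom_idx (B \<inter> Ds) n. (\<Prod>\<beta>\<in>B \<inter> Ds. t \<beta> ^ j \<beta>) * basis_term B j y v))
    (\<Sum>B\<in>VA Dp nus. ((-1) ^ card (B - Ds) * bcoef t B) * (\<Sum>j\<in>hom_idx (B \<inter> Ds) n. (\<Prod>\<beta>\<in>B \<inter> Ds. t \<beta> ^ j \<beta>) *
      (1 / of_nat (card (quot_reps Sim B)) *
      (\<Sum>q\<in>quot_reps Sim B. \<Prod>\<beta>\<in>B \<inter> Ds. of_real (bpol (j \<beta>) (bracket \<phi> B \<beta> (y + q)))))))"
    by (intro gsum_sum gsum_scale term_gsum)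
  also have "(\<Sum>B\<in>VA Dp nus. ((-1) ^ card (B - Ds) * bcoef t B) * (\<Sum>j\<in>hom_idx (B \<inter> Ds) n. (\<Prod>\<beta>\<in>B \<inter> Ds. t \<beta> ^ j \<beta>) *
      (1 / of_nat (card (quot_reps Sim B)) *
      (\<Sum>q\<in>quot_reps Sim B. \<Prod>\<beta>\<in>B \<inter> Ds. of_real (bpol (j \<beta>) (bracket \<phi> B \<beta> (y + q))))))) = (-1) ^ card (Dp - Ds) * Fcoef n t y"
    unfolding Fcoef_def sum_distrib_left[of "(-1) ^ card (Dp - Ds)"]
  proof (rule sum.cong[OF refl])
    fix B assume B: "B \<in> VA Dp nus"
    \<comment> \<open>The count of \<open>Dp - Ds\<close> converts the Whitney sign, which counts
      roots of \<open>B\<close> outside \<open>Ds\<close>, into the sign of \<open>F\<close>, which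
      counts those missing from \<open>B\<close>; a global sign remains.\<close>
    have "Dp - Ds = (B - Ds) \<union> ((Dp - Ds) - B)" using B by (auto simp: VA_iff)
    then have "card (Dp - Ds) = card (B - Ds) + card ((Dp - Ds) - B)"
      using card_Un_disjoint[of "B - Ds" "(Dp - Ds) - B"] VA_finite[OF B] finite_Dp by auto
    then have sign: "(-1) ^ card (Dp - Ds) * (-1) ^ card ((Dp - Ds) - B) = ((-1) ^ card (B - Ds) :: complex)"
      by (simp add: power_add mult.assoc flip: power_mult_distrib)
    have "(\<Sum>j\<in>hom_idx (B \<inter> Ds) n. (\<Prod>\<beta>\<in>B \<inter> Ds. t \<beta> ^ j \<beta>) * (1 / of_nat (card (quot_reps Sim B)) *
        (\<Sum>q\<in>quot_reps Sim B. \<Prod>\<beta>\<in>B \<inter> Ds. of_real (bpol (j \<beta>) (bracket \<phi> B \<beta> (y + q)))))) =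
      1 / of_nat (card (quot_reps Sim B)) * (\<Sum>q\<in>quot_reps Sim B. \<Sum>j\<in>hom_idx (B \<inter> Ds) n.
         \<Prod>\<beta>\<in>B \<inter> Ds. of_real (bpol (j \<beta>) (bracket \<phi> B \<beta> (y + q))) * t \<beta> ^ j \<beta>)"
      unfolding prod.distrib sum_distrib_left
      by (subst sum.swap) (intro sum.cong refl, simp only: mult_ac)
    also have "\<dots> = 1 / of_nat (card (quot_reps Sim B)) * (\<Sum>q\<in>quot_reps Sim B. fps_nth (\<Prod>\<beta>\<in>B \<inter> Ds. bracket_fps B t (y + q) \<beta>) n)"
      by (simp only: fps_nth_prod[OF finite_Int[OF disjI2[OF finite_Ds]]] bracket_fps_def fps_nth_Abs_fps)
    finally show "((-1) ^ card (B - Ds) * bcoef t B) * (\<Sum>j\<in>hom_idx (B \<inter> Ds) n. (\<Prod>\<beta>\<in>B \<inter> Ds. t \<beta> ^ j \<beta>) *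
      (1 / of_nat (card (quot_reps Sim B)) *
      (\<Sum>q\<in>quot_reps Sim B. \<Prod>\<beta>\<in>B \<inter> Ds. of_real (bpol (j \<beta>) (bracket \<phi> B \<beta> (y + q)))))) =
      (-1) ^ card (Dp - Ds) * ((-1) ^ card (Dp - Ds - B) * bcoef t B * (1 / of_nat (card (quot_reps Sim B))) *
       (\<Sum>q\<in>quot_reps Sim B. fps_nth (\<Prod>\<beta>\<in>B \<inter> Ds. bracket_fps B t (y + q) \<beta>) n))"
      unfolding sign[symmetric] by (simp only: mult_ac)
  qed
  finally show ?thesis by (simp only: freq_term_expand[OF reg])
qed

end

section \<open>The Taylor coefficients of the generating function\<close>

lemma prod_fps_sums:
  fixes G :: "'a \<Rightarrow> complex fps"
  assumes fin: "finite S" and ab: "\<And>\<beta>. \<beta> \<in> S \<Longrightarrow> summable (\<lambda>j. norm (fps_nth (G \<beta>) j))"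
    and s: "\<And>\<beta>. \<beta> \<in> S \<Longrightarrow> fps_nth (G \<beta>) sums s \<beta>"
  shows "fps_nth (\<Prod>\<beta>\<in>S. G \<beta>) sums (\<Prod>\<beta>\<in>S. s \<beta>)"
proof -
  have ab': "(\<lambda>j. norm (fps_nth (G \<beta>) j)) summable_on UNIV" if "\<beta> \<in> S" for \<beta>
    using ab[OF that] by (intro summable_nonneg_imp_summable_on) auto
  have hs: "(fps_nth (G \<beta>) has_sum s \<beta>) UNIV" if "\<beta> \<in> S" for \<beta>
    by (rule norm_summable_imp_has_sum[OF ab[OF that] s[OF that]])
  have "((\<lambda>g. \<Prod>\<beta>\<in>S. fps_nth (G \<beta>) (g \<beta>)) has_sum (\<Prod>\<beta>\<in>S. infsum (fps_nth (G \<beta>)) UNIV)) (PiE S (\<lambda>_. UNIV))"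
    unfolding has_sum_iff
    using abs_summable_summable[OF abs_summable_prod_PiE[OF fin ab']] infsum_prod_PiE_abs[OF fin ab'] by auto
  also have "(\<Prod>\<beta>\<in>S. infsum (fps_nth (G \<beta>)) UNIV) = (\<Prod>\<beta>\<in>S. s \<beta>)"
    using hs by (intro prod.cong refl infsumI)
  also have "((\<lambda>g. \<Prod>\<beta>\<in>S. fps_nth (G \<beta>) (g \<beta>)) has_sum (\<Prod>\<beta>\<in>S. s \<beta>)) (PiE S (\<lambda>_. UNIV)) \<longleftrightarrow>
     ((\<lambda>k. \<Prod>\<beta>\<in>S. fps_nth (G \<beta>) (k \<beta>)) has_sum (\<Prod>\<beta>\<in>S. s \<beta>)) (multi_idx S)"
  proof -
    have bij: "bij_betw (\<lambda>g \<alpha>. if \<alpha> \<in> S then g \<alpha> else 0) (PiE S (\<lambda>_. UNIV :: nat set)) (multi_idx S)"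
      by (rule bij_betwI[of _ _ _ "\<lambda>k. restrict k S"])
         (auto simp: multi_idx_def PiE_def extensional_def fun_eq_iff)
    show ?thesis
      using has_sum_reindex_bij_betw[OF bij, of "\<lambda>k. \<Prod>\<beta>\<in>S. fps_nth (G \<beta>) (k \<beta>)"] by simp
  qed
  finally have "(\<lambda>n. \<Sum>k\<in>hom_idx S n. \<Prod>\<beta>\<in>S. fps_nth (G \<beta>) (k \<beta>)) sums (\<Prod>\<beta>\<in>S. s \<beta>)"
    by (rule has_sum_by_degree[OF fin])
  moreover have "fps_nth (\<Prod>\<beta>\<in>S. G \<beta>) = (\<lambda>n. \<Sum>k\<in>hom_idx S n. \<Prod>\<beta>\<in>S. fps_nth (G \<beta>) (k \<beta>))"
    by (rule ext) (rule fps_nth_prod[OF fin])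
  ultimately show ?thesis by simp
qed

text \<open>Each index of degree \<open>n\<close> contributes 2^(-n) to a convergent series. This is
  where the growth 2^n in the later estimates comes from.\<close>

lemma card_hom_idx_le:
  assumes "finite S" shows "real (card (hom_idx S n)) \<le> 2 ^ n * infsum (\<lambda>k. (1/2) ^ sum k S) (multi_idx S)"
proof -
  have "(\<Sum>k\<in>hom_idx S n. (1/2::real) ^ sum k S) \<le> infsum (\<lambda>k. (1/2) ^ sum k S) (multi_idx S)"
    using finite_hom_idx[OF assms]
    by (intro finite_sum_le_infsum summable_geometric_multi_idx assms) (auto simp: hom_idx_def)
  moreover have "(\<Sum>k\<in>hom_idx S n. (1/2::real) ^ sum k S) = real (card (hom_idx S n)) * (1/2) ^ n"
    by (simp add: hom_idx_def)
  ultimately have "2 ^ n * (real (card (hom_idx S n)) * (1/2) ^ n) \<le> 2 ^ n * infsum (\<lambda>k. (1/2) ^ sum k S) (multi_idx S)"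
    by (intro mult_left_mono) auto
  moreover have "2 ^ n * (real (card (hom_idx S n)) * (1/2) ^ n) = real (card (hom_idx S n))"
    by (simp add: power_divide)
  ultimately show ?thesis by simp
qed

lemma frac_right_limit:
  assumes a: "a > (0::real)"
  shows "\<forall>\<^sub>F c in at_right 0. frac (x + c * a) = frac x + c * a \<and> x + c * a \<notin> \<int>"
proof -
  have "\<forall>\<^sub>F c in at_right 0. c < (1 - frac x) / a"
    using a frac_lt_1[of x] by (intro eventually_at_right_less order_tendstoD(2)[OF tendsto_ident_at]) auto
  moreover have "\<forall>\<^sub>F c in at_right (0::real). c > 0" by (rule eventually_at_right_less)
  ultimately show ?thesis
  proof eventually_elim
    case (elim c)
    then have ca: "0 < c * a" "c * a < 1 - frac x" using a by (auto simp: field_simps)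
    have "\<lfloor>x + c * a\<rfloor> = \<lfloor>x\<rfloor>"
      by (rule floor_unique) (use ca in \<open>auto simp: frac_def, linarith\<close>)
    then have f: "frac (x + c * a) = frac x + c * a" by (simp add: frac_def)
    moreover have "frac x + c * a > 0" using ca frac_ge_0[of x] by linarith
    ultimately show ?case by (metis frac_eq_0_iff less_irrefl)
  qed
qed

context zeta_setup
begin

section \<open>Limits along \<phi> and bounds on the homogeneous parts\<close>

lemma bracket_bounds: "bracket \<phi> B \<beta> y \<in> {0..1}"
  unfolding bracket_def by (auto intro: less_imp_le frac_lt_1)

text \<open>The two cases of \<open>bracket\<close> are the right-continuous and the left-continuous
  fractional part. The sign of the pairing with \<phi> selects the one that is continuous in the
  direction of motion.\<close>

lemma bracket_right_limit:
  assumes "\<phi> \<bullet> dualb B \<beta> \<noteq> 0"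
  shows "((\<lambda>c. bracket \<phi> B \<beta> (z + c *\<^sub>R \<phi>)) \<longlongrightarrow> bracket \<phi> B \<beta> z) (at_right 0)"
proof -
  let ?a = "\<phi> \<bullet> dualb B \<beta>" and ?x = "z \<bullet> dualb B \<beta>"
  have "\<forall>\<^sub>F c in at_right 0. bracket \<phi> B \<beta> (z + c *\<^sub>R \<phi>) = bracket \<phi> B \<beta> z + c * ?a"
  proof (cases "?a > 0")
    case True
    show ?thesis using frac_right_limit[OF True, of ?x]
      by eventually_elim (simp add: bracket_def True inner_add_left)
  next
    case False
    then have "- ?a > 0" using assms by simp
    from frac_right_limit[OF this, of "- ?x"] show ?thesis
      by eventually_elim (use False in \<open>simp add: bracket_def inner_add_left\<close>)
  qed
  moreover have "((\<lambda>c. bracket \<phi> B \<beta> z + c * ?a) \<longlongrightarrow> bracket \<phi> B \<beta> z + 0 * ?a) (at_right 0)"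
    by (intro tendsto_intros)
  ultimately show ?thesis
    by (subst tendsto_cong) auto
qed

lemma eventually_generic: "\<forall>\<^sub>F c in at_right 0. generic (y + c *\<^sub>R \<phi>)"
  unfolding generic_def
proof (intro eventually_ball_finite ballI finite_VA)
  fix B assume B: "B \<in> VA Dp nus"
  show "finite B" by (rule VA_finite[OF B])
  fix \<beta> assume \<beta>: "\<beta> \<in> B"
  let ?m = "real (mult_of B)" and ?a = "\<phi> \<bullet> dualb B \<beta>" and ?x = "y \<bullet> dualb B \<beta>"
  have m: "?m > 0" using mult_of(1)[OF B] by simp
  show "\<forall>\<^sub>F c in at_right 0. ?m * ((y + c *\<^sub>R \<phi>) \<bullet> dualb B \<beta>) \<notin> \<int>"
  proof (cases "?a > 0")
    case True
    then have "?m * ?a > 0" using m by simp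
    from frac_right_limit[OF this, of "?m * ?x"] show ?thesis
      by eventually_elim (simp add: inner_add_left algebra_simps)
  next
    case False
    then have "?m * (- ?a) > 0" using VA_phi[OF B \<beta>] m by (intro mult_pos_pos) auto
    from frac_right_limit[OF this, of "- (?m * ?x)"] show ?thesis
    proof eventually_elim
      case (elim c)
      have "- (?m * ?x) + c * (?m * (- ?a)) = - (?m * ((y + c *\<^sub>R \<phi>) \<bullet> dualb B \<beta>))"
        by (simp add: inner_add_left algebra_simps)
      then show ?case using elim by (metis Ints_minus)
    qed
  qed
qed

lemma finite_VA_Int: "finite (B \<inter> Ds)" using finite_Ds by blast

lemma Fcoef_right_limit: "((\<lambda>c. Fcoef n t (y + c *\<^sub>R \<phi>)) \<longlongrightarrow> Fcoef n t y) (at_right 0)"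
proof -
  have lim: "((\<lambda>c. complex_of_real (bpol j (bracket \<phi> B \<beta> (y + c *\<^sub>R \<phi> + q)))) \<longlongrightarrow> of_real (bpol j (bracket \<phi> B \<beta> (y + q)))) (at_right 0)"
    if "B \<in> VA Dp nus" "\<beta> \<in> B \<inter> Ds" for j B \<beta> q
  proof -
    have "((\<lambda>c. bracket \<phi> B \<beta> ((y + q) + c *\<^sub>R \<phi>)) \<longlongrightarrow> bracket \<phi> B \<beta> (y + q)) (at_right 0)"
      using that by (intro bracket_right_limit VA_phi) auto
    then have "((\<lambda>c. bracket \<phi> B \<beta> (y + c *\<^sub>R \<phi> + q)) \<longlongrightarrow> bracket \<phi> B \<beta> (y + q)) (at_right 0)"
      by (simp add: add_ac)
    then show ?thesis unfolding bpol_eq by (intro tendsto_intros) auto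
  qed
  show ?thesis
    unfolding Fcoef_def fps_nth_prod[OF finite_VA_Int] bracket_fps_def fps_nth_Abs_fps
    by (intro tendsto_intros lim) auto
qed

text \<open>The rational factors of \<open>F\<close> are homogeneous of degree 0, so the grading by
  degree comes from the Bernoulli factors alone, whose series converge for arguments of norm below
  1.\<close>

lemma Fgen_sums:
  assumes reg: "F_regular Dp Ds nus t" and t1: "\<And>\<alpha>. \<alpha> \<in> Ds \<Longrightarrow> norm (t \<alpha>) < 1"
  shows "(\<lambda>n. Fcoef n t y) sums Fgen Dp Sim Ds nus \<phi> y t"
proof -
  have "(\<lambda>n. fps_nth (\<Prod>\<beta>\<in>B \<inter> Ds. bracket_fps B t (y + q) \<beta>) n) sums
      (\<Prod>\<beta>\<in>B \<inter> Ds. t \<beta> * exp (t \<beta> * of_real (bracket \<phi> B \<beta> (y + q))) / (exp (t \<beta>) - 1))" for B q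
  proof (rule prod_fps_sums[OF finite_VA_Int])
    fix \<beta> assume b: "\<beta> \<in> B \<inter> Ds"
    then have "t \<beta> \<noteq> 0" "norm (t \<beta>) < 1" using reg t1 by (auto simp: F_regular_def)
    from bern_gen_sums(1,2)[OF this bracket_bounds]
    show "summable (\<lambda>j. norm (fps_nth (bracket_fps B t (y + q) \<beta>) j))"
      "fps_nth (bracket_fps B t (y + q) \<beta>) sums (t \<beta> * exp (t \<beta> * of_real (bracket \<phi> B \<beta> (y + q))) / (exp (t \<beta>) - 1))"
      by (simp_all add: bracket_fps_def fps_nth_Abs_fps[abs_def])
  qed
  then have "(\<lambda>n. Fcoef n t y) sums (\<Sum>B\<in>VA Dp nus. (-1) ^ card ((Dp - Ds) - B) * bcoef t B * (1 / of_nat (card (quot_reps Sim B))) *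
      (\<Sum>q\<in>quot_reps Sim B. \<Prod>\<beta>\<in>B \<inter> Ds. t \<beta> * exp (t \<beta> * of_real (bracket \<phi> B \<beta> (y + q))) / (exp (t \<beta>) - 1)))"
    unfolding Fcoef_def by (intro sums_sum sums_mult)
  also have "\<dots> = Fgen Dp Sim Ds nus \<phi> y t"
    unfolding Fgen_def bcoef_def by (intro sum.cong refl) (simp only: VA_minus)
  finally show ?thesis .
qed

text \<open>Displays the coefficient 1 at \<gamma>, which shows that the denominator is a nonzero
  linear form, as \<open>torus_radii\<close> requires.\<close>

lemma Fden_linear:
  assumes B: "B \<in> VA Dp nus" and g: "\<gamma> \<in> Ds - B"
  shows "Fden Dp Ds B \<gamma> t = (\<Sum>\<alpha>\<in>Ds. t \<alpha> * ((if \<alpha> = \<gamma> then 1 else 0) - (if \<alpha> \<in> B then of_real (coroot \<gamma> \<bullet> dualb B \<alpha>) else 0)))"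
proof -
  have "(\<Sum>\<beta>\<in>B \<inter> Ds. t \<beta> * of_real (coroot \<gamma> \<bullet> dualb B \<beta>)) = (\<Sum>\<alpha>\<in>Ds. t \<alpha> * (if \<alpha> \<in> B then of_real (coroot \<gamma> \<bullet> dualb B \<alpha>) else 0))"
    using finite_Ds by (intro sum.mono_neutral_cong_left) auto
  moreover have "t \<gamma> = (\<Sum>\<alpha>\<in>Ds. t \<alpha> * (if \<alpha> = \<gamma> then 1 else 0))"
    using g finite_Ds by (simp add: if_distrib[of "(*) _"] cong: if_cong)
  ultimately show ?thesis unfolding Fden_def VA_minus[OF B]
    by (simp only: right_diff_distrib sum_subtractf)
qed

text \<open>All denominators are bounded below on one torus. They scale linearly, so regularity
  persists under positive scaling, and the resulting bound on \<open>Fcoef\<close> is uniform in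
  \<open>y\<close>.\<close>

lemma regular_torus:
  obtains \<delta> C where "\<And>\<alpha>. 0 < \<delta> \<alpha> \<and> \<delta> \<alpha> \<le> 1"
    and "\<And>N e s. 0 < s \<Longrightarrow> F_regular Dp Ds nus (\<lambda>\<alpha>. of_real s * torus_pt \<delta> N e \<alpha>)"
    and "\<And>n N e y. norm (Fcoef n (torus_pt \<delta> N e) y) \<le> C * 2 ^ n"
proof -
  define l :: "'a set \<Rightarrow> 'a \<Rightarrow> 'a \<Rightarrow> complex" where
    "l B \<gamma> \<alpha> = (if \<alpha> = \<gamma> then 1 else 0) - (if \<alpha> \<in> B then of_real (coroot \<gamma> \<bullet> dualb B \<alpha>) else 0)" for B \<gamma> \<alpha>
  define L where "L = (\<lambda>(B, \<gamma>). l B \<gamma>) ` (SIGMA B:VA Dp nus. Ds - B)"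
  have "finite L" unfolding L_def using finite_VA finite_Ds by auto
  moreover have "\<exists>\<alpha>\<in>Ds. f \<alpha> \<noteq> 0" if "f \<in> L" for f
    using that by (auto simp: L_def l_def intro!: bexI)
  ultimately have "\<exists>\<delta> \<kappa>. (\<forall>\<alpha>. 0 < \<delta> \<alpha> \<and> \<delta> \<alpha> \<le> 1) \<and> 0 < \<kappa> \<and>
     (\<forall>l\<in>L. \<forall>t::'a \<Rightarrow> complex. (\<forall>\<alpha>\<in>Ds. norm (t \<alpha>) = \<delta> \<alpha>) \<longrightarrow> \<kappa> \<le> norm (\<Sum>\<alpha>\<in>Ds. t \<alpha> * l \<alpha>))"
    by (rule torus_radii[OF finite_Ds])
  then obtain \<delta> \<kappa> where \<delta>: "\<And>\<alpha>. 0 < \<delta> \<alpha> \<and> \<delta> \<alpha> \<le> 1" and \<kappa>: "0 < \<kappa>"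
    and low: "\<And>f t. f \<in> L \<Longrightarrow> (\<forall>\<alpha>\<in>Ds. norm (t \<alpha>) = \<delta> \<alpha>) \<Longrightarrow> \<kappa> \<le> norm (\<Sum>\<alpha>\<in>Ds. t \<alpha> * f \<alpha>)"
    by blast
  have nt: "norm (torus_pt \<delta> N e \<alpha>) = \<delta> \<alpha>" for N e \<alpha>
    using \<delta>[of \<alpha>] by (simp add: torus_pt_def norm_mult)
  have den: "\<kappa> \<le> norm (Fden Dp Ds B \<gamma> (torus_pt \<delta> N e))" if "B \<in> VA Dp nus" "\<gamma> \<in> Ds - B" for B \<gamma> N e
  proof -
    have "l B \<gamma> \<in> L" using that by (auto simp: L_def)
    from low[OF this, of "torus_pt \<delta> N e"] show ?thesis
      by (simp add: nt Fden_linear[OF that] l_def)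
  qed
  have dom: "Dp - (B \<union> (Dp - Ds)) = Ds - B" for B using Ds_sub by auto
  have scale: "Fden Dp Ds B \<gamma> (\<lambda>\<alpha>. of_real s * t \<alpha>) = of_real s * Fden Dp Ds B \<gamma> t" for B \<gamma> s t
    by (simp add: Fden_def right_diff_distrib sum_distrib_left mult.assoc)
  have reg: "F_regular Dp Ds nus (\<lambda>\<alpha>. of_real s * torus_pt \<delta> N e \<alpha>)" if "0 < s" for N e s
    unfolding F_regular_def dom
  proof (intro conjI ballI)
    fix \<alpha> assume "\<alpha> \<in> Ds"
    have "norm (of_real s * torus_pt \<delta> N e \<alpha>) > 0" using that \<delta>[of \<alpha>] by (simp only: norm_mult nt) simp
    then show "of_real s * torus_pt \<delta> N e \<alpha> \<noteq> 0" by auto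
  next
    fix B \<gamma> assume "B \<in> VA Dp nus" "\<gamma> \<in> Ds - B"
    from den[OF this, of N e] \<kappa> have "Fden Dp Ds B \<gamma> (torus_pt \<delta> N e) \<noteq> 0" by auto
    then show "Fden Dp Ds B \<gamma> (\<lambda>\<alpha>. of_real s * torus_pt \<delta> N e \<alpha>) \<noteq> 0" unfolding scale using that by simp
  qed
  \<comment> \<open>Each quotient is at most 1 / \<kappa> because the radii are at most 1; the
    maximum with 1 allows the exponent to be raised to \<open>card Ds\<close>.\<close>
  define K where "K = (max 1 (1 / \<kappa>)) ^ card Ds"
  have K: "norm (bcoef (torus_pt \<delta> N e) B) \<le> K" if B: "B \<in> VA Dp nus" for N e B
  proof -
    have "norm (bcoef (torus_pt \<delta> N e) B) = (\<Prod>\<gamma>\<in>Ds - B. \<delta> \<gamma> / norm (Fden Dp Ds B \<gamma> (torus_pt \<delta> N e)))"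
      by (simp add: bcoef_def dom nt norm_divide flip: prod_norm)
    also have "\<dots> \<le> (\<Prod>\<gamma>\<in>Ds - B. max 1 (1 / \<kappa>))"
    proof (rule prod_mono, intro conjI)
      fix \<gamma> assume g: "\<gamma> \<in> Ds - B"
      have "\<delta> \<gamma> / norm (Fden Dp Ds B \<gamma> (torus_pt \<delta> N e)) \<le> 1 / \<kappa>"
        using \<delta>[of \<gamma>] den[OF B g] \<kappa> by (intro frac_le) auto
      then show "\<delta> \<gamma> / norm (Fden Dp Ds B \<gamma> (torus_pt \<delta> N e)) \<le> max 1 (1 / \<kappa>)" by simp
      show "0 \<le> \<delta> \<gamma> / norm (Fden Dp Ds B \<gamma> (torus_pt \<delta> N e))" using \<delta>[of \<gamma>] by simp
    qed
    also have "\<dots> \<le> K" unfolding K_def prod_constant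
      using finite_Ds by (intro power_increasing card_mono) auto
    finally show ?thesis .
  qed
  have K0: "K \<ge> 0" by (simp add: K_def)
  define G :: "'a set \<Rightarrow> real" where
    "G B = infsum (\<lambda>k. (1/2) ^ sum k (B \<inter> Ds)) (multi_idx (B \<inter> Ds)) * 3 ^ card (B \<inter> Ds)" for B
  have G: "norm (fps_nth (\<Prod>\<beta>\<in>B \<inter> Ds. bracket_fps B (torus_pt \<delta> N e) z \<beta>) n) \<le> G B * 2 ^ n" for B N e z n
  proof -
    have "norm (fps_nth (\<Prod>\<beta>\<in>B \<inter> Ds. bracket_fps B (torus_pt \<delta> N e) z \<beta>) n) \<le>
      (\<Sum>j\<in>hom_idx (B \<inter> Ds) n. norm (\<Prod>\<beta>\<in>B \<inter> Ds. of_real (bpol (j \<beta>) (bracket \<phi> B \<beta> z)) * torus_pt \<delta> N e \<beta> ^ j \<beta>))"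
      unfolding fps_nth_prod[OF finite_VA_Int] bracket_fps_def fps_nth_Abs_fps by (rule norm_sum)
    also have "\<dots> \<le> (\<Sum>j\<in>hom_idx (B \<inter> Ds) n. 3 ^ card (B \<inter> Ds))"
    proof (rule sum_mono)
      fix j
      have "norm (\<Prod>\<beta>\<in>B \<inter> Ds. of_real (bpol (j \<beta>) (bracket \<phi> B \<beta> z)) * torus_pt \<delta> N e \<beta> ^ j \<beta>) \<le> (\<Prod>\<beta>\<in>B \<inter> Ds. 3)"
        unfolding prod_norm[symmetric]
      proof (rule prod_mono, intro conjI)
        fix \<beta>
        have "\<delta> \<beta> ^ j \<beta> \<le> 1" using \<delta>[of \<beta>] by (intro power_le_one) auto
        then show "norm (of_real (bpol (j \<beta>) (bracket \<phi> B \<beta> z)) * torus_pt \<delta> N e \<beta> ^ j \<beta>) \<le> 3"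
          using abs_bpol_le[OF bracket_bounds, of "j \<beta>" B \<beta> z] \<delta>[of \<beta>]
            mult_mono[of "\<bar>bpol (j \<beta>) (bracket \<phi> B \<beta> z)\<bar>" 3 "\<delta> \<beta> ^ j \<beta>" 1]
          by (simp add: norm_mult norm_power nt)
      qed auto
      then show "norm (\<Prod>\<beta>\<in>B \<inter> Ds. of_real (bpol (j \<beta>) (bracket \<phi> B \<beta> z)) * torus_pt \<delta> N e \<beta> ^ j \<beta>) \<le> 3 ^ card (B \<inter> Ds)"
        by simp
    qed
    also have "\<dots> = real (card (hom_idx (B \<inter> Ds) n)) * 3 ^ card (B \<inter> Ds)" by simp
    also have "\<dots> \<le> (2 ^ n * infsum (\<lambda>k. (1/2) ^ sum k (B \<inter> Ds)) (multi_idx (B \<inter> Ds))) * 3 ^ card (B \<inter> Ds)"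
      by (intro mult_right_mono card_hom_idx_le finite_VA_Int) auto
    finally show ?thesis by (simp add: G_def mult_ac)
  qed
  have G0: "G B \<ge> 0" for B unfolding G_def by (intro mult_nonneg_nonneg infsum_nonneg) auto
  define C where "C = (\<Sum>B\<in>VA Dp nus. K * G B)"
  have "norm (Fcoef n (torus_pt \<delta> N e) y) \<le> C * 2 ^ n" for n N e y
  proof -
    have "norm (Fcoef n (torus_pt \<delta> N e) y) \<le> (\<Sum>B\<in>VA Dp nus. K * G B * 2 ^ n)"
      unfolding Fcoef_def
    proof (rule order_trans[OF norm_sum], rule sum_mono)
      fix B assume B: "B \<in> VA Dp nus"
      let ?Q = "quot_reps Sim B"
      have "norm (\<Sum>q\<in>?Q. fps_nth (\<Prod>\<beta>\<in>B \<inter> Ds. bracket_fps B (torus_pt \<delta> N e) (y + q) \<beta>) n) \<le> (\<Sum>q\<in>?Q. G B * 2 ^ n)"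
        by (rule order_trans[OF norm_sum], rule sum_mono) (rule G)
      then have q: "norm (\<Sum>q\<in>?Q. fps_nth (\<Prod>\<beta>\<in>B \<inter> Ds. bracket_fps B (torus_pt \<delta> N e) (y + q) \<beta>) n) \<le> real (card ?Q) * (G B * 2 ^ n)"
        by simp
      have "1 / real (card ?Q) * norm (\<Sum>q\<in>?Q. fps_nth (\<Prod>\<beta>\<in>B \<inter> Ds. bracket_fps B (torus_pt \<delta> N e) (y + q) \<beta>) n) \<le> G B * 2 ^ n"
      proof (cases "card ?Q = 0")
        case False
        then show ?thesis using q by (simp add: field_simps)
      qed (simp add: G0)
      then have "norm (bcoef (torus_pt \<delta> N e) B) * (1 / real (card ?Q) * norm (\<Sum>q\<in>?Q. fps_nth (\<Prod>\<beta>\<in>B \<inter> Ds. bracket_fps B (torus_pt \<delta> N e) (y + q) \<beta>) n)) \<le> K * (G B * 2 ^ n)"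
        by (rule mult_mono[OF K[OF B] _ K0]) simp
      then show "norm ((-1) ^ card ((Dp - Ds) - B) * bcoef (torus_pt \<delta> N e) B * (1 / of_nat (card ?Q)) *
        (\<Sum>q\<in>?Q. fps_nth (\<Prod>\<beta>\<in>B \<inter> Ds. bracket_fps B (torus_pt \<delta> N e) (y + q) \<beta>) n)) \<le> K * G B * 2 ^ n"
        by (simp add: norm_mult norm_divide norm_power mult.assoc)
    qed
    also have "\<dots> = C * 2 ^ n" by (simp add: C_def sum_distrib_right)
    finally show ?thesis .
  qed
  with \<delta> reg show ?thesis by (rule that)
qed

text \<open>The norms of the terms do not depend on \<open>y\<close>, so the Weierstrass test gives
  uniform convergence along the whole line.\<close>

lemma weight_sum_right_limit:
  assumes "(\<lambda>v. norm (weight_term k y v)) summable_on regular_weights"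
  shows "((\<lambda>c. infsum (weight_term k (y + c *\<^sub>R \<phi>)) regular_weights) \<longlongrightarrow> infsum (weight_term k y) regular_weights) (at_right 0)"
proof -
  have n: "norm (weight_term k z v) = norm (weight_term k y v)" for z v
    by (simp add: weight_term_def norm_mult)
  have "uniform_limit UNIV (\<lambda>X c. \<Sum>v\<in>X. weight_term k (y + c *\<^sub>R \<phi>) v) (\<lambda>c. infsum (weight_term k (y + c *\<^sub>R \<phi>)) regular_weights) (finite_subsets_at_top regular_weights)"
    by (rule Weierstrass_m_test_general[OF _ assms]) (rule eq_refl[OF n])
  then have "continuous_on UNIV (\<lambda>c. infsum (weight_term k (y + c *\<^sub>R \<phi>)) regular_weights)"
  proof (rule uniform_limit_theorem[rotated])
    show "\<forall>\<^sub>F X in finite_subsets_at_top regular_weights. continuous_on UNIV (\<lambda>c. \<Sum>v\<in>X. weight_term k (y + c *\<^sub>R \<phi>) v)"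
      unfolding weight_term_def by (intro always_eventually allI continuous_intros)
  qed auto
  then have "isCont (\<lambda>c. infsum (weight_term k (y + c *\<^sub>R \<phi>)) regular_weights) 0"
    by (simp add: continuous_on_eq_continuous_at)
  then have "((\<lambda>c. infsum (weight_term k (y + c *\<^sub>R \<phi>)) regular_weights) \<longlongrightarrow> infsum (weight_term k (y + 0 *\<^sub>R \<phi>)) regular_weights) (at 0)"
    by (simp add: isCont_def)
  then show ?thesis by (simp add: tendsto_within_subset[of _ _ _ UNIV])
qed

text \<open>At a singular weight either the indicator vanishes or a root of \<open>Ds\<close> is
  orthogonal to it, and then \<open>bc\<close> is 0 since the exponent is positive. At a regular
  weight each root of \<open>Ds\<close> contributes a sign -1 and a power of 2 pi i.\<close>

lemma freq_term_eq_weight_term: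
  assumes k2: "\<forall>\<alpha>\<in>Ds. k \<alpha> \<ge> 2" and k0: "\<forall>\<alpha>\<in>Dp - Ds. k \<alpha> = 0"
  shows "freq_term (\<lambda>\<alpha>. if \<alpha> \<in> Ds then k \<alpha> else 0) y v =
    (if v \<in> regular_weights then (-1) ^ card Ds / (\<Prod>\<alpha>\<in>Ds. (2 * of_real pi * \<i>) ^ k \<alpha>) * weight_term k y v else 0)"
proof (cases "v \<in> int_dual Sim")
  case False
  then show ?thesis by (simp add: freq_term_def regular_weights_def)
next
  case True
  have bcs: "(\<Prod>\<alpha>\<in>Ds. bc (if \<alpha> \<in> Ds then k \<alpha> else 0) (coroot \<alpha> \<bullet> v)) = (\<Prod>\<alpha>\<in>Ds. bc (k \<alpha>) (coroot \<alpha> \<bullet> v))"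
    by (intro prod.cong) auto
  show ?thesis
  proof (cases "v \<in> regular_weights")
    case reg: True
    then have ne: "coroot \<alpha> \<bullet> v \<noteq> 0" if "\<alpha> \<in> Dp" for \<alpha> using that by (auto simp: regular_weights_def)
    have A: "\<not> (\<exists>\<nu>\<in>Dp - Ds. \<nu> \<bullet> v = 0)"
      using ne Dp_nonzero by (auto simp: coroot_inner_eq_0)
    have "(\<Prod>\<alpha>\<in>Ds. bc (k \<alpha>) (coroot \<alpha> \<bullet> v)) = (\<Prod>\<alpha>\<in>Ds. - 1 / (2 * of_real pi * \<i>) ^ k \<alpha> * inverse (of_real (coroot \<alpha> \<bullet> v) ^ k \<alpha>))"
    proof (intro prod.cong refl)
      fix \<alpha> assume a: "\<alpha> \<in> Ds"
      then have "k \<alpha> \<noteq> 0" "coroot \<alpha> \<bullet> v \<noteq> 0" using k2 ne Ds_sub by auto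
      then show "bc (k \<alpha>) (coroot \<alpha> \<bullet> v) = - 1 / (2 * of_real pi * \<i>) ^ k \<alpha> * inverse (of_real (coroot \<alpha> \<bullet> v) ^ k \<alpha>)"
        by (simp add: bc_def power_mult_distrib divide_inverse)
    qed
    also have "\<dots> = (-1) ^ card Ds / (\<Prod>\<alpha>\<in>Ds. (2 * of_real pi * \<i>) ^ k \<alpha>) * (\<Prod>\<alpha>\<in>Ds. inverse (of_real (coroot \<alpha> \<bullet> v) ^ k \<alpha>))"
      by (simp only: prod.distrib prod_dividef prod_constant)
    also have "(\<Prod>\<alpha>\<in>Ds. inverse (of_real (coroot \<alpha> \<bullet> v) ^ k \<alpha>)) = (\<Prod>\<alpha>\<in>Dp. inverse (of_real (coroot \<alpha> \<bullet> v) ^ k \<alpha>) :: complex)"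
      using Ds_sub finite_Dp k0 by (intro prod.mono_neutral_left) auto
    finally have P: "(\<Prod>\<alpha>\<in>Ds. bc (k \<alpha>) (coroot \<alpha> \<bullet> v)) = (-1) ^ card Ds / (\<Prod>\<alpha>\<in>Ds. (2 * of_real pi * \<i>) ^ k \<alpha>) * (\<Prod>\<alpha>\<in>Dp. inverse (of_real (coroot \<alpha> \<bullet> v) ^ k \<alpha>))" .
    show ?thesis unfolding freq_term_def bcs P weight_term_def if_P[OF True] if_P[OF reg] if_not_P[OF A] by (simp only: mult_ac mult_1_left mult_1_right)
  next
    case nreg: False
    then obtain \<alpha> where \<alpha>: "\<alpha> \<in> Dp" "coroot \<alpha> \<bullet> v = 0" using True by (auto simp: regular_weights_def)
    show ?thesis
    proof (cases "\<alpha> \<in> Ds")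
      case True
      then have "bc (k \<alpha>) (coroot \<alpha> \<bullet> v) = 0" using k2 \<alpha> by (auto simp: bc_def)
      then have "(\<Prod>\<alpha>\<in>Ds. bc (k \<alpha>) (coroot \<alpha> \<bullet> v)) = 0" using True finite_Ds by (auto simp: prod_zero_iff)
      then show ?thesis using nreg by (simp add: freq_term_def bcs)
    next
      case False
      then have "\<exists>\<nu>\<in>Dp - Ds. \<nu> \<bullet> v = 0" using \<alpha> Dp_nonzero by (auto simp: coroot_inner_eq_0)
      then show ?thesis using nreg by (simp add: freq_term_def)
    qed
  qed
qed

lemma weight_sum_eq_Pcoef:
  assumes k2: "\<forall>\<alpha>\<in>Ds. k \<alpha> \<ge> 2" and k0: "\<forall>\<alpha>\<in>Dp - Ds. k \<alpha> = 0"
    and summ: "(\<lambda>v. norm (weight_term k y v)) summable_on regular_weights"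
  shows "infsum (weight_term k y) regular_weights =
    (-1) ^ card Dp * Pcoef Dp Sim Ds nus \<phi> y (\<lambda>\<alpha>. if \<alpha> \<in> Ds then k \<alpha> else 0) *
      (\<Prod>\<alpha>\<in>Ds. (2 * of_real pi * \<i>) ^ k \<alpha> / of_nat (fact (k \<alpha>)))"
proof -
  obtain \<delta> C where \<delta>: "\<And>\<alpha>. 0 < \<delta> \<alpha> \<and> \<delta> \<alpha> \<le> 1"
    and regs: "\<And>N e s. 0 < s \<Longrightarrow> F_regular Dp Ds nus (\<lambda>\<alpha>. of_real s * torus_pt \<delta> N e \<alpha>)"
    and C: "\<And>n N e y. norm (Fcoef n (torus_pt \<delta> N e) y) \<le> C * 2 ^ n"
    by (rule regular_torus) blast
  have reg: "F_regular Dp Ds nus (torus_pt \<delta> N e)" for N e using regs[of 1 N e] by simp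
  have \<delta>0: "\<And>\<alpha>. \<alpha> \<in> Ds \<Longrightarrow> 0 < \<delta> \<alpha>" using \<delta> by auto
  define p where "p k y = coef_extract Ds \<delta> (sum k Ds) k (\<lambda>t. Fcoef (sum k Ds) t y)" for k y
  define \<epsilon> :: complex where "\<epsilon> = (-1) ^ card (Dp - Ds)"
  have \<epsilon>2: "\<epsilon> * \<epsilon> = 1" by (simp add: \<epsilon>_def flip: power_mult_distrib)

  \<comment> \<open>\<open>freq_gsum\<close> sums only whole homogeneous parts. Extraction combines
    finitely many of them, taken at torus points, and isolates a single multi-index.\<close>
  have freq_p: "gsum y (freq_term k y) (\<epsilon> * p k y)" if y: "generic y" and k: "k \<in> multi_idx Ds" for k y
  proof -
    define n where "n = sum k Ds"
    have kn: "k \<in> hom_idx Ds n" using k by (simp add: hom_idx_def n_def)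
    have "gsum y (\<lambda>v. coef_extract Ds \<delta> n k (\<lambda>t. \<Sum>k'\<in>hom_idx Ds n. freq_term k' y v * (\<Prod>\<alpha>\<in>Ds. t \<alpha> ^ k' \<alpha>)))
       (coef_extract Ds \<delta> n k (\<lambda>t. \<epsilon> * Fcoef n t y))"
      unfolding coef_extract_def \<epsilon>_def by (intro gsum_sum gsum_scale freq_gsum reg y)
    moreover have "coef_extract Ds \<delta> n k (\<lambda>t. \<Sum>k'\<in>hom_idx Ds n. freq_term k' y v * (\<Prod>\<alpha>\<in>Ds. t \<alpha> ^ k' \<alpha>)) = freq_term k y v" for v
      by (rule coef_extract_poly[OF finite_Ds \<delta>0 kn])
    moreover have "coef_extract Ds \<delta> n k (\<lambda>t. \<epsilon> * Fcoef n t y) = \<epsilon> * p k y"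
      by (simp add: p_def n_def coef_extract_def sum_distrib_left mult_ac)
    ultimately show ?thesis by simp
  qed

  have p_limit: "((\<lambda>c. p k (y + c *\<^sub>R \<phi>)) \<longlongrightarrow> p k y) (at_right 0)" for k
    unfolding p_def coef_extract_def by (intro tendsto_intros Fcoef_right_limit)

  \<comment> \<open>At any regular \<open>t\<close> the same lattice function now has two
    generalized sums, one from the basis expansion and one from the extracted coefficients;
    uniqueness equates them.\<close>
  have poly: "Fcoef n t y = (\<Sum>k\<in>hom_idx Ds n. p k y * (\<Prod>\<alpha>\<in>Ds. t \<alpha> ^ k \<alpha>))" if t: "F_regular Dp Ds nus t" for n t
  proof -
    have gen: "Fcoef n t z = (\<Sum>k\<in>hom_idx Ds n. p k z * (\<Prod>\<alpha>\<in>Ds. t \<alpha> ^ k \<alpha>))" if z: "generic z" for z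
    proof -
      have "gsum z (\<lambda>v. \<Sum>k\<in>hom_idx Ds n. (\<Prod>\<alpha>\<in>Ds. t \<alpha> ^ k \<alpha>) * freq_term k z v) (\<Sum>k\<in>hom_idx Ds n. (\<Prod>\<alpha>\<in>Ds. t \<alpha> ^ k \<alpha>) * (\<epsilon> * p k z))"
        by (intro gsum_sum gsum_scale freq_p z) (simp add: hom_idx_def)
      moreover have "gsum z (\<lambda>v. \<Sum>k\<in>hom_idx Ds n. (\<Prod>\<alpha>\<in>Ds. t \<alpha> ^ k \<alpha>) * freq_term k z v) (\<epsilon> * Fcoef n t z)"
        using freq_gsum[OF t z, of n] by (simp only: \<epsilon>_def mult.commute)
      ultimately have "\<epsilon> * Fcoef n t z = (\<Sum>k\<in>hom_idx Ds n. (\<Prod>\<alpha>\<in>Ds. t \<alpha> ^ k \<alpha>) * (\<epsilon> * p k z))"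
        by (rule gsum_unique[rotated])
      also have "\<dots> = \<epsilon> * (\<Sum>k\<in>hom_idx Ds n. p k z * (\<Prod>\<alpha>\<in>Ds. t \<alpha> ^ k \<alpha>))"
        by (simp add: sum_distrib_left mult_ac)
      finally have "\<epsilon> * (\<epsilon> * Fcoef n t z) = \<epsilon> * (\<epsilon> * (\<Sum>k\<in>hom_idx Ds n. p k z * (\<Prod>\<alpha>\<in>Ds. t \<alpha> ^ k \<alpha>)))" by simp
      then show ?thesis by (simp only: mult.assoc[symmetric] \<epsilon>2 mult_1_left)
    qed
    have "((\<lambda>c. \<Sum>k\<in>hom_idx Ds n. p k (y + c *\<^sub>R \<phi>) * (\<Prod>\<alpha>\<in>Ds. t \<alpha> ^ k \<alpha>)) \<longlongrightarrow> (\<Sum>k\<in>hom_idx Ds n. p k y * (\<Prod>\<alpha>\<in>Ds. t \<alpha> ^ k \<alpha>))) (at_right 0)"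
      by (intro tendsto_intros p_limit)
    moreover have "\<forall>\<^sub>F c in at_right 0. (\<Sum>k\<in>hom_idx Ds n. p k (y + c *\<^sub>R \<phi>) * (\<Prod>\<alpha>\<in>Ds. t \<alpha> ^ k \<alpha>)) = Fcoef n t (y + c *\<^sub>R \<phi>)"
      using eventually_generic[of y] by eventually_elim (simp add: gen)
    ultimately have "((\<lambda>c. Fcoef n t (y + c *\<^sub>R \<phi>)) \<longlongrightarrow> (\<Sum>k\<in>hom_idx Ds n. p k y * (\<Prod>\<alpha>\<in>Ds. t \<alpha> ^ k \<alpha>))) (at_right 0)"
      by (rule Lim_transform_eventually)
    then show ?thesis using Fcoef_right_limit[of n t y] by (intro tendsto_unique[OF _ Fcoef_right_limit]) auto
  qed

  have P: "Pcoef Dp Sim Ds nus \<phi> y = (\<lambda>k. if k \<in> multi_idx Ds then p k y * (\<Prod>\<alpha>\<in>Ds. of_nat (fact (k \<alpha>))) else 0)"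
  proof (rule Pcoef_eqI[OF finite_Ds \<delta> regs])
    \<comment> \<open>The minimum with 1 keeps the Bernoulli series convergent; the quarter is what
      \<open>has_sum_multi_idx\<close> asks for.\<close>
    define r where "r = Min (insert 1 (\<delta> ` Ds)) / 4"
    have fin: "finite (insert 1 (\<delta> ` Ds))" using finite_Ds by simp
    have "Min (insert 1 (\<delta> ` Ds)) > 0" using fin \<delta> by (subst Min_gr_iff) auto
    then show "r > 0" by (simp add: r_def)
    have r: "r \<le> 1 / 4" "\<And>\<alpha>. \<alpha> \<in> Ds \<Longrightarrow> r \<le> \<delta> \<alpha> / 4"
      unfolding r_def by (auto intro!: divide_right_mono Min_le fin)
    fix t assume t: "\<forall>\<alpha>\<in>Ds. norm (t \<alpha>) < r" and rt: "F_regular Dp Ds nus t"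
    have "((\<lambda>k. p k y * (\<Prod>\<alpha>\<in>Ds. t \<alpha> ^ k \<alpha>)) has_sum Fgen Dp Sim Ds nus \<phi> y t) (multi_idx Ds)"
    proof (rule has_sum_multi_idx[OF finite_Ds \<delta>0])
      show "norm (p k y) \<le> C * 2 ^ n / (\<Prod>\<alpha>\<in>Ds. \<delta> \<alpha> ^ k \<alpha>)" if "k \<in> hom_idx Ds n" for n k
        using that unfolding p_def hom_idx_def by (auto intro!: norm_coef_extract_le finite_Ds \<delta>0 C)
      show "norm (t \<alpha>) \<le> \<delta> \<alpha> / 4" if "\<alpha> \<in> Ds" for \<alpha> using t r(2) that by fastforce
      show "(\<lambda>n. \<Sum>k\<in>hom_idx Ds n. p k y * (\<Prod>\<alpha>\<in>Ds. t \<alpha> ^ k \<alpha>)) sums Fgen Dp Sim Ds nus \<phi> y t"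
        unfolding poly[OF rt, symmetric] using t r(1) by (intro Fgen_sums rt) force
    qed
    also have "?this \<longleftrightarrow> ((\<lambda>k. (if k \<in> multi_idx Ds then p k y * (\<Prod>\<alpha>\<in>Ds. of_nat (fact (k \<alpha>))) else 0) *
        (\<Prod>\<alpha>\<in>Ds. t \<alpha> ^ k \<alpha> / of_nat (fact (k \<alpha>)))) has_sum Fgen Dp Sim Ds nus \<phi> y t) (multi_idx Ds)"
      using finite_Ds by (intro has_sum_cong) (simp add: prod_dividef prod_zero_iff)
    finally show "((\<lambda>k. (if k \<in> multi_idx Ds then p k y * (\<Prod>\<alpha>\<in>Ds. of_nat (fact (k \<alpha>))) else 0) *
        (\<Prod>\<alpha>\<in>Ds. t \<alpha> ^ k \<alpha> / of_nat (fact (k \<alpha>)))) has_sum Fgen Dp Sim Ds nus \<phi> y t) (multi_idx Ds)" .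
  qed auto

  define k' where "k' = (\<lambda>\<alpha>. if \<alpha> \<in> Ds then k \<alpha> else 0)"
  have k': "k' \<in> multi_idx Ds" by (simp add: k'_def multi_idx_def)
  define W :: complex where "W = (\<Prod>\<alpha>\<in>Ds. (2 * of_real pi * \<i>) ^ k \<alpha>)"
  have W0: "W \<noteq> 0" using finite_Ds by (simp add: W_def prod_zero_iff)
  \<comment> \<open>For this multi-index the sum converges absolutely by \<open>summ\<close>, so its
    generalized sum is the ordinary one.\<close>
  have wsum: "\<epsilon> * p k' z = (-1) ^ card Ds / W * infsum (weight_term k z) regular_weights" if z: "generic z" for z
  proof -
    have n: "norm (weight_term k z v) = norm (weight_term k y v)" for v by (simp add: weight_term_def norm_mult)
    have "(weight_term k z has_sum infsum (weight_term k z) regular_weights) regular_weights"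
      by (rule has_sum_infsum, rule abs_summable_summable) (simp only: n summ)
    from has_sum_cmult_right[OF this, of "(-1) ^ card Ds / W"]
    have "((\<lambda>v. (-1) ^ card Ds / W * weight_term k z v) has_sum (-1) ^ card Ds / W * infsum (weight_term k z) regular_weights) regular_weights" .
    also have "?this \<longleftrightarrow> (freq_term k' z has_sum (-1) ^ card Ds / W * infsum (weight_term k z) regular_weights) UNIV"
      unfolding k'_def by (rule has_sum_cong_neutral) (auto simp: freq_term_eq_weight_term[OF k2 k0] W_def)
    finally show ?thesis using freq_p[OF z k'] by (intro gsum_unique[OF _ gsum_base]) auto
  qed
  have "((\<lambda>c. (-1) ^ card Ds / W * infsum (weight_term k (y + c *\<^sub>R \<phi>)) regular_weights) \<longlongrightarrow> (-1) ^ card Ds / W * infsum (weight_term k y) regular_weights) (at_right 0)"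
    by (intro tendsto_intros weight_sum_right_limit summ)
  moreover have "\<forall>\<^sub>F c in at_right 0. (-1) ^ card Ds / W * infsum (weight_term k (y + c *\<^sub>R \<phi>)) regular_weights = \<epsilon> * p k' (y + c *\<^sub>R \<phi>)"
    using eventually_generic[of y] by eventually_elim (simp add: wsum)
  ultimately have "((\<lambda>c. \<epsilon> * p k' (y + c *\<^sub>R \<phi>)) \<longlongrightarrow> (-1) ^ card Ds / W * infsum (weight_term k y) regular_weights) (at_right 0)"
    by (rule Lim_transform_eventually)
  moreover have "((\<lambda>c. \<epsilon> * p k' (y + c *\<^sub>R \<phi>)) \<longlongrightarrow> \<epsilon> * p k' y) (at_right 0)"
    by (intro tendsto_intros p_limit)
  ultimately have eq: "(-1) ^ card Ds / W * infsum (weight_term k y) regular_weights = \<epsilon> * p k' y"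
    by (rule tendsto_unique[rotated]) auto

  \<comment> \<open>The final sign combines one factor -1 for each root of \<open>Ds\<close>, from
    \<open>bc\<close>, with the global sign of \<open>freq_gsum\<close>, which counts the remaining
    roots.\<close>
  have "card Dp = card Ds + card (Dp - Ds)"
    using card_Un_disjoint[of Ds "Dp - Ds"] finite_Ds finite_Dp Ds_sub by (simp add: Un_absorb1)
  then have sgn: "(-1) ^ card Dp = (-1) ^ card Ds * \<epsilon>" by (simp add: \<epsilon>_def power_add)
  have s2: "(-1) ^ card Ds * (-1) ^ card Ds = (1::complex)" by (simp flip: power_mult_distrib)
  have "infsum (weight_term k y) regular_weights = (-1) ^ card Ds * W * ((-1) ^ card Ds / W * infsum (weight_term k y) regular_weights)"
    using W0 s2 by (simp add: mult_ac)
  also have "\<dots> = (-1) ^ card Dp * p k' y * W" unfolding eq sgn by (simp only: mult_ac)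
  also have "\<dots> = (-1) ^ card Dp * Pcoef Dp Sim Ds nus \<phi> y k' * (\<Prod>\<alpha>\<in>Ds. (2 * of_real pi * \<i>) ^ k \<alpha> / of_nat (fact (k \<alpha>)))"
  proof -
    have "(\<Prod>\<alpha>\<in>Ds. of_nat (fact (k' \<alpha>))) = (\<Prod>\<alpha>\<in>Ds. of_nat (fact (k \<alpha>)) :: complex)"
      by (intro prod.cong refl) (simp add: k'_def)
    moreover have "(\<Prod>\<alpha>\<in>Ds. of_nat (fact (k \<alpha>)) :: complex) \<noteq> 0" using finite_Ds by (simp add: prod_zero_iff)
    ultimately show ?thesis using k' unfolding P by (simp add: prod_dividef W_def)
  qed
  finally show ?thesis by (simp only: k'_def)
qed

end

theorem theorem3p9:
  fixes D Dp Sim Ds :: "'a::euclidean_space set" and nus :: "'a list" and \<phi> y :: 'a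
    and k :: "'a \<Rightarrow> nat"
  assumes "root_system D" and "reduced_rs D" and "irreducible_rs D"
    and "fundamental_system D Sim" and "Dp = positive_roots D Sim"
    and "root_set Dp Sim Ds"
    and "distinct nus" and "set nus = Dp - Ds"
    and "\<forall>B\<in>bases_in Dp. \<forall>\<beta>\<in>B. \<phi> \<bullet> dualb B \<beta> \<noteq> 0"
    and "DIM('a) = 1 \<longrightarrow> (\<forall>\<alpha>\<in>Sim. \<phi> = coroot \<alpha>)"
    and "\<forall>\<alpha>\<in>Ds. k \<alpha> \<ge> 2" and "\<forall>\<alpha>\<in>Dp - Ds. k \<alpha> = 0"
    and "\<forall>w\<in>weyl_group D.
           (\<lambda>lam. norm (zeta_term Dp (param_act Dp (inv w) k) (inv w y) lam)) summable_on Ppp Sim"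
  shows "(\<Sum>w\<in>weyl_group D.
            (\<Prod>\<alpha>\<in>{\<alpha>\<in>Dp. \<alpha> \<in> w ` (uminus ` Dp)}. (-1::complex) ^ k \<alpha>) *
            zeta_rs Dp Sim (param_act Dp (inv w) k) (inv w y))
         = (-1) ^ card Dp * Pcoef Dp Sim Ds nus \<phi> y (\<lambda>\<alpha>. if \<alpha> \<in> Ds then k \<alpha> else 0) *
           (\<Prod>\<alpha>\<in>Ds. (2 * of_real pi * \<i>) ^ k \<alpha> / of_nat (fact (k \<alpha>)))"
proof -
  interpret root_datum D Sim using assms(1,2,4) by unfold_locales
  note Dp_eq = assms(5)
  have Ds: "Ds \<subseteq> positive_roots D Sim" using assms(5,6) by (simp add: root_set_def)
  note zsum = weyl_zeta_sum[OF assms(13)[unfolded Dp_eq]]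
  \<comment> \<open>Absolute convergence supplies the spanning condition of
    \<open>zeta_setup\<close>, which lets partial fractions be taken over \<open>I\<close> together
    with \<open>Ds\<close> for every \<open>I\<close>.\<close>
  have sp: "span Ds = UNIV"
    using summable_imp_span[OF Ds _ zsum(2)] assms(12) by (simp add: Dp_eq)
  interpret zeta_setup D Sim Ds nus \<phi>
    using Ds sp assms(7,8,9) by unfold_locales (simp_all add: Dp_eq)
  have "(\<Sum>w\<in>weyl_group D. weyl_sign k w * zeta_rs (positive_roots D Sim) Sim (param_act (positive_roots D Sim) (inv w) k) (inv w y)) =
    infsum (weight_term k y) regular_weights"
    using zsum(1) by (simp add: infsumI)
  also have "\<dots> = (-1) ^ card (positive_roots D Sim) * Pcoef (positive_roots D Sim) Sim Ds nus \<phi> y (\<lambda>\<alpha>. if \<alpha> \<in> Ds then k \<alpha> else 0) *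
           (\<Prod>\<alpha>\<in>Ds. (2 * of_real pi * \<i>) ^ k \<alpha> / of_nat (fact (k \<alpha>)))"
    using weight_sum_eq_Pcoef[OF assms(11) _ zsum(2)] assms(12) by (simp add: Dp_eq)
  finally show ?thesis unfolding Dp_eq weyl_sign_def .
qed

end
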